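(* The decision version of the Minimum Paired Domination problem is NP-complete for GP$4$-graphs; that is, given a GP$4$-graph $G$ and a positive integer $k$, deciding whether $G$ has a paired dominating set of cardinality at most $k$ is NP-complete.
   Context: All graphs are finite and simple. A graph $G=(V,E)$ is a GP$4$-graph if it is obtained from a connected graph $H=(V_H,E_H)$ with $V_H=\{v_1,\dots,v_{n_H}\}$ by setting $V=V_H\cup\{w_i,x_i,y_i,z_i : i\in[n_H]\}$ (new distinct vertices) and $E=E_H\cup\{v_iw_i,\,w_ix_i,\,x_iy_i,\,y_iz_i : i\in[n_H]\}$. For a graph with no isolated vertices, a paired dominating set is a set $D$ of vertices such that every vertex outside $D$ has a neighbor in $D$ and the subgraph induced by $D$ has a perfect matching. *)

theory Defs
  imports "HOL-Computational_Algebra.Polynomial"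
begin

section \<open>Graphs, GP4-graphs and paired domination\<close>

definition simple_graph :: "'a set \<Rightarrow> 'a set set \<Rightarrow> bool" where
  "simple_graph V E \<longleftrightarrow> finite V \<and> (\<forall>e\<in>E. e \<subseteq> V \<and> card e = 2)"

text \<open>Connected graphs are taken to be nonempty.\<close>

definition connected_graph :: "'a set \<Rightarrow> 'a set set \<Rightarrow> bool" where
  "connected_graph V E \<longleftrightarrow> simple_graph V E \<and> V \<noteq> {} \<and>
     (\<forall>u\<in>V. \<forall>v\<in>V. (u, v) \<in> {(a, b). {a, b} \<in> E}\<^sup>*)"

definition gp4_graph :: "'a set \<Rightarrow> 'a set set \<Rightarrow> bool" where
  "gp4_graph V E \<longleftrightarrow>
     (\<exists>VH EH w x y z. connected_graph VH EH
        \<and> inj_on w VH \<and> inj_on x VH \<and> inj_on y VH \<and> inj_on z VH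
        \<and> disjnt VH (w ` VH) \<and> disjnt VH (x ` VH)
        \<and> disjnt VH (y ` VH) \<and> disjnt VH (z ` VH)
        \<and> disjnt (w ` VH) (x ` VH) \<and> disjnt (w ` VH) (y ` VH)
        \<and> disjnt (w ` VH) (z ` VH) \<and> disjnt (x ` VH) (y ` VH)
        \<and> disjnt (x ` VH) (z ` VH) \<and> disjnt (y ` VH) (z ` VH)
        \<and> V = VH \<union> w ` VH \<union> x ` VH \<union> y ` VH \<union> z ` VH
        \<and> E = EH \<union> (\<Union>v\<in>VH. {{v, w v}, {w v, x v}, {x v, y v}, {y v, z v}}))"

definition induced_edges :: "'a set set \<Rightarrow> 'a set \<Rightarrow> 'a set set" where
  "induced_edges E D = {e \<in> E. e \<subseteq> D}"

definition perfect_matching :: "'a set \<Rightarrow> 'a set set \<Rightarrow> 'a set set \<Rightarrow> bool" where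
  "perfect_matching V E M \<longleftrightarrow> M \<subseteq> E \<and> (\<forall>v\<in>V. \<exists>!e. e \<in> M \<and> v \<in> e)"

definition paired_dominating_set :: "'a set \<Rightarrow> 'a set set \<Rightarrow> 'a set \<Rightarrow> bool" where
  "paired_dominating_set V E D \<longleftrightarrow> D \<subseteq> V \<and> (\<forall>v\<in>V - D. \<exists>u\<in>D. {u, v} \<in> E)
     \<and> (\<exists>M. perfect_matching D (induced_edges E D) M)"


section \<open>Turing machines\<close>

text \<open>
  Deterministic multi-tape machines with two-way infinite tapes. States and tape symbols are
  numbers below explicit bounds, so that finiteness needs no quantification over types.
  Symbol 0 is the blank, 1 and 2 are the bits, 3 is a separator; further symbols are
  work symbols. Tape 0 carries the input, tape 1 the output. The machine halts exactly in
  its accepting and its rejecting state.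
\<close>

datatype move = MLeft | MStay | MRight

record tm =
  num_tapes :: nat
  num_states :: nat
  num_syms :: nat
  start :: nat
  accept :: nat
  reject :: nat
  trans :: "nat \<Rightarrow> nat list \<Rightarrow> nat \<times> (nat \<times> move) list"

definition wf_tm :: "tm \<Rightarrow> bool" where
  "wf_tm M \<longleftrightarrow> num_tapes M \<ge> 2 \<and> num_syms M \<ge> 4
     \<and> start M < num_states M \<and> accept M < num_states M \<and> reject M < num_states M
     \<and> accept M \<noteq> reject M
     \<and> (\<forall>q ss. q < num_states M \<and> length ss = num_tapes M \<and> set ss \<subseteq> {..<num_syms M} \<longrightarrow>
          (case trans M q ss of (q', as) \<Rightarrow>
             q' < num_states M \<and> length as = num_tapes M \<and> fst ` set as \<subseteq> {..<num_syms M}))"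

text \<open>A tape is a head position with the tape contents; a configuration is a state with the tapes.\<close>

type_synonym tape = "int \<times> (int \<Rightarrow> nat)"
type_synonym config = "nat \<times> tape list"

fun offset :: "move \<Rightarrow> int" where
  "offset MLeft = -1"
| "offset MStay = 0"
| "offset MRight = 1"

fun read_tape :: "tape \<Rightarrow> nat" where
  "read_tape (i, f) = f i"

fun act :: "nat \<times> move \<Rightarrow> tape \<Rightarrow> tape" where
  "act (s, m) (i, f) = (i + offset m, f(i := s))"

definition halted :: "tm \<Rightarrow> config \<Rightarrow> bool" where
  "halted M c \<longleftrightarrow> fst c = accept M \<or> fst c = reject M"

definition step :: "tm \<Rightarrow> config \<Rightarrow> config" where
  "step M c = (if halted M c then c
     else case trans M (fst c) (map read_tape (snd c)) of
       (q', as) \<Rightarrow> (q', map2 act as (snd c)))"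

definition contents :: "nat list \<Rightarrow> int \<Rightarrow> nat" where
  "contents s = (\<lambda>i. if 0 \<le> i \<and> i < int (length s) then s ! nat i else 0)"

definition init_config :: "tm \<Rightarrow> nat list \<Rightarrow> config" where
  "init_config M s = (start M, (0, contents s) # replicate (num_tapes M - 1) (0, contents []))"

definition run :: "tm \<Rightarrow> nat list \<Rightarrow> nat \<Rightarrow> config" where
  "run M s t = (step M ^^ t) (init_config M s)"


section \<open>Polynomial time, NP and NP-completeness\<close>

type_synonym language = "bool list set"

definition syms :: "bool list \<Rightarrow> nat list" where
  "syms = map (\<lambda>b. if b then 2 else 1)"

definition polytime_computable :: "(bool list \<Rightarrow> bool list) \<Rightarrow> bool" where
  "polytime_computable f \<longleftrightarrow>
     (\<exists>M (p :: nat poly). wf_tm M \<and>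
        (\<forall>x. let c = run M (syms x) (poly p (length x))
             in halted M c \<and> snd (snd c ! 1) = contents (syms (f x))))"

text \<open>
  NP via polynomial-time verifiers: the verifier receives the instance and a certificate of
  polynomially bounded length, separated by symbol 3.
\<close>

definition verifier_input :: "bool list \<Rightarrow> bool list \<Rightarrow> nat list" where
  "verifier_input x u = syms x @ [3] @ syms u"

definition NP :: "language set" where
  "NP = {L. \<exists>M (p :: nat poly) (r :: nat poly). wf_tm M \<and>
     (\<forall>x u. halted M (run M (verifier_input x u) (poly r (length (verifier_input x u))))) \<and>
     (\<forall>x. x \<in> L \<longleftrightarrow> (\<exists>u. length u \<le> poly p (length x) \<and>
        (\<exists>t. fst (run M (verifier_input x u) t) = accept M)))}"

definition polytime_reducible :: "language \<Rightarrow> language \<Rightarrow> bool" where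
  "polytime_reducible K L \<longleftrightarrow> (\<exists>f. polytime_computable f \<and> (\<forall>x. x \<in> K \<longleftrightarrow> f x \<in> L))"

definition np_hard :: "language \<Rightarrow> bool" where
  "np_hard L \<longleftrightarrow> (\<forall>K\<in>NP. polytime_reducible K L)"

definition np_complete :: "language \<Rightarrow> bool" where
  "np_complete L \<longleftrightarrow> L \<in> NP \<and> np_hard L"


section \<open>The decision problem\<close>

text \<open>Binary numerals, least significant bit first, without leading zeros.\<close>

fun binary :: "nat \<Rightarrow> bool list" where
  "binary k = (if k = 0 then [] else odd k # binary (k div 2))"

declare binary.simps [simp del]

text \<open>
  An instance is a graph on the vertices \<open>0, \<dots>, n - 1\<close> together with a bound \<open>k\<close>. It is
  encoded by the number of vertices in unary, the adjacency matrix row by row, and \<open>k\<close>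
  in binary.
\<close>

definition adj_matrix :: "nat \<Rightarrow> nat set set \<Rightarrow> bool list" where
  "adj_matrix n E = concat (map (\<lambda>i. map (\<lambda>j. {i, j} \<in> E) [0..<n]) [0..<n])"

definition encode_instance :: "nat \<Rightarrow> nat set set \<Rightarrow> nat \<Rightarrow> bool list" where
  "encode_instance n E k = replicate n True @ [False] @ adj_matrix n E @ binary k"

definition gp4_paired_domination :: language where
  "gp4_paired_domination = {encode_instance n E k | n E k.
     gp4_graph {..<n} E \<and> k > 0 \<and> (\<exists>D. paired_dominating_set {..<n} E D \<and> card D \<le> k)}"

text \<open>Distinct instances have distinct encodings.\<close>

lemma binary_inj: "binary k = binary l \<Longrightarrow> k = l"
proof (induction k arbitrary: l rule: less_induct)
  case (less k)
  show ?case
  proof (cases "k = 0 \<or> l = 0")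
    case True
    then show ?thesis
      using less.prems by (subst (asm) (1 2) binary.simps) (auto split: if_splits)
  next
    case False
    then have *: "odd k = odd l" "binary (k div 2) = binary (l div 2)"
      using less.prems by (subst (asm) (1 2) binary.simps, simp)+
    have "k div 2 = l div 2"
      using less.IH[OF _ *(2)] False by simp
    then show ?thesis
      using *(1) by (metis bit_eq_rec)
  qed
qed

lemma adj_matrix_length: "length (adj_matrix n E) = n * n"
  by (simp add: adj_matrix_def length_concat comp_def sum_list_triv)

lemma adj_matrix_inj:
  assumes E: "simple_graph {..<n} E" and F: "simple_graph {..<n} F"
    and eq: "adj_matrix n E = adj_matrix n F"
  shows "E = F"
proof -
  let ?row = "\<lambda>E i. map (\<lambda>j. {i, j} \<in> E) [0..<n]"
  have "map (?row E) [0..<n] = map (?row F) [0..<n]"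
    using eq unfolding adj_matrix_def
    by (subst (asm) concat_eq_concat_iff) (auto simp: set_zip)
  then have *: "{i, j} \<in> E \<longleftrightarrow> {i, j} \<in> F" if "i < n" "j < n" for i j
    using that by auto
  have "A \<subseteq> B" if A: "simple_graph {..<n} A"
    and AB: "\<And>i j. i < n \<Longrightarrow> j < n \<Longrightarrow> {i, j} \<in> A \<Longrightarrow> {i, j} \<in> B" for A B
  proof
    fix e assume "e \<in> A"
    then obtain i j where "e = {i, j}" "i < n" "j < n"
      using A unfolding simple_graph_def by (auto simp: card_2_iff dest!: bspec)
    then show "e \<in> B" using AB \<open>e \<in> A\<close> by auto
  qed
  from this[OF E] this[OF F] * show ?thesis by blast
qed

lemma encode_instance_inj:
  assumes "simple_graph {..<n} E" "simple_graph {..<m} F"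
    and eq: "encode_instance n E k = encode_instance m F l"
  shows "n = m \<and> E = F \<and> k = l"
proof -
  have tw: "takeWhile (\<lambda>b. b) (replicate i True @ False # xs) = replicate i True" for i xs
    by (induction i) auto
  have nm: "n = m"
    using arg_cong[OF eq, of "takeWhile (\<lambda>b. b)"]
    by (simp add: encode_instance_def tw)
  with eq have "adj_matrix n E = adj_matrix n F \<and> binary k = binary l"
    by (simp add: encode_instance_def adj_matrix_length)
  with nm assms adj_matrix_inj binary_inj show ?thesis by metis
qed

end

theory Submission imports Defs "HOL-Library.Countable" begin

text \<open>
  Turing machines are only programmed once: a polynomially bounded counter can be kept as the
  position of a head, and therefore arithmetic expressions with bounded sums, which may query
  the input, are evaluated in polynomial time. All verifiers and reductions below are given by
  such expressions.

  For membership in NP the certificate numbers the vertices such that each pendant path is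
  consecutive and each \<open>v\<^sub>i\<close> but the first has an earlier neighbour \<open>v\<^sub>j\<close>, which witnesses that \<open>H\<close>
  is connected, and it gives the perfect matching of a paired dominating set.

  For hardness, every paired dominating set \<open>D\<close> contains each \<open>y\<^sub>i\<close>, matched to \<open>x\<^sub>i\<close> or \<open>z\<^sub>i\<close>, and
  choosing \<open>x\<^sub>i\<close> also dominates \<open>w\<^sub>i\<close>. So \<open>|D| \<le> 2 n\<^sub>H + 2 s\<close> is possible iff at most \<open>s\<close> edges or single
  vertices of \<open>H\<close> dominate \<open>H\<close>. Satisfiability reduces to the latter problem: a leaf forces one
  edge per variable, which picks a literal and thereby dominates the clauses containing it.
  Machine runs are encoded by clauses in the manner of Cook and Levin.
\<close>

section \<open>A register language compiled to Turing machines\<close>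

text \<open>Polynomial time refers to concrete machines, and a reduction has to deliver each output
  bit as a function of its position. Nothing is therefore assembled sequentially: instances are
  given by predicates on indices, and closure rules show that these are computable. This shapes the
  satisfiability problem. Variables and clauses are the numbers below one common bound, decoded in a
  common base, and a number that is not the code of a clause becomes a tautology. Such a tautology
  also supplies an occurring literal, which ties the clause vertices to the rest of the graph. For
  \<open>N\<close> variables the graph \<open>H\<close> has \<open>5 * N\<close> vertices and one
  pair per variable is allowed, so the bound on the paired dominating set is
  \<open>2 * (5 * N) + 2 * N = 12 * N\<close>. Since all values are polynomially bounded, powers of
  two and the binary bound \<open>k\<close> have to be handled without exponentials.\<close>

datatype test = Nz nat | Sym "nat set"

datatype com = Inc nat | Dec nat | Fwd | Bwd | Out nat
  | Seq com com | Cond test com | Loop test com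

text \<open>Position of the input head, register contents, and output written so far.\<close>

type_synonym store = "int \<times> (nat \<Rightarrow> nat) \<times> bool list"

fun holds :: "nat list \<Rightarrow> store \<Rightarrow> test \<Rightarrow> bool" where
  "holds s (p, g, w) (Nz r) = (g r \<noteq> 0)"
| "holds s (p, g, w) (Sym A) = (contents s p \<in> A)"

text \<open>
  The control state is the list of commands that remain to be executed. Only finitely many
  such lists are reachable from a given command, and they become the states of the machine.
\<close>

fun eff :: "com list \<Rightarrow> store \<Rightarrow> store" where
  "eff (Inc r # K) (p, g, w) = (p, g(r := g r + 1), w)"
| "eff (Dec r # K) (p, g, w) = (p, g(r := g r - 1), w)"
| "eff (Fwd # K) (p, g, w) = (p + 1, g, w)"
| "eff (Bwd # K) (p, g, w) = (p - 1, g, w)"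
| "eff (Out r # K) (p, g, w) = (p, g, w @ [g r \<noteq> 0])"
| "eff K \<sigma> = \<sigma>"

text \<open>Only the outcomes of tests enter, so that the same function describes the step on stores
  (\<open>h = holds s \<sigma>\<close>) and the step of the machine on scanned symbols
  (\<open>h = seen ss\<close>).\<close>

fun ctl :: "(test \<Rightarrow> bool) \<Rightarrow> com list \<Rightarrow> com list" where
  "ctl h [] = []"
| "ctl h (Seq a b # K) = a # b # K"
| "ctl h (Cond t a # K) = (if h t then a # K else K)"
| "ctl h (Loop t a # K) = (if h t then a # Loop t a # K else K)"
| "ctl h (_ # K) = K"

definition nxt :: "nat list \<Rightarrow> com list \<times> store \<Rightarrow> com list \<times> store" where
  "nxt s = (\<lambda>(K, \<sigma>). (ctl (holds s \<sigma>) K, eff K \<sigma>))"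

text \<open>These are the lists met from \<open>c # K\<close> on until \<open>K\<close> is reached,
  \<open>K\<close> itself excluded. A loop puts itself back on the list, so its body is followed by
  \<open>Loop t a # K\<close>; the recursion stays structural and the set finite.\<close>

fun conts :: "com \<Rightarrow> com list \<Rightarrow> com list set" where
  "conts (Seq a b) K = insert (Seq a b # K) (conts a (b # K) \<union> conts b K)"
| "conts (Cond t a) K = insert (Cond t a # K) (conts a K)"
| "conts (Loop t a) K = insert (Loop t a # K) (conts a (Loop t a # K))"
| "conts c K = {c # K}"

lemma finite_conts: "finite (conts c K)"
  by (induction c arbitrary: K) auto

lemma conts_refl [simp]: "c # K \<in> conts c K"
  by (cases c) auto

lemma ctl_conts: "S \<in> conts c K \<Longrightarrow> ctl h S = K \<or> ctl h S \<in> conts c K"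
proof (induction c arbitrary: K S)
  case (Seq a b)
  consider "S = Seq a b # K" | "S \<in> conts a (b # K)" | "S \<in> conts b K"
    using Seq.prems by auto
  then show ?case
  proof cases
    case 2
    with Seq.IH(1)[OF 2] show ?thesis by (auto split: if_splits)
  next
    case 3
    with Seq.IH(2)[OF 3] show ?thesis by auto
  qed auto
next
  case (Cond t a)
  then show ?case using Cond.IH[of S K] by (auto split: if_splits)
next
  case (Loop t a)
  then show ?case using Loop.IH[of S "Loop t a # K"] by (auto split: if_splits)
qed auto

definition states :: "com \<Rightarrow> com list set" where
  "states c = insert [] (conts c [])"

lemma finite_states: "finite (states c)"
  by (simp add: states_def finite_conts)

lemma ctl_states: "K \<in> states c \<Longrightarrow> ctl h K \<in> states c"
  using ctl_conts[of K c "[]" h] by (auto simp: states_def)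

fun tbnd :: "nat \<Rightarrow> test \<Rightarrow> bool" where
  "tbnd m (Nz r) = (r < m)"
| "tbnd m (Sym A) = True"

text \<open>Each register occupies a tape of its own and a machine has a fixed number of tapes, so
  the register indices of a command have to be bounded.\<close>

fun bnd :: "nat \<Rightarrow> com \<Rightarrow> bool" where
  "bnd m (Inc r) = (r < m)"
| "bnd m (Dec r) = (r < m)"
| "bnd m (Out r) = (r < m)"
| "bnd m (Seq a b) = (bnd m a \<and> bnd m b)"
| "bnd m (Cond t a) = (tbnd m t \<and> bnd m a)"
| "bnd m (Loop t a) = (tbnd m t \<and> bnd m a)"
| "bnd m _ = True"

lemma conts_bnd: "S \<in> conts c K \<Longrightarrow> bnd m c \<Longrightarrow> list_all (bnd m) K \<Longrightarrow> list_all (bnd m) S"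
  by (induction c arbitrary: K) auto

lemma states_bnd: "K \<in> states c \<Longrightarrow> bnd m c \<Longrightarrow> list_all (bnd m) K"
  using conts_bnd[of K c "[]" m] by (auto simp: states_def)

lemma bnd_mono: "bnd m c \<Longrightarrow> m \<le> n \<Longrightarrow> bnd n c"
proof (induction c)
  case (Cond t a) then show ?case by (cases t) auto
next
  case (Loop t a) then show ?case by (cases t) auto
qed auto

lemma ex_bnd: "\<exists>m. bnd m c"
proof (induction c)
  case (Seq a b)
  then obtain m n where "bnd m a" "bnd n b" by blast
  then have "bnd (max m n) (Seq a b)" using bnd_mono by (metis bnd.simps(4) max.cobounded1 max.cobounded2)
  then show ?case by blast
next
  case (Cond t a)
  then obtain m where m: "bnd m a" by blast
  show ?case
  proof (cases t)
    case (Nz r)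
    have "bnd (max m (Suc r)) (Cond t a)" using m Nz bnd_mono[of m a "max m (Suc r)"] by auto
    then show ?thesis by blast
  qed (use m in auto)
next
  case (Loop t a)
  then obtain m where m: "bnd m a" by blast
  show ?case
  proof (cases t)
    case (Nz r)
    have "bnd (max m (Suc r)) (Loop t a)" using m Nz bnd_mono[of m a "max m (Suc r)"] by auto
    then show ?thesis by blast
  qed (use m in auto)
qed auto

text \<open>
  A register lives on tape \<open>r + 2\<close> as the position of the head; cell 0 of that tape carries
  a mark, so that the machine can test for zero.
\<close>

definition mark :: "int \<Rightarrow> nat" where
  "mark = (\<lambda>_. 0)(0 := 1)"

fun tp :: "nat list \<Rightarrow> store \<Rightarrow> nat \<Rightarrow> tape" where
  "tp s (p, g, w) i = (if i = 0 then (p, contents s)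
     else if i = 1 then (int (length w), contents (syms w)) else (int (g (i - 2)), mark))"

text \<open>On a register tape the symbol 1 is in cell 0 only; scanning anything else means that the
  register is nonzero.\<close>

fun seen :: "nat list \<Rightarrow> test \<Rightarrow> bool" where
  "seen ss (Nz r) = (ss ! (r + 2) \<noteq> 1)"
| "seen ss (Sym A) = (ss ! 0 \<in> A)"

fun tact :: "com list \<Rightarrow> nat list \<Rightarrow> nat \<Rightarrow> nat \<times> move" where
  "tact (Inc r # K) ss i = (ss ! i, if i = r + 2 then MRight else MStay)"
| "tact (Dec r # K) ss i = (ss ! i, if i = r + 2 \<and> ss ! i \<noteq> 1 then MLeft else MStay)"
| "tact (Fwd # K) ss i = (ss ! i, if i = 0 then MRight else MStay)"
| "tact (Bwd # K) ss i = (ss ! i, if i = 0 then MLeft else MStay)"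
| "tact (Out r # K) ss i = (if i = 1 then (if ss ! (r + 2) \<noteq> 1 then 2 else 1, MRight) else (ss ! i, MStay))"
| "tact K ss i = (ss ! i, MStay)"

text \<open>States 0, 1 and 2 accept, reject and start; the continuation \<open>K\<close> is state
  \<open>3 + h K\<close>. The start state only writes the marks on the register tapes. The empty
  continuation scans tape 3, that is register 1, and accepts iff this register is nonzero.\<close>

definition tm_of :: "(com list \<Rightarrow> nat) \<Rightarrow> com \<Rightarrow> nat \<Rightarrow> tm" where
  "tm_of h c m = \<lparr>num_tapes = m + 2, num_states = 3 + card (states c), num_syms = 4,
     start = 2, accept = 0, reject = 1,
     trans = (\<lambda>q ss.
       if q = 2 then (3 + h [c], map (\<lambda>i. (if i < 2 then ss ! i else 1, MStay)) [0..<m + 2])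
       else let K = inv_into (states c) h (q - 3) in
         if K = [] then (if ss ! 3 \<noteq> 1 then 0 else 1, map (\<lambda>i. (ss ! i, MStay)) [0..<m + 2])
         else (3 + h (ctl (seen ss) K), map (tact K ss) [0..<m + 2]))\<rparr>"

section \<open>The machine simulates the command step by step\<close>

lemma tact_sym: "fst (tact K ss i) \<in> {ss ! i, 1, 2}"
  by (induction K ss i rule: tact.induct) auto

lemma wf_tm_of:
  assumes h: "bij_betw h (states c) {..<card (states c)}"
  shows "wf_tm (tm_of h c m)"
proof -
  have ne: "states c \<noteq> {}" by (simp add: states_def)
  then have pos: "card (states c) > 0" using finite_states by (simp add: card_gt_0_iff)
  have hl: "K \<in> states c \<Longrightarrow> h K < card (states c)" for K
    using h by (auto simp: bij_betw_def)
  have c: "[c] \<in> states c" by (simp add: states_def)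
  \<comment> \<open>For the states 0, 1 and 2 truncated subtraction yields 0, which is again the
    code of some list.\<close>
  have inv: "inv_into (states c) h (q - 3) \<in> states c" if "q < 3 + card (states c)" for q
    by (rule inv_into_into) (use h that pos in \<open>auto simp: bij_betw_def\<close>)
  show ?thesis
    unfolding wf_tm_def
  proof (intro conjI allI impI, goal_cases)
    case (7 q ss)
    then have q: "q < 3 + card (states c)" and len: "length ss = m + 2"
      and ss: "\<And>i. i < m + 2 \<Longrightarrow> ss ! i < 4"
      by (auto simp: tm_of_def subset_iff all_set_conv_all_nth)
    have *: "fst (tact K ss i) < 4" if "i < m + 2" for K i
      using tact_sym[of K ss i] ss[OF that] by auto
    show ?case
      using hl[OF c] hl[OF ctl_states[OF inv[OF q]]] ss *
      by (auto simp: tm_of_def Let_def)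
  qed (auto simp: tm_of_def)
qed

definition cfg :: "(com list \<Rightarrow> nat) \<Rightarrow> nat list \<Rightarrow> nat \<Rightarrow> com list \<times> store \<Rightarrow> config" where
  "cfg h s m = (\<lambda>(K, \<sigma>). (3 + h K, map (tp s \<sigma>) [0..<m + 2]))"

lemma mark_iff: "mark (int n) = Suc 0 \<longleftrightarrow> n = 0"
  by (simp add: mark_def)

lemma contents_snoc:
  "(contents (syms w))(int (length w) := (if b then 2 else Suc 0)) = contents (syms (w @ [b]))"
  by (auto simp: contents_def syms_def nth_append fun_eq_iff nat_eq_iff)

lemma map2_act: "map2 act (map f xs) (map g xs) = map (\<lambda>i. act (f i) (g i)) xs"
  by (simp add: map2_map_map)

lemma seen_eq:
  assumes "tbnd m t"
  shows "seen (map read_tape (map (tp s \<sigma>) [0..<m + 2])) t = holds s \<sigma> t"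
  using assms by (cases \<sigma>; cases t) (simp_all add: mark_iff del: upt_Suc)

lemma ctl_eq:
  assumes "list_all (bnd m) K" "\<And>t. tbnd m t \<Longrightarrow> h t = h' t"
  shows "ctl h K = ctl h' K"
proof (cases K)
  case (Cons a L)
  then show ?thesis using assms by (cases a) auto
qed auto

lemma act_eq:
  assumes "list_all (bnd m) K" "i < m + 2"
  shows "act (tact K (map read_tape (map (tp s \<sigma>) [0..<m + 2])) i) (tp s \<sigma> i) = tp s (eff K \<sigma>) i"
proof -
  obtain p g w where \<sigma>: "\<sigma> = (p, g, w)" by (cases \<sigma>)
  show ?thesis
  proof (cases K)
    case Nil
    then show ?thesis using assms \<sigma> by (simp del: upt_Suc)
  next
    case (Cons a L)
    then show ?thesis using assms \<sigma>
      by (cases a; auto simp: mark_iff contents_snoc[symmetric] simp del: upt_Suc fun_upd_apply; auto)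
  qed
qed

lemma step_cfg:
  assumes h: "inj_on h (states c)" and "bnd m c" "K \<in> states c" "K \<noteq> []"
  shows "step (tm_of h c m) (cfg h s m (K, \<sigma>)) = cfg h s m (nxt s (K, \<sigma>))"
proof -
  have b: "list_all (bnd m) K" using assms states_bnd by blast
  let ?ss = "map read_tape (map (tp s \<sigma>) [0..<m + 2])"
  have 1: "ctl (seen ?ss) K = ctl (holds s \<sigma>) K"
    by (rule ctl_eq[OF b seen_eq])
  have 2: "map2 act (map (tact K ?ss) [0..<m + 2]) (map (tp s \<sigma>) [0..<m + 2])
      = map (tp s (eff K \<sigma>)) [0..<m + 2]"
    unfolding map2_act
      by (rule map_cong[OF refl]) (rule act_eq[OF b], simp only: set_upt atLeastLessThan_iff)
  have "inv_into (states c) h (h K) = K" using h assms by simp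
  then show ?thesis
    using assms(4) 1 2
    by (simp add: step_def cfg_def halted_def tm_of_def nxt_def Let_def del: upt_Suc)
qed

lemma step_cfg_Nil:
  assumes "inj_on h (states c)" "m \<ge> 2"
  shows "step (tm_of h c m) (cfg h s m ([], (p, g, w))) =
    (if g 1 \<noteq> 0 then 0 else 1, map (tp s (p, g, w)) [0..<m + 2])"
proof -
  have "inv_into (states c) h (h []) = []"
    using assms by (simp add: states_def)
  then show ?thesis
    using assms(2) unfolding step_def cfg_def halted_def tm_of_def
    by (simp add: map2_act mark_iff del: upt_Suc)
qed

lemma nxt_Nil: "(nxt s ^^ t) ([], \<sigma>) = ([], \<sigma>)"
  by (induction t) (auto simp: nxt_def)

text \<open>\<open>nxt\<close> rests at the empty list, whereas the machine leaves it in one further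
  step for a halting state. Hence \<open>t + 1\<close>, and only as a bound, because the list may
  become empty before time \<open>t\<close>.\<close>

lemma run_cfg:
  assumes h: "inj_on h (states c)" and "bnd m c" "m \<ge> 2"
  shows "K \<in> states c \<Longrightarrow> (nxt s ^^ t) (K, \<sigma>) = ([], (p, g, w)) \<Longrightarrow>
    \<exists>t'\<le>t + 1. (step (tm_of h c m) ^^ t') (cfg h s m (K, \<sigma>)) =
      (if g 1 \<noteq> 0 then 0 else 1, map (tp s (p, g, w)) [0..<m + 2])"
proof (induction t arbitrary: K \<sigma>)
  case 0
  then show ?case using step_cfg_Nil[OF h \<open>m \<ge> 2\<close>]
    by (intro exI[of _ 1]) simp
next
  case (Suc t)
  show ?case
  proof (cases "K = []")
    case True
    then have "\<sigma> = (p, g, w)" using Suc.prems nxt_Nil by (metis prod.inject)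
    then show ?thesis using step_cfg_Nil[OF h \<open>m \<ge> 2\<close>] True
      by (intro exI[of _ 1]) simp
  next
    case False
    have *: "step (tm_of h c m) (cfg h s m (K, \<sigma>)) = cfg h s m (nxt s (K, \<sigma>))"
      by (rule step_cfg[OF h assms(2) Suc.prems(1) False])
    obtain K' \<sigma>' where n: "nxt s (K, \<sigma>) = (K', \<sigma>')" by (cases "nxt s (K, \<sigma>)")
    then have "K' \<in> states c" using ctl_states Suc.prems by (auto simp: nxt_def)
    moreover have "(nxt s ^^ t) (K', \<sigma>') = ([], (p, g, w))"
      using Suc.prems(2) n by (simp add: funpow_Suc_right del: funpow.simps)
    ultimately obtain t' where t': "t' \<le> t + 1" "(step (tm_of h c m) ^^ t') (cfg h s m (K', \<sigma>')) =
      (if g 1 \<noteq> 0 then 0 else 1, map (tp s (p, g, w)) [0..<m + 2])"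
      using Suc.IH by blast
    then have "(step (tm_of h c m) ^^ (Suc t')) (cfg h s m (K, \<sigma>)) =
      (if g 1 \<noteq> 0 then 0 else 1, map (tp s (p, g, w)) [0..<m + 2])"
      using * n by (simp add: funpow_Suc_right del: funpow.simps)
    then show ?thesis using t'(1) by (intro exI[of _ "Suc t'"]) simp
  qed
qed

text \<open>Quantifying over all continuations makes the notion compositional, and \<open>b\<close>
  is only an upper bound so that cost estimates can be rounded up.\<close>

definition runs :: "nat list \<Rightarrow> com \<Rightarrow> store \<Rightarrow> nat \<Rightarrow> store \<Rightarrow> bool" where
  "runs s c \<sigma> b \<sigma>' \<longleftrightarrow> (\<exists>t\<le>b. \<forall>K. (nxt s ^^ t) (c # K, \<sigma>) = (K, \<sigma>'))"

section \<open>Halting, and acceptance at a known halting time\<close>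

lemma halted_stays: "halted M c \<Longrightarrow> (step M ^^ t) c = c"
  by (induction t) (auto simp: step_def)

lemma run_mono:
  assumes "halted M (run M s t)" "t \<le> t'"
  shows "run M s t' = run M s t"
proof -
  have "run M s t' = (step M ^^ (t' - t)) (run M s t)"
    using assms(2) funpow_add[of "t' - t" t "step M"] by (simp add: run_def)
  then show ?thesis using halted_stays[OF assms(1)] by simp
qed

lemma accepts_iff:
  assumes halt: "halted M (run M s t)"
  shows "(\<exists>t. fst (run M s t) = accept M) \<longleftrightarrow> fst (run M s t) = accept M"
proof
  assume "\<exists>t. fst (run M s t) = accept M"
  then obtain t' where t': "fst (run M s t') = accept M" by blast
  have "run M s (max t' t) = run M s t" by (rule run_mono[OF halt]) simp
  moreover have "run M s (max t' t) = run M s t'"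
    by (rule run_mono) (simp_all add: halted_def t')
  ultimately show "fst (run M s t) = accept M" using t' by simp
qed blast

definition init_store :: store where
  "init_store = (0, \<lambda>_. 0, [])"

lemma init_config_tm_of: "init_config (tm_of h c m) s =
    (2, map (\<lambda>i. (0, if i = 0 then contents s else contents [])) [0..<m + 2])"
proof -
  have "(0, contents s) # replicate (m + 1) (0, contents []) =
      map (\<lambda>i. (0, if i = 0 then contents s else contents [])) [0..<m + 2]" (is "?l = ?r")
  proof (rule nth_equalityI)
    fix i assume "i < length ?l"
    then show "?l ! i = ?r ! i" by (cases i) (simp_all del: upt_Suc replicate_Suc)
  qed simp
  then show ?thesis by (simp add: init_config_def tm_of_def del: upt_Suc replicate_Suc)
qed

lemma step_init: "step (tm_of h c m) (init_config (tm_of h c m) s) = cfg h s m ([c], init_store)"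
proof -
  have c0: "contents [] = (\<lambda>_. 0)" by (auto simp: contents_def)
  show ?thesis
    unfolding init_config_tm_of
    by (simp add: step_def halted_def tm_of_def cfg_def map2_act del: upt_Suc)
      (auto simp: c0 init_store_def syms_def mark_def fun_eq_iff simp del: upt_Suc)
qed

lemma tm_of_sel: "accept (tm_of h c m) = 0" "reject (tm_of h c m) = 1" "num_tapes (tm_of h c m) = m + 2"
  by (simp_all add: tm_of_def)

theorem tm_of_runs:
  assumes "\<And>s. P s \<Longrightarrow> runs s c init_store (poly B (length s)) (pp s, g s, w s)"
  obtains M p where "wf_tm M"
    "\<And>s. P s \<Longrightarrow> run M s (poly p (length s)) =
       (if g s 1 \<noteq> 0 then accept M else reject M, map (tp s (pp s, g s, w s)) [0..<num_tapes M])"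
proof -
  obtain m0 where "bnd m0 c" using ex_bnd by blast
  \<comment> \<open>At least two registers are provided, since register 1 decides
    acceptance.\<close>
  then have m: "bnd (max m0 2) c" "max m0 2 \<ge> 2" by (auto intro: bnd_mono)
  define m where "m = max m0 2"
  note m = m[folded m_def]
  obtain h where h: "bij_betw h (states c) {..<card (states c)}"
    using ex_bij_betw_finite_nat[OF finite_states] by (metis atLeast0LessThan)
  then have inj: "inj_on h (states c)" by (simp add: bij_betw_def)
  let ?M = "tm_of h c m"
  \<comment> \<open>The two extra steps write the marks at the beginning and enter a halting state
    at the end.\<close>
  have "run ?M s (poly (B + 2) (length s)) =
       (if g s 1 \<noteq> 0 then accept ?M else reject ?M, map (tp s (pp s, g s, w s)) [0..<num_tapes ?M])"
    if P: "P s" for s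
  proof -
    obtain t where t: "t \<le> poly B (length s)"
      and "\<forall>K. (nxt s ^^ t) (c # K, init_store) = (K, (pp s, g s, w s))"
      using assms[OF P] unfolding runs_def by (elim exE conjE)
    from this(2) have t2: "(nxt s ^^ t) ([c], init_store) = ([], (pp s, g s, w s))" ..
    have "[c] \<in> states c" by (simp add: states_def)
    from run_cfg[OF inj m this t2] obtain t' where t': "t' \<le> t + 1"
      "(step ?M ^^ t') (cfg h s m ([c], init_store)) =
      (if g s 1 \<noteq> 0 then 0 else 1, map (tp s (pp s, g s, w s)) [0..<m + 2])" by (elim exE conjE)
    then have *: "run ?M s (Suc t') = (if g s 1 \<noteq> 0 then 0 else 1, map (tp s (pp s, g s, w s)) [0..<m + 2])"
      unfolding run_def by (simp add: step_init funpow_Suc_right del: funpow.simps upt_Suc)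
    then have "halted ?M (run ?M s (Suc t'))" by (simp add: halted_def tm_of_sel)
    moreover have "Suc t' \<le> poly (B + 2) (length s)" using t t'(1) by simp
    ultimately have "run ?M s (poly (B + 2) (length s)) = run ?M s (Suc t')" by (rule run_mono)
    then show ?thesis unfolding * tm_of_sel .
  qed
  then show thesis
    by (rule that[of ?M "B + 2", OF wf_tm_of[OF h]])
qed

section \<open>Bounded arithmetic expressions\<close>

lemma runs_mono: "runs s c \<sigma> b \<sigma>' \<Longrightarrow> b \<le> b' \<Longrightarrow> runs s c \<sigma> b' \<sigma>'"
  unfolding runs_def by (meson le_trans)

lemma runs_prim:
  assumes "\<And>h K. ctl h (c # K) = K" "\<And>K. eff (c # K) \<sigma> = \<sigma>'"
  shows "runs s c \<sigma> 1 \<sigma>'"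
  unfolding runs_def by (rule exI[of _ 1]) (simp add: nxt_def assms)

lemma runs_Seq:
  assumes "runs s a \<sigma> t \<sigma>1" "runs s b \<sigma>1 t' \<sigma>2"
  shows "runs s (Seq a b) \<sigma> (1 + t + t') \<sigma>2"
proof -
  obtain k where k: "k \<le> t" "\<And>K. (nxt s ^^ k) (a # K, \<sigma>) = (K, \<sigma>1)"
    using assms(1) unfolding runs_def by auto
  obtain l where l: "l \<le> t'" "\<And>K. (nxt s ^^ l) (b # K, \<sigma>1) = (K, \<sigma>2)"
    using assms(2) unfolding runs_def by auto
  have "(nxt s ^^ (l + k + 1)) (Seq a b # K, \<sigma>) = (K, \<sigma>2)" for K
  proof -
    have "(nxt s ^^ (l + k + 1)) (Seq a b # K, \<sigma>) = (nxt s ^^ l) ((nxt s ^^ k) (nxt s (Seq a b # K, \<sigma>)))"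
      by (simp only: funpow_add comp_def One_nat_def funpow.simps id_def)
    also have "nxt s (Seq a b # K, \<sigma>) = (a # b # K, \<sigma>)" by (simp add: nxt_def)
    finally show ?thesis by (simp add: k l)
  qed
  then show ?thesis unfolding runs_def using k l by (intro exI[of _ "l + k + 1"]) simp
qed

lemma runs_Cond:
  assumes "holds s \<sigma> t \<Longrightarrow> runs s a \<sigma> b \<sigma>'" "\<not> holds s \<sigma> t \<Longrightarrow> \<sigma>' = \<sigma>"
  shows "runs s (Cond t a) \<sigma> (1 + b) \<sigma>'"
proof (cases "holds s \<sigma> t")
  case True
  obtain k where k: "k \<le> b" "\<And>K. (nxt s ^^ k) (a # K, \<sigma>) = (K, \<sigma>')"
    using assms(1)[OF True] unfolding runs_def by auto
  have "(nxt s ^^ (Suc k)) (Cond t a # K, \<sigma>) = (K, \<sigma>')" for K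
  proof -
    have "nxt s (Cond t a # K, \<sigma>) = (a # K, \<sigma>)" by (simp add: nxt_def True)
    then show ?thesis by (simp only: funpow_Suc_right comp_def k)
  qed
  then show ?thesis unfolding runs_def using k by (intro exI[of _ "Suc k"]) simp
next
  case False
  then show ?thesis unfolding runs_def by (intro exI[of _ 1]) (simp add: nxt_def assms)
qed

text \<open>The sequence \<open>\<sigma>\<close> lists the stores at the successive tests and so
  serves as the invariant. Each iteration costs one step more than its body, and the failing test
  costs the last step.\<close>

lemma runs_Loop:
  assumes "\<And>i. i < n \<Longrightarrow> holds s (\<sigma> i) t" "\<And>i. i < n \<Longrightarrow> runs s a (\<sigma> i) b (\<sigma> (Suc i))"
    "\<not> holds s (\<sigma> n) t"
  shows "runs s (Loop t a) (\<sigma> 0) (n * (b + 1) + 1) (\<sigma> n)"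
  using assms
proof (induction n arbitrary: \<sigma>)
  case 0
  then show ?case unfolding runs_def by (intro exI[of _ 1]) (simp add: nxt_def)
next
  case (Suc n)
  have "runs s (Loop t a) (\<sigma> (Suc 0)) (n * (b + 1) + 1) (\<sigma> (Suc n))"
    using Suc.IH[of "\<lambda>i. \<sigma> (Suc i)"] Suc.prems by simp
  then obtain l where l: "l \<le> n * (b + 1) + 1"
    "\<And>K. (nxt s ^^ l) (Loop t a # K, \<sigma> (Suc 0)) = (K, \<sigma> (Suc n))"
    unfolding runs_def by auto
  obtain k where k: "k \<le> b" "\<And>K. (nxt s ^^ k) (a # K, \<sigma> 0) = (K, \<sigma> (Suc 0))"
    using Suc.prems(2)[of 0] unfolding runs_def by auto
  have "(nxt s ^^ (l + k + 1)) (Loop t a # K, \<sigma> 0) = (K, \<sigma> (Suc n))" for K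
  proof -
    have "(nxt s ^^ (l + k + 1)) (Loop t a # K, \<sigma> 0) = (nxt s ^^ l) ((nxt s ^^ k) (nxt s (Loop t a # K, \<sigma> 0)))"
      by (simp only: funpow_add comp_def One_nat_def funpow.simps id_def)
    also have "nxt s (Loop t a # K, \<sigma> 0) = (a # Loop t a # K, \<sigma> 0)"
      using Suc.prems(1)[of 0] by (simp add: nxt_def)
    finally show ?thesis by (simp add: k l)
  qed
  then show ?case unfolding runs_def using k l by (intro exI[of _ "l + k + 1"]) simp
qed

fun straight :: "com \<Rightarrow> bool" where
  "straight (Seq a b) = (straight a \<and> straight b)"
| "straight (Cond t a) = False"
| "straight (Loop t a) = False"
| "straight _ = True"

fun sem :: "com \<Rightarrow> store \<Rightarrow> store" where
  "sem (Seq a b) \<sigma> = sem b (sem a \<sigma>)"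
| "sem c \<sigma> = eff [c] \<sigma>"

fun ticks :: "com \<Rightarrow> nat" where
  "ticks (Seq a b) = 1 + ticks a + ticks b"
| "ticks _ = 1"

lemma runs_straight: "straight c \<Longrightarrow> runs s c \<sigma> (ticks c) (sem c \<sigma>)"
proof (induction c arbitrary: \<sigma>)
  case (Seq a b)
  then show ?case using runs_Seq[OF Seq.IH] by simp
next
  case (Inc r)
  show ?case unfolding sem.simps ticks.simps by (cases \<sigma>, rule runs_prim, simp_all)
next
  case (Dec r)
  show ?case unfolding sem.simps ticks.simps by (cases \<sigma>, rule runs_prim, simp_all)
next
  case Fwd
  show ?case unfolding sem.simps ticks.simps by (cases \<sigma>, rule runs_prim, simp_all)
next
  case Bwd
  show ?case unfolding sem.simps ticks.simps by (cases \<sigma>, rule runs_prim, simp_all)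
next
  case (Out r)
  show ?case unfolding sem.simps ticks.simps by (cases \<sigma>, rule runs_prim, simp_all)
qed auto

lemma loop_straight:
  assumes "straight c" "\<And>i. i < n \<Longrightarrow> holds s (\<sigma> i) t" "\<And>i. i < n \<Longrightarrow> sem c (\<sigma> i) = \<sigma> (Suc i)"
    "\<not> holds s (\<sigma> n) t" "\<sigma> 0 = x" "\<sigma> n = y" "n \<le> B"
  shows "runs s (Loop t c) x (B * (ticks c + 1) + 1) y"
proof -
  have "runs s (Loop t c) (\<sigma> 0) (n * (ticks c + 1) + 1) (\<sigma> n)"
  proof (rule runs_Loop)
    fix i assume "i < n"
    then show "runs s c (\<sigma> i) (ticks c) (\<sigma> (Suc i))"
      using runs_straight[OF assms(1), of s "\<sigma> i"] assms(3) by simp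
  qed (use assms in auto)
  moreover have "n * (ticks c + 1) + 1 \<le> B * (ticks c + 1) + 1"
    using \<open>n \<le> B\<close> by (intro add_mono mult_right_mono) auto
  ultimately show ?thesis using assms(5,6) runs_mono by blast
qed

text \<open>
  Variables are de Bruijn indices, and \<open>Sum a b\<close> binds one in \<open>b\<close>. Every expression is polynomially
  bounded, so it can be evaluated with counters in unary.
\<close>

datatype exp = Var nat | One | Add exp exp | Sub exp exp | Inp "nat set" exp | Len | Sum exp exp

fun eval :: "nat list \<Rightarrow> exp \<Rightarrow> (nat \<Rightarrow> nat) \<Rightarrow> nat" where
  "eval s (Var i) v = v i"
| "eval s One v = 1"
| "eval s (Add a b) v = eval s a v + eval s b v"
| "eval s (Sub a b) v = eval s a v - eval s b v"
| "eval s (Inp A a) v = of_bool (contents s (int (eval s a v)) \<in> A)"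
| "eval s Len v = length s"
| "eval s (Sum a b) v = (\<Sum>i<eval s a v. eval s b (case_nat i v))"

text \<open>
  The value of the expression is left in register \<open>d\<close>; registers from \<open>d\<close> on have to be 0
  initially, and \<open>\<rho>\<close> gives the registers of the variables.
\<close>

fun compile :: "exp \<Rightarrow> (nat \<Rightarrow> nat) \<Rightarrow> nat \<Rightarrow> com" where
  "compile (Var i) \<rho> d =
     Seq (Loop (Nz (\<rho> i)) (Seq (Dec (\<rho> i)) (Seq (Inc d) (Inc (d + 1)))))
         (Loop (Nz (d + 1)) (Seq (Dec (d + 1)) (Inc (\<rho> i))))"
| "compile One \<rho> d = Inc d"
| "compile (Add a b) \<rho> d = Seq (compile a \<rho> d) (Seq (compile b \<rho> (d + 1))
     (Loop (Nz (d + 1)) (Seq (Dec (d + 1)) (Inc d))))"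
| "compile (Sub a b) \<rho> d = Seq (compile a \<rho> d) (Seq (compile b \<rho> (d + 1))
     (Loop (Nz (d + 1)) (Seq (Dec (d + 1)) (Dec d))))"
| "compile (Inp A a) \<rho> d = Seq (compile a \<rho> (d + 1))
     (Seq (Loop (Nz (d + 1)) (Seq (Dec (d + 1)) (Seq (Inc (d + 2)) Fwd)))
     (Seq (Cond (Sym A) (Inc d))
          (Loop (Nz (d + 2)) (Seq (Dec (d + 2)) Bwd))))"
| "compile Len \<rho> d =
     Seq (Loop (Sym (- {0})) (Seq (Inc d) (Seq (Inc (d + 1)) Fwd)))
         (Loop (Nz (d + 1)) (Seq (Dec (d + 1)) Bwd))"
| "compile (Sum a b) \<rho> d = Seq (compile a \<rho> (d + 1))
     (Seq (Loop (Nz (d + 1)) (Seq (Dec (d + 1))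
            (Seq (compile b (case_nat (d + 2) \<rho>) (d + 3))
            (Seq (Loop (Nz (d + 3)) (Seq (Dec (d + 3)) (Inc d)))
                 (Inc (d + 2))))))
          (Loop (Nz (d + 2)) (Dec (d + 2))))"

text \<open>A bound on the value when all variables and the input length are at most
  \<open>X\<close>. The variable bound by a sum is below \<open>vb a X\<close>, so the body is
  estimated at \<open>X + vb a X\<close>.\<close>

fun vb :: "exp \<Rightarrow> nat \<Rightarrow> nat" where
  "vb (Var i) X = X"
| "vb One X = 1"
| "vb (Add a b) X = vb a X + vb b X"
| "vb (Sub a b) X = vb a X"
| "vb (Inp A a) X = 1"
| "vb Len X = X"
| "vb (Sum a b) X = vb a X * vb b (X + vb a X)"

text \<open>The constants are read off from \<open>compile\<close>: a factor such as 4 or 10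
  collects, for each transfer loop, the \<open>ticks\<close> of its body plus one step for the
  test.\<close>

fun cost :: "exp \<Rightarrow> nat \<Rightarrow> nat" where
  "cost (Var i) X = 10 * X + 3"
| "cost One X = 1"
| "cost (Add a b) X = cost a X + cost b X + 4 * vb b X + 3"
| "cost (Sub a b) X = cost a X + cost b X + 4 * vb b X + 3"
| "cost (Inp A a) X = cost a X + 10 * vb a X + 7"
| "cost Len X = 10 * X + 3"
| "cost (Sum a b) X = cost a X +
     vb a X * (cost b (X + vb a X) + 4 * vb b (X + vb a X) + 7) + 2 * vb a X + 4"

lemma eval_le: "(\<And>i. v i \<le> X) \<Longrightarrow> length s \<le> X \<Longrightarrow> eval s e v \<le> vb e X"
proof (induction e arbitrary: v X)
  case (Sum a b)
  have a: "eval s a v \<le> vb a X" by (rule Sum.IH(1)) (use Sum.prems in auto)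
  have "eval s b (case_nat i v) \<le> vb b (X + vb a X)" if "i < eval s a v" for i
  proof (rule Sum.IH(2))
    fix j show "(case j of 0 \<Rightarrow> i | Suc k \<Rightarrow> v k) \<le> X + vb a X"
      using Sum.prems(1)[of "j - 1"] a that by (cases j) auto
  qed (use Sum.prems in simp)
  then have "eval s (Sum a b) v \<le> eval s a v * vb b (X + vb a X)"
    using sum_bounded_above[of "{..<eval s a v}" "\<lambda>i. eval s b (case_nat i v)"] by simp
  also have "\<dots> \<le> vb a X * vb b (X + vb a X)" using a by simp
  finally show ?case by simp
next
  case (Sub a b)
  have "eval s a v \<le> vb a X" by (rule Sub.IH(1)) (use Sub.prems in auto)
  then show ?case by simp
qed (auto intro: add_mono)

text \<open>Reading a register empties it, so variables are copied together with a backup in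
  \<open>d + 1\<close> and restored, and the input head returns to cell 0 after every query. Thus
  only register \<open>d\<close> changes in the end, and the body of a sum can be run again in an
  unchanged environment. Truncated subtraction is what \<open>Dec\<close> does at 0.\<close>

lemma compile_correct:
  assumes "0 \<notin> set s"
  shows "(\<And>i. \<rho> i < d) \<Longrightarrow> (\<And>r. r \<ge> d \<Longrightarrow> g r = 0) \<Longrightarrow> (\<And>i. g (\<rho> i) \<le> X) \<Longrightarrow> length s \<le> X \<Longrightarrow>
    runs s (compile e \<rho> d) (0, g, w) (cost e X) (0, g(d := eval s e (g \<circ> \<rho>)), w)"
proof (induction e arbitrary: \<rho> d g X)
  case (Var i)
  let ?x = "\<rho> i" let ?n = "g ?x"
  have x: "?x < d" "?n \<le> X" using Var by auto
  have 1: "runs s (Loop (Nz ?x) (Seq (Dec ?x) (Seq (Inc d) (Inc (d + 1))))) (0, g, w)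
      (X * (ticks (Seq (Dec ?x) (Seq (Inc d) (Inc (d + 1)))) + 1) + 1) (0, g(?x := 0, d := ?n, d + 1 := ?n), w)"
    by (rule loop_straight[where n = ?n and \<sigma> = "\<lambda>k. (0, g(?x := ?n - k, d := k, d + 1 := k), w)"])
      (use x Var in \<open>auto simp: fun_eq_iff\<close>)
  have 2: "runs s (Loop (Nz (d + 1)) (Seq (Dec (d + 1)) (Inc ?x))) (0, g(?x := 0, d := ?n, d + 1 := ?n), w)
      (X * (ticks (Seq (Dec (d + 1)) (Inc ?x)) + 1) + 1) (0, g(d := ?n), w)"
    by (rule loop_straight[where n = ?n and \<sigma> = "\<lambda>k. (0, g(?x := k, d := ?n, d + 1 := ?n - k), w)"])
      (use x Var in \<open>auto simp: fun_eq_iff\<close>)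
  show ?case unfolding compile.simps eval.simps comp_def by (rule runs_mono[OF runs_Seq[OF 1 2]]) simp
next
  case One
  show ?case unfolding compile.simps eval.simps cost.simps by (rule runs_prim) (use One in auto)
next
  case (Add a b)
  let ?g = "g(d := eval s a (g \<circ> \<rho>))" let ?n = "eval s b (g \<circ> \<rho>)"
  have r: "\<rho> i \<noteq> d" for i using Add.prems(1)[of i] by simp
  have env: "?g \<circ> \<rho> = g \<circ> \<rho>" by (auto simp: fun_eq_iff r)
  have 1: "runs s (compile a \<rho> d) (0, g, w) (cost a X) (0, ?g, w)"
    by (rule Add.IH(1)) (use Add.prems in auto)
  have "runs s (compile b \<rho> (d + 1)) (0, ?g, w) (cost b X) (0, ?g(d + 1 := eval s b (?g \<circ> \<rho>)), w)"
    by (rule Add.IH(2)) (use Add.prems r in \<open>auto simp: less_SucI\<close>)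
  then have 2: "runs s (compile b \<rho> (d + 1)) (0, ?g, w) (cost b X) (0, ?g(d + 1 := ?n), w)"
    unfolding env .
  have n: "?n \<le> vb b X" by (rule eval_le) (use Add.prems in auto)
  have 3: "runs s (Loop (Nz (d + 1)) (Seq (Dec (d + 1)) (Inc d))) (0, ?g(d + 1 := ?n), w)
      (vb b X * (ticks (Seq (Dec (d + 1)) (Inc d)) + 1) + 1) (0, g(d := eval s (Add a b) (g \<circ> \<rho>)), w)"
    by (rule loop_straight[where n = ?n and \<sigma> = "\<lambda>k. (0, ?g(d := ?g d + k, d + 1 := ?n - k), w)"])
      (use n Add.prems in \<open>auto simp: fun_eq_iff\<close>)
  show ?case unfolding compile.simps by (rule runs_mono[OF runs_Seq[OF 1 runs_Seq[OF 2 3]]]) simp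
next
  case (Sub a b)
  let ?g = "g(d := eval s a (g \<circ> \<rho>))" let ?n = "eval s b (g \<circ> \<rho>)"
  have r: "\<rho> i \<noteq> d" for i using Sub.prems(1)[of i] by simp
  have env: "?g \<circ> \<rho> = g \<circ> \<rho>" by (auto simp: fun_eq_iff r)
  have 1: "runs s (compile a \<rho> d) (0, g, w) (cost a X) (0, ?g, w)"
    by (rule Sub.IH(1)) (use Sub.prems in auto)
  have "runs s (compile b \<rho> (d + 1)) (0, ?g, w) (cost b X) (0, ?g(d + 1 := eval s b (?g \<circ> \<rho>)), w)"
    by (rule Sub.IH(2)) (use Sub.prems r in \<open>auto simp: less_SucI\<close>)
  then have 2: "runs s (compile b \<rho> (d + 1)) (0, ?g, w) (cost b X) (0, ?g(d + 1 := ?n), w)"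
    unfolding env .
  have n: "?n \<le> vb b X" by (rule eval_le) (use Sub.prems in auto)
  have 3: "runs s (Loop (Nz (d + 1)) (Seq (Dec (d + 1)) (Dec d))) (0, ?g(d + 1 := ?n), w)
      (vb b X * (ticks (Seq (Dec (d + 1)) (Dec d)) + 1) + 1) (0, g(d := eval s (Sub a b) (g \<circ> \<rho>)), w)"
    by (rule loop_straight[where n = ?n and \<sigma> = "\<lambda>k. (0, ?g(d := ?g d - k, d + 1 := ?n - k), w)"])
      (use n Sub.prems in \<open>auto simp: fun_eq_iff\<close>)
  show ?case unfolding compile.simps by (rule runs_mono[OF runs_Seq[OF 1 runs_Seq[OF 2 3]]]) simp
next
  case (Inp A a)
  let ?n = "eval s a (g \<circ> \<rho>)" let ?y = "eval s (Inp A a) (g \<circ> \<rho>)"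
  have 1: "runs s (compile a \<rho> (d + 1)) (0, g, w) (cost a X) (0, g(d + 1 := ?n), w)"
    by (rule Inp.IH) (use Inp.prems in \<open>auto simp: less_SucI\<close>)
  have n: "?n \<le> vb a X" by (rule eval_le) (use Inp.prems in auto)
  have 2: "runs s (Loop (Nz (d + 1)) (Seq (Dec (d + 1)) (Seq (Inc (d + 2)) Fwd))) (0, g(d + 1 := ?n), w)
      (vb a X * (ticks (Seq (Dec (d + 1)) (Seq (Inc (d + 2)) Fwd)) + 1) + 1) (int ?n, g(d + 2 := ?n), w)"
    by (rule loop_straight[where n = ?n and \<sigma> = "\<lambda>k. (int k, g(d + 1 := ?n - k, d + 2 := k), w)"])
      (use n Inp.prems in \<open>auto simp: fun_eq_iff\<close>)
  have 3: "runs s (Cond (Sym A) (Inc d)) (int ?n, g(d + 2 := ?n), w) (1 + 1) (int ?n, g(d := ?y, d + 2 := ?n), w)"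
  proof (rule runs_Cond)
    assume "holds s (int ?n, g(d + 2 := ?n), w) (Sym A)"
    then show "runs s (Inc d) (int ?n, g(d + 2 := ?n), w) 1 (int ?n, g(d := ?y, d + 2 := ?n), w)"
      by (intro runs_prim) (use Inp.prems in \<open>auto simp: fun_eq_iff\<close>)
  qed (use Inp.prems in \<open>auto simp: fun_eq_iff\<close>)
  have 4: "runs s (Loop (Nz (d + 2)) (Seq (Dec (d + 2)) Bwd)) (int ?n, g(d := ?y, d + 2 := ?n), w)
      (vb a X * (ticks (Seq (Dec (d + 2)) Bwd) + 1) + 1) (0, g(d := ?y), w)"
    by (rule loop_straight[where n = ?n and \<sigma> = "\<lambda>k. (int (?n - k), g(d := ?y, d + 2 := ?n - k), w)"])
      (use n Inp.prems in \<open>auto simp: fun_eq_iff of_nat_diff\<close>)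
  show ?case unfolding compile.simps
    by (rule runs_mono[OF runs_Seq[OF 1 runs_Seq[OF 2 runs_Seq[OF 3 4]]]]) simp
next
  case Len
  let ?n = "length s"
  \<comment> \<open>No input symbol is blank, so the first blank met by the head marks the end of
    the input.\<close>
  have nz: "s ! i \<noteq> 0" if "i < ?n" for i using assms that by (metis nth_mem)
  have 1: "runs s (Loop (Sym (- {0})) (Seq (Inc d) (Seq (Inc (d + 1)) Fwd))) (0, g, w)
      (X * (ticks (Seq (Inc d) (Seq (Inc (d + 1)) Fwd)) + 1) + 1) (int ?n, g(d := ?n, d + 1 := ?n), w)"
    by (rule loop_straight[where n = ?n and \<sigma> = "\<lambda>k. (int k, g(d := k, d + 1 := k), w)"])
      (use Len nz in \<open>auto simp: fun_eq_iff contents_def\<close>)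
  have 2: "runs s (Loop (Nz (d + 1)) (Seq (Dec (d + 1)) Bwd)) (int ?n, g(d := ?n, d + 1 := ?n), w)
      (X * (ticks (Seq (Dec (d + 1)) Bwd) + 1) + 1) (0, g(d := ?n), w)"
    by (rule loop_straight[where n = ?n and \<sigma> = "\<lambda>k. (int (?n - k), g(d := ?n, d + 1 := ?n - k), w)"])
      (use Len in \<open>auto simp: fun_eq_iff of_nat_diff\<close>)
  show ?case unfolding compile.simps eval.simps comp_def by (rule runs_mono[OF runs_Seq[OF 1 2]]) simp
next
  case (Sum a b)
  let ?n = "eval s a (g \<circ> \<rho>)" let ?Y = "X + vb a X"
  let ?e = "\<lambda>i. eval s b (case_nat i (g \<circ> \<rho>))"
  \<comment> \<open>Loop invariant: \<open>d\<close> holds the partial sum, \<open>d + 1\<close> the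
    number of iterations left, \<open>d + 2\<close> the bound variable; \<open>d + 3\<close> is
    empty between iterations and receives the summand.\<close>
  let ?\<sigma> = "\<lambda>k. g(d := (\<Sum>i<k. ?e i), d + 1 := ?n - k, d + 2 := k)"
  have 1: "runs s (compile a \<rho> (d + 1)) (0, g, w) (cost a X) (0, g(d + 1 := ?n), w)"
    by (rule Sum.IH(1)) (use Sum.prems in \<open>auto simp: less_SucI\<close>)
  have n: "?n \<le> vb a X" by (rule eval_le) (use Sum.prems in auto)
  have rd: "\<rho> i \<noteq> d + k" for i k using Sum.prems(1)[of i] by simp
  let ?body = "Seq (Dec (d + 1)) (Seq (compile b (case_nat (d + 2) \<rho>) (d + 3))
            (Seq (Loop (Nz (d + 3)) (Seq (Dec (d + 3)) (Inc d))) (Inc (d + 2))))"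
  let ?B = "1 + 1 + (1 + cost b ?Y + (1 + (vb b ?Y * 4 + 1) + 1))"
  have body: "runs s ?body (0, ?\<sigma> k, w) ?B (0, ?\<sigma> (Suc k), w)" if k: "k < ?n" for k
  proof -
    let ?g = "(?\<sigma> k)(d + 1 := ?n - Suc k)"
    have 1: "runs s (Dec (d + 1)) (0, ?\<sigma> k, w) 1 (0, ?g, w)"
      by (rule runs_prim) (auto simp: fun_eq_iff)
    have env: "?g \<circ> case_nat (d + 2) \<rho> = case_nat k (g \<circ> \<rho>)"
      using rd[of _ 0] rd[of _ 1] rd[of _ 2] by (auto simp: fun_eq_iff split: nat.split)
    have Y: "(case_nat k (g \<circ> \<rho>)) i \<le> ?Y" for i
      using Sum.prems(3)[of "i - 1"] k n by (cases i) auto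
    have e: "?e k \<le> vb b ?Y" by (rule eval_le) (use Y Sum.prems in auto)
    have 2: "runs s (compile b (case_nat (d + 2) \<rho>) (d + 3)) (0, ?g, w) (cost b ?Y)
        (0, ?g(d + 3 := eval s b (?g \<circ> case_nat (d + 2) \<rho>)), w)"
    proof (rule Sum.IH(2))
      fix i show "(case i of 0 \<Rightarrow> d + 2 | Suc j \<Rightarrow> \<rho> j) < d + 3"
        using Sum.prems(1)[of "i - 1"] by (cases i) auto
      show "?g (case i of 0 \<Rightarrow> d + 2 | Suc j \<Rightarrow> \<rho> j) \<le> ?Y"
        using Y[of i] fun_cong[OF env, of i] by (simp only: comp_def)
    qed (use Sum.prems in auto)
    have 3: "runs s (Loop (Nz (d + 3)) (Seq (Dec (d + 3)) (Inc d))) (0, ?g(d + 3 := ?e k), w)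
       (vb b ?Y * (ticks (Seq (Dec (d + 3)) (Inc d)) + 1) + 1) (0, ?g(d := (\<Sum>i<Suc k. ?e i)), w)"
      by (rule loop_straight[where n = "?e k" and
            \<sigma> = "\<lambda>j. (0, ?g(d := (\<Sum>i<k. ?e i) + j, d + 3 := ?e k - j), w)"])
        (use e Sum.prems in \<open>auto simp: fun_eq_iff\<close>)
    have 4: "runs s (Inc (d + 2)) (0, ?g(d := (\<Sum>i<Suc k. ?e i)), w) 1 (0, ?\<sigma> (Suc k), w)"
      by (rule runs_prim) (auto simp: fun_eq_iff)
    show ?thesis by (rule runs_mono[OF runs_Seq[OF 1 runs_Seq[OF 2[unfolded env] runs_Seq[OF 3 4]]]]) simp
  qed
  have s0: "?\<sigma> 0 = g(d + 1 := ?n)" using Sum.prems by (auto simp: fun_eq_iff)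
  have "runs s (Loop (Nz (d + 1)) ?body) (0, ?\<sigma> 0, w) (?n * (?B + 1) + 1) (0, ?\<sigma> ?n, w)"
    by (rule runs_Loop[where \<sigma> = "\<lambda>k. (0, ?\<sigma> k, w)"]) (use body in auto)
  then have 2: "runs s (Loop (Nz (d + 1)) ?body) (0, g(d + 1 := ?n), w) (?n * (?B + 1) + 1) (0, ?\<sigma> ?n, w)"
    unfolding s0 .
  have 3: "runs s (Loop (Nz (d + 2)) (Dec (d + 2))) (0, ?\<sigma> ?n, w)
      (vb a X * (ticks (Dec (d + 2)) + 1) + 1) (0, g(d := \<Sum>i<?n. ?e i), w)"
    by (rule loop_straight[where n = ?n and \<sigma> = "\<lambda>k. (0, g(d := \<Sum>i<?n. ?e i, d + 2 := ?n - k), w)"])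
      (use n Sum.prems in \<open>auto simp: fun_eq_iff\<close>)
  have "?n * (?B + 1) \<le> vb a X * (?B + 1)" using n by (rule mult_right_mono) simp
  then have "1 + cost a X + (1 + (?n * (?B + 1) + 1) + (vb a X * (ticks (Dec (d + 2)) + 1) + 1))
    \<le> cost (Sum a b) X" by (simp add: algebra_simps)
  then show ?case unfolding compile.simps eval.simps by (rule runs_mono[OF runs_Seq[OF 1 runs_Seq[OF 2 3]]])
qed

section \<open>Polynomial bounds on values and running times\<close>

definition poly_bounded :: "(nat \<Rightarrow> nat) \<Rightarrow> bool" where
  "poly_bounded f \<longleftrightarrow> (\<exists>p :: nat poly. \<forall>x. f x \<le> poly p x)"

lemma poly_nat_mono: "x \<le> y \<Longrightarrow> poly (p :: nat poly) x \<le> poly p y"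
  by (induction p) (auto intro!: add_mono mult_mono)

lemma poly_bounded_const: "poly_bounded (\<lambda>x. c)"
  unfolding poly_bounded_def by (rule exI[of _ "[:c:]"]) simp

lemma poly_bounded_id: "poly_bounded (\<lambda>x. x)"
  unfolding poly_bounded_def by (rule exI[of _ "[:0, 1:]"]) simp

lemma poly_bounded_add:
  assumes "poly_bounded f" "poly_bounded g"
  shows "poly_bounded (\<lambda>x. f x + g x)"
proof -
  obtain p q where "\<And>x. f x \<le> poly p x" "\<And>x. g x \<le> poly q x"
    using assms unfolding poly_bounded_def by auto
  then show ?thesis unfolding poly_bounded_def by (intro exI[of _ "p + q"]) (simp add: add_mono)
qed

lemma poly_bounded_mult:
  assumes "poly_bounded f" "poly_bounded g"
  shows "poly_bounded (\<lambda>x. f x * g x)"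
proof -
  obtain p q where "\<And>x. f x \<le> poly p x" "\<And>x. g x \<le> poly q x"
    using assms unfolding poly_bounded_def by auto
  then show ?thesis unfolding poly_bounded_def by (intro exI[of _ "p * q"]) (simp add: mult_mono)
qed

text \<open>Polynomials with natural coefficients are monotone, so the bound on the inner function
  may be inserted into the outer bound. Sums need this, since their body is estimated at an enlarged
  argument.\<close>

lemma poly_bounded_compose:
  assumes "poly_bounded f" "poly_bounded g"
  shows "poly_bounded (\<lambda>x. f (g x))"
proof -
  obtain p q where p: "\<And>x. f x \<le> poly p x" and q: "\<And>x. g x \<le> poly q x"
    using assms unfolding poly_bounded_def by auto
  have "f (g x) \<le> poly (pcompose p q) x" for x
    using order_trans[OF p[of "g x"] poly_nat_mono[OF q]] by (simp add: poly_pcompose)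
  then show ?thesis unfolding poly_bounded_def by blast
qed

lemmas poly_bounded_intros = poly_bounded_const poly_bounded_id poly_bounded_add poly_bounded_mult

lemma poly_bounded_cong: "(\<And>x. f x = g x) \<Longrightarrow> poly_bounded g \<Longrightarrow> poly_bounded f"
  unfolding poly_bounded_def by simp

lemma poly_bounded_vb: "poly_bounded (vb e)"
proof (induction e)
  case (Sum a b)
  show ?case
    by (rule poly_bounded_cong[OF vb.simps(7)])
      (intro poly_bounded_intros poly_bounded_compose[OF Sum.IH(2)] Sum.IH(1))
next
  case (Add a b)
  show ?case by (rule poly_bounded_cong[OF vb.simps(3)]) (intro poly_bounded_intros Add.IH)
next
  case (Sub a b)
  show ?case by (rule poly_bounded_cong[OF vb.simps(4)]) (rule Sub.IH)
qed (rule poly_bounded_cong, rule vb.simps, intro poly_bounded_intros)+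

lemma poly_bounded_cost: "poly_bounded (cost e)"
proof (induction e)
  case (Sum a b)
  show ?case
    by (rule poly_bounded_cong[OF cost.simps(7)])
      (intro poly_bounded_intros poly_bounded_compose[OF Sum.IH(2)]
        poly_bounded_compose[OF poly_bounded_vb[of b]] Sum.IH(1) poly_bounded_vb[of a])
next
  case (Add a b)
  show ?case by (rule poly_bounded_cong[OF cost.simps(3)]) (intro poly_bounded_intros Add.IH poly_bounded_vb)
next
  case (Sub a b)
  show ?case by (rule poly_bounded_cong[OF cost.simps(4)]) (intro poly_bounded_intros Sub.IH poly_bounded_vb)
next
  case (Inp A a)
  show ?case by (rule poly_bounded_cong[OF cost.simps(5)]) (intro poly_bounded_intros Inp.IH poly_bounded_vb)
qed (rule poly_bounded_cong, rule cost.simps, intro poly_bounded_intros)+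

section \<open>Machines that decide by an expression or output its values\<close>

theorem decide_exp:
  obtains M p where "wf_tm M" "\<And>s. 0 \<notin> set s \<Longrightarrow> halted M (run M s (poly p (length s)))"
    "\<And>s. 0 \<notin> set s \<Longrightarrow> fst (run M s (poly p (length s))) = accept M \<longleftrightarrow> eval s e (\<lambda>_. 0) \<noteq> 0"
proof -
  obtain B where B: "\<And>x. cost e x \<le> poly B x"
    using poly_bounded_cost unfolding poly_bounded_def by blast
  \<comment> \<open>All free variables are mapped to register 0, which stays 0; the value goes to
    register 1, the one that decides acceptance.\<close>
  have "runs s (compile e (\<lambda>_. 0) 1) init_store (poly B (length s)) (0, (\<lambda>_. 0)(1 := eval s e (\<lambda>_. 0)), [])"
    if "0 \<notin> set s" for s
  proof -
    have "runs s (compile e (\<lambda>_. 0) 1) (0, \<lambda>_. 0, []) (cost e (length s))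
      (0, (\<lambda>_. 0)(1 := eval s e ((\<lambda>_. 0) \<circ> (\<lambda>_. 0 :: nat))), [])"
      by (rule compile_correct[OF that]) auto
    from runs_mono[OF this B] show ?thesis unfolding init_store_def comp_def .
  qed
  then obtain M p where M: "wf_tm M" "\<And>s. 0 \<notin> set s \<Longrightarrow> run M s (poly p (length s)) =
       (if ((\<lambda>_ :: nat. 0)(1 := eval s e (\<lambda>_. 0))) 1 \<noteq> (0 :: nat) then accept M else reject M,
        map (tp s (0, (\<lambda>_. 0)(1 := eval s e (\<lambda>_. 0)), [])) [0..<num_tapes M])"
    using that by (rule tm_of_runs[of "\<lambda>s. 0 \<notin> set s" _ B "\<lambda>_. 0" "\<lambda>s. (\<lambda>_. 0)(1 := eval s e (\<lambda>_. 0))" "\<lambda>_. []"])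
  moreover have "accept M \<noteq> reject M" using M(1) by (simp add: wf_tm_def)
  ultimately show thesis by (intro that[of M p]) (auto simp: halted_def)
qed

text \<open>Register 1 counts down the bits still to be written, register 2 is the index of the next
  bit and register 3 holds its value. Register 1 is 0 at the end, so the machine halts in its
  rejecting state; its result is on the output tape.\<close>

theorem polytime_exp:
  "polytime_computable (\<lambda>x. map (\<lambda>i. eval (syms x) b (case_nat i (\<lambda>_. 0)) \<noteq> 0) [0..<eval (syms x) l (\<lambda>_. 0)])"
proof -
  let ?n = "\<lambda>s. eval s l (\<lambda>_. 0)" let ?b = "\<lambda>s i. eval s b (case_nat i (\<lambda>_. 0))"
  let ?body = "Seq (Dec 1) (Seq (compile b (case_nat 2 (\<lambda>_. 0)) 3)
    (Seq (Out 3) (Seq (Loop (Nz 3) (Dec 3)) (Inc 2))))"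
  let ?c = "Seq (compile l (\<lambda>_. 0) 1) (Loop (Nz 1) ?body)"
  let ?Y = "\<lambda>X. X + vb l X"
  let ?B = "\<lambda>X. 1 + 1 + (1 + cost b (?Y X) + (1 + 1 + (1 + (vb b (?Y X) * 2 + 1) + 1)))"
  let ?C = "\<lambda>X. 1 + cost l X + (vb l X * (?B X + 1) + 1)"
  have "poly_bounded ?C"
    by (intro poly_bounded_intros poly_bounded_compose[OF poly_bounded_vb[of b]]
        poly_bounded_compose[OF poly_bounded_cost[of b]] poly_bounded_vb[of l] poly_bounded_cost[of l])
  then obtain B where B: "\<And>x. ?C x \<le> poly B x" unfolding poly_bounded_def by blast
  have "runs s ?c init_store (poly B (length s))
     (0, (\<lambda>_. 0)(2 := ?n s), map (\<lambda>i. ?b s i \<noteq> 0) [0..<?n s])"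
    if s: "0 \<notin> set s" for s
  proof -
    let ?X = "length s"
    let ?g = "\<lambda>k. (\<lambda>_ :: nat. 0)(1 := ?n s - k, 2 := k)" let ?w = "\<lambda>k. map (\<lambda>i. ?b s i \<noteq> 0) [0..<k]"
    have 1: "runs s (compile l (\<lambda>_. 0) 1) (0, \<lambda>_. 0, []) (cost l ?X)
      (0, (\<lambda>_. 0)(1 := eval s l ((\<lambda>_. 0) \<circ> (\<lambda>_. 0 :: nat))), [])"
      by (rule compile_correct[OF s]) auto
    have n: "?n s \<le> vb l ?X" by (rule eval_le) auto
    have body: "runs s ?body (0, ?g k, ?w k) (?B ?X) (0, ?g (Suc k), ?w (Suc k))" if k: "k < ?n s" for k
    proof -
      let ?h = "(?g k)(1 := ?n s - Suc k)"
      have 1: "runs s (Dec 1) (0, ?g k, ?w k) 1 (0, ?h, ?w k)"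
        by (rule runs_prim) (auto simp: fun_eq_iff)
      have env: "?h \<circ> case_nat 2 (\<lambda>_. 0) = case_nat k (\<lambda>_. 0)"
        by (auto simp: fun_eq_iff split: nat.split)
      have Y: "(case_nat k (\<lambda>_. 0)) i \<le> ?Y ?X" for i using k n by (cases i) auto
      have e: "?b s k \<le> vb b (?Y ?X)" by (rule eval_le) (use Y in auto)
      have 2: "runs s (compile b (case_nat 2 (\<lambda>_. 0)) 3) (0, ?h, ?w k) (cost b (?Y ?X))
        (0, ?h(3 := eval s b (?h \<circ> case_nat 2 (\<lambda>_. 0))), ?w k)"
      proof (rule compile_correct[OF s])
        fix i show "(case i of 0 \<Rightarrow> 2 | Suc j \<Rightarrow> 0) < (3 :: nat)" by (cases i) auto
        show "?h (case i of 0 \<Rightarrow> 2 | Suc j \<Rightarrow> 0) \<le> ?Y ?X"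
          using Y[of i] fun_cong[OF env, of i] by (simp only: comp_def)
      qed auto
      have 3: "runs s (Out 3) (0, ?h(3 := ?b s k), ?w k) 1 (0, ?h(3 := ?b s k), ?w (Suc k))"
        by (rule runs_prim) auto
      have 4: "runs s (Loop (Nz 3) (Dec 3)) (0, ?h(3 := ?b s k), ?w (Suc k))
        (vb b (?Y ?X) * (ticks (Dec 3) + 1) + 1) (0, ?h, ?w (Suc k))"
        by (rule loop_straight[where n = "?b s k" and \<sigma> = "\<lambda>j. (0, ?h(3 := ?b s k - j), ?w (Suc k))"])
          (use e in \<open>auto simp: fun_eq_iff simp del: upt_Suc\<close>)
      have 5: "runs s (Inc 2) (0, ?h, ?w (Suc k)) 1 (0, ?g (Suc k), ?w (Suc k))"
        by (rule runs_prim) (auto simp: fun_eq_iff)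
      show ?thesis
        by (rule runs_mono[OF runs_Seq[OF 1 runs_Seq[OF 2[unfolded env] runs_Seq[OF 3 runs_Seq[OF 4 5]]]]]) simp
    qed
    have "runs s (Loop (Nz 1) ?body) (0, ?g 0, ?w 0) (?n s * (?B ?X + 1) + 1) (0, ?g (?n s), ?w (?n s))"
      by (rule runs_Loop[where \<sigma> = "\<lambda>k. (0, ?g k, ?w k)"]) (use body in \<open>auto simp del: upt_Suc\<close>)
    moreover have "?g 0 = (\<lambda>_. 0)(1 := ?n s)" "?w 0 = []" "?g (?n s) = (\<lambda>_. 0)(2 := ?n s)"
      by (auto simp: fun_eq_iff)
    ultimately have 2: "runs s (Loop (Nz 1) ?body) (0, (\<lambda>_. 0)(1 := ?n s), []) (?n s * (?B ?X + 1) + 1)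
       (0, (\<lambda>_. 0)(2 := ?n s), ?w (?n s))" by simp
    have "?n s * (?B ?X + 1) \<le> vb l ?X * (?B ?X + 1)" using n by (rule mult_right_mono) simp
    then have "1 + cost l ?X + (?n s * (?B ?X + 1) + 1) \<le> poly B ?X" using B[of ?X] by linarith
    then show ?thesis
      unfolding init_store_def by (rule runs_mono[OF runs_Seq[OF 1[unfolded comp_def] 2]])
  qed
  then obtain M p where M: "wf_tm M" "\<And>s. 0 \<notin> set s \<Longrightarrow> run M s (poly p (length s)) =
       (if ((\<lambda>_ :: nat. 0)(2 := ?n s)) 1 \<noteq> (0 :: nat) then accept M else reject M,
        map (tp s (0, (\<lambda>_. 0)(2 := ?n s), map (\<lambda>i. ?b s i \<noteq> 0) [0..<?n s])) [0..<num_tapes M])"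
    using that by (rule tm_of_runs[of "\<lambda>s. 0 \<notin> set s" ?c B "\<lambda>_. 0" "\<lambda>s. (\<lambda>_. 0)(2 := ?n s)"
        "\<lambda>s. map (\<lambda>i. ?b s i \<noteq> 0) [0..<?n s]"])
  have "num_tapes M \<ge> 2" using M(1) by (simp add: wf_tm_def)
  moreover have "0 \<notin> set (syms x)" "length (syms x) = length x" for x by (auto simp: syms_def)
  ultimately show ?thesis
    unfolding polytime_computable_def using M(1) M(2)[of "syms x" for x]
    by (intro exI[of _ M] exI[of _ p]) (simp add: halted_def Let_def)
qed

section \<open>Definable functions\<close>

text \<open>Definability is a property of HOL functions of the input and of an environment of de
  Bruijn indices. Expressions are thus never written out: resolution with the closure rules below
  finds them.\<close>

definition definable :: "(nat list \<Rightarrow> (nat \<Rightarrow> nat) \<Rightarrow> nat) \<Rightarrow> bool" where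
  "definable F \<longleftrightarrow> (\<exists>e. \<forall>s v. eval s e v = F s v)"

definition pdefinable :: "(nat list \<Rightarrow> (nat \<Rightarrow> nat) \<Rightarrow> bool) \<Rightarrow> bool" where
  "pdefinable P \<longleftrightarrow> definable (\<lambda>s v. of_bool (P s v))"

text \<open>Needed to place an expression under a sum, where its free indices shift by one.\<close>

fun rename :: "(nat \<Rightarrow> nat) \<Rightarrow> exp \<Rightarrow> exp" where
  "rename f (Var i) = Var (f i)"
| "rename f One = One"
| "rename f (Add a b) = Add (rename f a) (rename f b)"
| "rename f (Sub a b) = Sub (rename f a) (rename f b)"
| "rename f (Inp A a) = Inp A (rename f a)"
| "rename f Len = Len"
| "rename f (Sum a b) = Sum (rename f a) (rename (case_nat 0 (\<lambda>i. Suc (f i))) b)"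

lemma eval_rename: "eval s (rename f e) v = eval s e (\<lambda>i. v (f i))"
proof (induction e arbitrary: f v)
  case (Sum a b)
  have "(\<lambda>j. case_nat i v (case_nat 0 (\<lambda>i. Suc (f i)) j)) = case_nat i (\<lambda>i. v (f i))" for i
    by (auto simp: fun_eq_iff split: nat.split)
  then show ?case using Sum by simp
qed auto

lemma definable_rename: "definable F \<Longrightarrow> definable (\<lambda>s v. F s (\<lambda>i. v (f i)))"
  unfolding definable_def by (metis eval_rename)

lemma definable_var: "definable (\<lambda>s v. v i)"
  unfolding definable_def by (rule exI[of _ "Var i"]) simp

lemma definable_add: "definable F \<Longrightarrow> definable G \<Longrightarrow> definable (\<lambda>s v. F s v + G s v)"
  unfolding definable_def by (metis eval.simps(3))

lemma definable_sub: "definable F \<Longrightarrow> definable G \<Longrightarrow> definable (\<lambda>s v. F s v - G s v)"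
  unfolding definable_def by (metis eval.simps(4))

lemma definable_const: "definable (\<lambda>s v. c)"
proof (induction c)
  case 0
  show ?case unfolding definable_def by (rule exI[of _ "Sub One One"]) simp
next
  case (Suc c)
  moreover have "definable (\<lambda>s v. 1)" unfolding definable_def by (rule exI[of _ One]) simp
  ultimately show ?case using definable_add by fastforce
qed

lemma definable_Suc: "definable F \<Longrightarrow> definable (\<lambda>s v. Suc (F s v))"
  using definable_add[OF _ definable_const[of 1]] by simp

lemma definable_length: "definable (\<lambda>s v. length s)"
  unfolding definable_def by (rule exI[of _ Len]) simp

text \<open>Inside the body index 0 is the summation variable and the outer environment is shifted,
  which is why the premise passes the tail of \<open>v\<close> and \<open>v 0\<close>
  separately.\<close>

lemma definable_sum:
  assumes "definable F" "definable (\<lambda>s v. G s (\<lambda>i. v (Suc i)) (v 0))"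
  shows "definable (\<lambda>s v. \<Sum>i<F s v. G s v i)"
proof -
  obtain a b where "\<And>s v. eval s a v = F s v" "\<And>s v. eval s b v = G s (\<lambda>i. v (Suc i)) (v 0)"
    using assms unfolding definable_def by auto
  then show ?thesis unfolding definable_def by (intro exI[of _ "Sum a b"]) simp
qed

lemma definable_mult:
  assumes "definable F" "definable G"
  shows "definable (\<lambda>s v. F s v * G s v)"
  using definable_sum[OF assms(1), of "\<lambda>s v i. G s v", OF definable_rename[OF assms(2)]] by simp

section \<open>Closure of definable predicates\<close>

lemma pdefinable_not:
  assumes "pdefinable P"
  shows "pdefinable (\<lambda>s v. \<not> P s v)"
proof -
  have "of_bool (\<not> b) = 1 - (of_bool b :: nat)" for b by simp
  then show ?thesis using assms
    unfolding pdefinable_def by (simp only:) (intro definable_sub definable_const)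
qed

lemma pdefinable_conj: "pdefinable P \<Longrightarrow> pdefinable Q \<Longrightarrow> pdefinable (\<lambda>s v. P s v \<and> Q s v)"
  unfolding pdefinable_def of_bool_conj by (rule definable_mult)

lemma pdefinable_disj:
  assumes "pdefinable P" "pdefinable Q"
  shows "pdefinable (\<lambda>s v. P s v \<or> Q s v)"
  using pdefinable_not[OF pdefinable_conj[OF assms[THEN pdefinable_not]]] by simp

lemma pdefinable_imp:
  assumes "pdefinable P" "pdefinable Q"
  shows "pdefinable (\<lambda>s v. P s v \<longrightarrow> Q s v)"
  using pdefinable_disj[OF pdefinable_not[OF assms(1)] assms(2)] by (simp only: imp_conv_disj)

lemma pdefinable_le:
  assumes "definable F" "definable G"
  shows "pdefinable (\<lambda>s v. F s v \<le> G s v)"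
proof -
  have "(of_bool (m \<le> n) :: nat) = 1 - (m - n)" for m n :: nat by simp
  then show ?thesis unfolding pdefinable_def using assms
    by (simp only:) (intro definable_sub definable_const)
qed

lemma pdefinable_less:
  assumes "definable F" "definable G"
  shows "pdefinable (\<lambda>s v. F s v < G s v)"
  using pdefinable_le[OF definable_Suc[OF assms(1)] assms(2)] by (simp add: Suc_le_eq)

lemma pdefinable_eq:
  assumes "definable F" "definable G"
  shows "pdefinable (\<lambda>s v. F s v = G s v)"
proof -
  have "(\<lambda>s v. F s v = G s v) = (\<lambda>s v. F s v \<le> G s v \<and> G s v \<le> F s v)"
    by (auto simp: fun_eq_iff)
  then show ?thesis by (simp only:) (intro pdefinable_conj pdefinable_le assms)
qed

lemma pdefinable_const: "pdefinable (\<lambda>s v. b)"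
  unfolding pdefinable_def by (rule definable_const)

lemma pdefinable_ex:
  assumes "definable F" "pdefinable (\<lambda>s v. P s (\<lambda>i. v (Suc i)) (v 0))"
  shows "pdefinable (\<lambda>s v. \<exists>i<F s v. P s v i)"
proof -
  have "(\<exists>i<n. Q i) \<longleftrightarrow> 0 < (\<Sum>i<n. of_bool (Q i) :: nat)" for Q and n :: nat
    by (simp add: sum_of_bool_eq card_gt_0_iff) blast
  then show ?thesis
    using assms(2) unfolding pdefinable_def[of "\<lambda>s v. P s (\<lambda>i. v (Suc i)) (v 0)"]
    by (simp only:) (intro pdefinable_less definable_const definable_sum assms(1))
qed

lemma pdefinable_all:
  assumes "definable F" "pdefinable (\<lambda>s v. P s (\<lambda>i. v (Suc i)) (v 0))"
  shows "pdefinable (\<lambda>s v. \<forall>i<F s v. P s v i)"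
  using pdefinable_not[OF pdefinable_ex[OF assms(1) pdefinable_not[OF assms(2)]]] by simp

text \<open>A quantifier over a fixed finite set is a disjunction of fixed length, whatever the type
  of its elements. It is used for the rules and kinds that belong to a given machine.\<close>

lemma pdefinable_bex_const:
  assumes "finite A" "\<And>a. a \<in> A \<Longrightarrow> pdefinable (\<lambda>s v. P a s v)"
  shows "pdefinable (\<lambda>s v. \<exists>a\<in>A. P a s v)"
  using assms
proof (induction A)
  case (insert a A)
  then show ?case unfolding bex_simps by (intro pdefinable_disj) simp_all
qed (simp add: pdefinable_const)

lemma definable_of_bool: "pdefinable P \<Longrightarrow> definable (\<lambda>s v. of_bool (P s v))"
  by (simp add: pdefinable_def)

lemma pdefinable_symbol: "definable F \<Longrightarrow> pdefinable (\<lambda>s v. contents s (int (F s v)) \<in> A)"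
  unfolding pdefinable_def definable_def by (metis eval.simps(5))

lemma pdefinable_symbol_eq: "definable F \<Longrightarrow> pdefinable (\<lambda>s v. contents s (int (F s v)) = a)"
  using pdefinable_symbol[of F "{a}"] by simp

text \<open>The quotient counts the \<open>q\<close> with \<open>Suc q * n \<le> m\<close>, all of
  which are below \<open>m\<close>; the conjunct \<open>0 < n\<close> reproduces
  \<open>m div 0 = 0\<close>.\<close>

lemma definable_div:
  assumes "definable F" "definable G"
  shows "definable (\<lambda>s v. F s v div G s v)"
proof -
  have "m div n = (\<Sum>q<m. of_bool (0 < n \<and> Suc q * n \<le> m))" for m n :: nat
  proof (cases "n = 0")
    case False
    have "{q. q < m \<and> 0 < n \<and> Suc q * n \<le> m} = {..<m div n}"
    proof (intro set_eqI iffI)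
      fix q assume "q \<in> {..<m div n}"
      then have "Suc q \<le> m div n" by simp
      then have *: "Suc q * n \<le> m" using False by (simp add: less_eq_div_iff_mult_less_eq)
      moreover have "Suc q * 1 \<le> Suc q * n" using False by (intro mult_le_mono) auto
      ultimately have "Suc q * 1 \<le> m" by (rule le_trans[rotated])
      then have "q < m" by simp
      then show "q \<in> {q. q < m \<and> 0 < n \<and> Suc q * n \<le> m}" using False * by simp
    next
      fix q assume "q \<in> {q. q < m \<and> 0 < n \<and> Suc q * n \<le> m}"
      then have "Suc q \<le> m div n"
        using False by (simp only: less_eq_div_iff_mult_less_eq mem_Collect_eq)
      then show "q \<in> {..<m div n}" by simp
    qed
    then have "card ({..<m} \<inter> {q. 0 < n \<and> Suc q * n \<le> m}) = m div n"
      by (simp add: Int_def)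
    then show ?thesis by (simp add: sum_of_bool_eq)
  qed simp
  then show ?thesis
    by (simp only:) (intro definable_sum definable_of_bool pdefinable_conj pdefinable_less
      pdefinable_le definable_mult definable_Suc definable_const definable_var
      definable_rename[OF assms(1)] definable_rename[OF assms(2)] assms)
qed

lemma definable_mod:
  assumes "definable F" "definable G"
  shows "definable (\<lambda>s v. F s v mod G s v)"
  unfolding modulo_nat_def by (intro definable_sub definable_mult definable_div assms)

lemma definable_if:
  assumes "pdefinable P" "definable F" "definable G"
  shows "definable (\<lambda>s v. if P s v then F s v else G s v)"
proof -
  have "(if b then m else n) = of_bool b * m + of_bool (\<not> b) * n" for b and m n :: nat by simp
  then show ?thesis
    by (simp only:) (intro definable_add definable_mult definable_of_bool pdefinable_not assms)
qed

lemma pdefinable_if: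
  assumes "pdefinable P" "pdefinable Q" "pdefinable R"
  shows "pdefinable (\<lambda>s v. if P s v then Q s v else R s v)"
proof -
  have "(\<lambda>s v. if P s v then Q s v else R s v) = (\<lambda>s v. P s v \<and> Q s v \<or> \<not> P s v \<and> R s v)"
    by (simp add: fun_eq_iff)
  then show ?thesis
    by (simp only:) (intro pdefinable_disj pdefinable_conj pdefinable_not assms)
qed

lemma pdefinable_dvd:
  assumes "definable F" "definable G"
  shows "pdefinable (\<lambda>s v. F s v dvd G s v)"
  unfolding dvd_eq_mod_eq_0 by (intro pdefinable_eq definable_mod definable_const assms)

lemma definable_poly: "definable F \<Longrightarrow> definable (\<lambda>s v. poly p (F s v))"
proof (induction p)
  case (pCons a p)
  then show ?case unfolding poly_pCons by (intro definable_add definable_mult definable_const)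
qed (simp add: definable_const)

text \<open>Substitution, expressed as a sum with a single nonzero term.\<close>

lemma definable_let:
  assumes "definable F" "definable (\<lambda>s v. G s (\<lambda>i. v (Suc i)) (v 0))"
  shows "definable (\<lambda>s v. G s v (F s v))"
proof -
  have "(\<lambda>s v. G s v (F s v)) = (\<lambda>s v. \<Sum>i<Suc (F s v). of_bool (i = F s v) * G s v i)"
    by (simp add: fun_eq_iff)
  then show ?thesis
    by (simp only:) (intro definable_sum definable_mult definable_of_bool pdefinable_eq definable_var
        definable_Suc definable_rename[OF assms(1)] assms)
qed

lemma pdefinable_let:
  assumes "definable F" "pdefinable (\<lambda>s v. P s (\<lambda>i. v (Suc i)) (v 0))"
  shows "pdefinable (\<lambda>s v. P s v (F s v))"
  using definable_let[of F "\<lambda>s v n. of_bool (P s v n)"] assms unfolding pdefinable_def .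

lemmas def_intros = pdefinable_not pdefinable_conj pdefinable_disj pdefinable_imp pdefinable_dvd
  pdefinable_le pdefinable_less pdefinable_eq pdefinable_ex pdefinable_all pdefinable_symbol_eq
  pdefinable_if pdefinable_const
  definable_var definable_const definable_Suc definable_add definable_sub definable_mult
  definable_div definable_mod definable_sum definable_of_bool definable_length definable_if

section \<open>Binary numerals\<close>

lemma binary_0 [simp]: "binary 0 = []"
  by (simp add: binary.simps)

lemma length_binary: "m < 2 ^ length (binary m) \<and> (m \<noteq> 0 \<longrightarrow> 2 ^ (length (binary m) - 1) \<le> m)"
proof (induction m rule: less_induct)
  case (less m)
  show ?case
  proof (cases "m = 0")
    case False
    then have *: "length (binary m) = Suc (length (binary (m div 2)))" by (simp add: binary.simps[of m])
    have IH: "m div 2 < 2 ^ length (binary (m div 2))"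
      "m div 2 \<noteq> 0 \<longrightarrow> 2 ^ (length (binary (m div 2)) - 1) \<le> m div 2"
      using less.IH[of "m div 2"] False by auto
    have "2 ^ length (binary (m div 2)) \<le> m"
    proof (cases "m div 2 = 0")
      case True
      then show ?thesis using False by (simp add: binary.simps)
    next
      case False
      then have "binary (m div 2) \<noteq> []" by (subst binary.simps) simp
      then have "(2 :: nat) ^ length (binary (m div 2)) = 2 * 2 ^ (length (binary (m div 2)) - 1)"
        by (cases "length (binary (m div 2))") auto
      then show ?thesis using IH(2) False by linarith
    qed
    then show ?thesis using IH(1) * by auto
  qed (simp add: binary.simps)
qed

lemma power_le_iff_length_binary: "2 ^ i \<le> m \<longleftrightarrow> i < length (binary m)"
proof
  assume "2 ^ i \<le> m"
  then have "(2 :: nat) ^ i < 2 ^ length (binary m)" using length_binary[of m] by linarith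
  then show "i < length (binary m)" by simp
next
  assume i: "i < length (binary m)"
  then have "m \<noteq> 0" by (intro notI) simp
  moreover have "(2 :: nat) ^ i \<le> 2 ^ (length (binary m) - 1)" using i by (intro power_increasing) auto
  ultimately show "2 ^ i \<le> m" using length_binary[of m] by linarith
qed

lemma nth_binary: "i < length (binary m) \<Longrightarrow> binary m ! i = odd (m div 2 ^ i)"
proof (induction i arbitrary: m)
  case 0
  then show ?case by (cases "m = 0") (simp_all add: binary.simps[of m])
next
  case (Suc i)
  then have "m \<noteq> 0" by (intro notI) simp
  then have "binary m = odd m # binary (m div 2)" by (simp add: binary.simps[of m])
  then show ?case using Suc by (simp add: div_mult2_eq)
qed

text \<open>The powers of two, recognised by having no odd divisor except 1. This uses quantifiers
  bounded by the number itself instead of an exponential.\<close>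

definition pow2 :: "nat \<Rightarrow> bool" where
  "pow2 m \<longleftrightarrow> 0 < m \<and> (\<forall>d<Suc m. d dvd m \<longrightarrow> d = 1 \<or> 2 dvd d)"

lemma power2_odd_factor: "0 < m \<Longrightarrow> \<exists>i b. m = 2 ^ i * b \<and> odd (b :: nat)"
proof (induction m rule: less_induct)
  case (less m)
  show ?case
  proof (cases "odd m")
    case True
    then show ?thesis by (intro exI[of _ 0] exI[of _ m]) simp
  next
    case False
    then obtain n where n: "m = 2 * n" by blast
    then obtain i b where "n = 2 ^ i * b" "odd b" using less.IH[of n] less.prems by auto
    then show ?thesis using n by (intro exI[of _ "Suc i"] exI[of _ b]) simp
  qed
qed

lemma pow2_iff: "pow2 m \<longleftrightarrow> (\<exists>i. m = 2 ^ i)"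
proof
  assume m: "pow2 m"
  then obtain i b where b: "m = 2 ^ i * b" "odd b"
    using power2_odd_factor[of m] by (auto simp: pow2_def)
  then have "b dvd m" "b < Suc m" using m by (auto simp: pow2_def less_Suc_eq_le)
  then have "b = 1" using m b(2) unfolding pow2_def by blast
  then show "\<exists>i. m = 2 ^ i" using b by auto
next
  assume "\<exists>i. m = 2 ^ i"
  then show "pow2 m" by (auto simp: pow2_def divides_primepow_nat)
qed

lemma length_binary_power: "length (binary (2 ^ i)) = Suc i"
  using power_le_iff_length_binary[of i "2 ^ i"] power_le_iff_length_binary[of "Suc i" "2 ^ i"] by auto

text \<open>The length of a numeral is the number of powers of two up to \<open>m\<close>, which
  turns it into a bounded sum.\<close>

lemma length_binary_sum: "length (binary m) = (\<Sum>j<Suc m. of_bool (pow2 j))"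
proof -
  have "{..<Suc m} \<inter> {j. pow2 j} = (\<lambda>i. 2 ^ i) ` {..<length (binary m)}"
    by (auto simp: pow2_iff less_Suc_eq_le power_le_iff_length_binary)
  moreover have "inj_on (\<lambda>i. 2 ^ i :: nat) {..<length (binary m)}" by (auto simp: inj_on_def)
  ultimately have "card ({..<Suc m} \<inter> {j. pow2 j}) = length (binary m)" by (simp add: card_image)
  then show ?thesis by (simp add: sum_of_bool_eq del: sum.lessThan_Suc)
qed

lemma pdefinable_pow2: "definable F \<Longrightarrow> pdefinable (\<lambda>s v. pow2 (F s v))"
  by (rule pdefinable_let, assumption) (unfold pow2_def, intro def_intros)

lemma definable_length_binary: "definable F \<Longrightarrow> definable (\<lambda>s v. length (binary (F s v)))"
  by (rule definable_let, assumption)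
    (unfold length_binary_sum, intro definable_sum definable_of_bool pdefinable_pow2 def_intros)

text \<open>The power \<open>2 ^ i\<close> is replaced by a bounded \<open>j\<close> characterised
  as a power of two with a numeral of length \<open>Suc i\<close>. If \<open>2 ^ i\<close> exceeds
  \<open>m\<close>, there is no such \<open>j\<close>, in agreement with the quotient being
  0.\<close>

lemma odd_div_power_iff:
  "odd (m div 2 ^ i) \<longleftrightarrow> (\<exists>j<Suc m. pow2 j \<and> length (binary j) = Suc i \<and> \<not> 2 dvd m div j)"
proof
  assume o: "odd (m div 2 ^ i)"
  then have "2 ^ i \<le> m" by (metis dvd_0_right div_less linorder_not_le)
  then show "\<exists>j<Suc m. pow2 j \<and> length (binary j) = Suc i \<and> \<not> 2 dvd m div j"
    using o by (intro exI[of _ "2 ^ i"]) (auto simp: pow2_iff length_binary_power)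
qed (auto simp: pow2_iff length_binary_power)

lemma pdefinable_bit:
  assumes "definable F" "definable G"
  shows "pdefinable (\<lambda>s v. odd (F s v div 2 ^ G s v))"
proof -
  have "pdefinable (\<lambda>s v. odd (v 0 div 2 ^ v (Suc 0)))"
    unfolding odd_div_power_iff
    by (intro def_intros pdefinable_pow2 definable_length_binary)
  then have "pdefinable (\<lambda>s v. odd (F s (\<lambda>i. v (Suc i)) div 2 ^ v 0))"
    using pdefinable_let[OF definable_rename[OF assms(1)], of "\<lambda>s v n. odd (n div 2 ^ v 0)" Suc]
    by blast
  then show ?thesis by (rule pdefinable_let[OF assms(2)])
qed

section \<open>From definable predicates and functions to machines\<close>

theorem decide_definable:
  assumes "pdefinable P"
  obtains M p where "wf_tm M" "\<And>s. 0 \<notin> set s \<Longrightarrow> halted M (run M s (poly p (length s)))"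
    "\<And>s. 0 \<notin> set s \<Longrightarrow> fst (run M s (poly p (length s))) = accept M \<longleftrightarrow> P s (\<lambda>_. 0)"
proof -
  obtain e where e: "\<And>s v. eval s e v = of_bool (P s v)"
    using assms unfolding pdefinable_def definable_def by blast
  obtain M p where M: "wf_tm M" "\<And>s. 0 \<notin> set s \<Longrightarrow> halted M (run M s (poly p (length s)))"
    "\<And>s. 0 \<notin> set s \<Longrightarrow> fst (run M s (poly p (length s))) = accept M \<longleftrightarrow> eval s e (\<lambda>_. 0) \<noteq> 0"
    using decide_exp[of e] by metis
  show thesis by (rule that[OF M(1,2)]) (simp_all add: M(3) e)
qed

theorem polytime_definable:
  assumes "definable L" "pdefinable B"
  shows "polytime_computable (\<lambda>x. map (\<lambda>i. B (syms x) (case_nat i (\<lambda>_. 0))) [0..<L (syms x) (\<lambda>_. 0)])"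
proof -
  obtain l b where e: "\<And>s v. eval s l v = L s v" "\<And>s v. eval s b v = of_bool (B s v)"
    using assms unfolding pdefinable_def definable_def by blast
  show ?thesis using polytime_exp[of b l] unfolding e by (simp only: of_bool_eq_0_iff not_not)
qed

section \<open>GP4-graphs in canonical form\<close>

definition edges :: "nat \<Rightarrow> (nat \<Rightarrow> nat \<Rightarrow> bool) \<Rightarrow> nat set set" where
  "edges n R = {{i, j} | i j. i < n \<and> j < n \<and> R i j}"

lemma edgesI: "i < n \<Longrightarrow> j < n \<Longrightarrow> R i j \<Longrightarrow> {i, j} \<in> edges n R"
  by (auto simp: edges_def)

lemma edges_iff: "symp R \<Longrightarrow> {i, j} \<in> edges n R \<longleftrightarrow> i < n \<and> j < n \<and> R i j"
  unfolding edges_def by (auto simp: doubleton_eq_iff dest: sympD)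

lemma simple_graph_edges: "irreflp R \<Longrightarrow> simple_graph {..<n} (edges n R)"
  unfolding simple_graph_def edges_def by (auto simp: irreflp_def card_insert_if)

text \<open>Blocks of five consecutive numbers are the pendant paths; comparing quotients rules out
  an edge from the end of one block to the start of the next.\<close>

definition chain :: "nat \<Rightarrow> nat \<Rightarrow> bool" where
  "chain i j \<longleftrightarrow> i div 5 = j div 5 \<and> (j = Suc i \<or> i = Suc j)"

text \<open>
  The vertices \<open>v\<^sub>i, w\<^sub>i, x\<^sub>i, y\<^sub>i, z\<^sub>i\<close> are numbered \<open>5 i, \<dots>, 5 i + 4\<close>.
\<close>

definition gp4_adj :: "(nat \<Rightarrow> nat \<Rightarrow> bool) \<Rightarrow> nat \<Rightarrow> nat \<Rightarrow> bool" where
  "gp4_adj H i j \<longleftrightarrow> chain i j \<or> 5 dvd i \<and> 5 dvd j \<and> H (i div 5) (j div 5)"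

lemma symp_gp4_adj: "symp H \<Longrightarrow> symp (gp4_adj H)"
  by (auto simp: symp_def gp4_adj_def chain_def)

lemma irreflp_gp4_adj: "irreflp H \<Longrightarrow> irreflp (gp4_adj H)"
  by (auto simp: irreflp_def gp4_adj_def chain_def)

lemma five_decomp: "k < 5 \<Longrightarrow> b = 5 * u + k \<longleftrightarrow> b mod 5 = k \<and> b div 5 = (u :: nat)"
  by auto

lemma five_mod:
  "(5 * u) mod 5 = (0 :: nat)" "(5 * u + 1) mod 5 = (1 :: nat)" "(5 * u + 2) mod 5 = (2 :: nat)"
  "(5 * u + 3) mod 5 = (3 :: nat)" "(5 * u + 4) mod 5 = (4 :: nat)"
  "(5 * u) div 5 = (u :: nat)" "(5 * u + 1) div 5 = (u :: nat)" "(5 * u + 2) div 5 = (u :: nat)"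
  "(5 * u + 3) div 5 = (u :: nat)" "(5 * u + 4) div 5 = (u :: nat)"
  using five_decomp[of 1 "5 * u + 1" u] five_decomp[of 2 "5 * u + 2" u]
    five_decomp[of 3 "5 * u + 3" u] five_decomp[of 4 "5 * u + 4" u] by simp_all

lemma five_eq:
  "b = 5 * u \<longleftrightarrow> b mod 5 = 0 \<and> b div 5 = (u :: nat)"
  "b = 5 * u + 1 \<longleftrightarrow> b mod 5 = 1 \<and> b div 5 = (u :: nat)"
  "b = 5 * u + 2 \<longleftrightarrow> b mod 5 = 2 \<and> b div 5 = (u :: nat)"
  "b = 5 * u + 3 \<longleftrightarrow> b mod 5 = 3 \<and> b div 5 = (u :: nat)"
  "b = 5 * u + 4 \<longleftrightarrow> b mod 5 = 4 \<and> b div 5 = (u :: nat)"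
  using five_decomp[of 0 b u] five_decomp[of 1 b u] five_decomp[of 2 b u] five_decomp[of 3 b u]
    five_decomp[of 4 b u] by simp_all

lemma mod5_cases:
  obtains i where "x = 5 * i" | i where "x = 5 * i + 1" | i where "x = 5 * i + 2"
    | i where "x = 5 * i + 3" | i where "x = 5 * i + (4 :: nat)"
proof -
  have "x mod 5 < 5" by simp
  then consider "x mod 5 = 0" | "x mod 5 = 1" | "x mod 5 = 2" | "x mod 5 = 3" | "x mod 5 = 4" by linarith
  then show thesis using mult_div_mod_eq[of 5 x] by cases (metis that add_0_right)+
qed

lemma chain_iff:
  "chain (5 * i) u \<longleftrightarrow> u = 5 * i + 1"
  "chain (5 * i + 1) u \<longleftrightarrow> u = 5 * i \<or> u = 5 * i + 2"
  "chain (5 * i + 2) u \<longleftrightarrow> u = 5 * i + 1 \<or> u = 5 * i + 3"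
  "chain (5 * i + 3) u \<longleftrightarrow> u = 5 * i + 2 \<or> u = 5 * i + 4"
  "chain (5 * i + 4) u \<longleftrightarrow> u = 5 * i + 3"
proof -
  have *: "chain a u \<longleftrightarrow> u div 5 = a div 5 \<and> (u = a + 1 \<or> a = u + 1)" for a
    by (auto simp: chain_def)
  have "5 * i + 5 = 5 * Suc i" by simp
  then show
    "chain (5 * i) u \<longleftrightarrow> u = 5 * i + 1"
    "chain (5 * i + 1) u \<longleftrightarrow> u = 5 * i \<or> u = 5 * i + 2"
    "chain (5 * i + 2) u \<longleftrightarrow> u = 5 * i + 1 \<or> u = 5 * i + 3"
    "chain (5 * i + 3) u \<longleftrightarrow> u = 5 * i + 2 \<or> u = 5 * i + 4"
    "chain (5 * i + 4) u \<longleftrightarrow> u = 5 * i + 3"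
    unfolding * five_mod
    by (cases u rule: mod5_cases; simp only: five_mod; linarith?)+
qed

lemma gp4_adj_iff:
  "gp4_adj H (5 * i) u \<longleftrightarrow> u = 5 * i + 1 \<or> (\<exists>j. u = 5 * j \<and> H i j)"
  "gp4_adj H (5 * i + 1) u \<longleftrightarrow> u = 5 * i \<or> u = 5 * i + 2"
  "gp4_adj H (5 * i + 2) u \<longleftrightarrow> u = 5 * i + 1 \<or> u = 5 * i + 3"
  "gp4_adj H (5 * i + 3) u \<longleftrightarrow> u = 5 * i + 2 \<or> u = 5 * i + 4"
  "gp4_adj H (5 * i + 4) u \<longleftrightarrow> u = 5 * i + 3"
proof -
  have nd: "\<not> 5 dvd 5 * i + 1" "\<not> 5 dvd 5 * i + 2" "\<not> 5 dvd 5 * i + 3" "\<not> 5 dvd 5 * i + 4"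
    unfolding dvd_eq_mod_eq_0 five_mod by simp_all
  show "gp4_adj H (5 * i) u \<longleftrightarrow> u = 5 * i + 1 \<or> (\<exists>j. u = 5 * j \<and> H i j)"
    unfolding gp4_adj_def chain_iff by auto
  show
    "gp4_adj H (5 * i + 1) u \<longleftrightarrow> u = 5 * i \<or> u = 5 * i + 2"
    "gp4_adj H (5 * i + 2) u \<longleftrightarrow> u = 5 * i + 1 \<or> u = 5 * i + 3"
    "gp4_adj H (5 * i + 3) u \<longleftrightarrow> u = 5 * i + 2 \<or> u = 5 * i + 4"
    "gp4_adj H (5 * i + 4) u \<longleftrightarrow> u = 5 * i + 3"
    unfolding gp4_adj_def chain_iff using nd by blast+
qed

section \<open>Graphs in canonical form, up to renaming, are GP4-graphs\<close>

lemma connected_graph_image: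
  assumes "inj_on f V" "connected_graph V E"
  shows "connected_graph (f ` V) ((`) f ` E)"
  unfolding connected_graph_def
proof (intro conjI ballI)
  show "simple_graph (f ` V) ((`) f ` E)"
    unfolding simple_graph_def
  proof (intro conjI ballI)
    fix e assume "e \<in> (`) f ` E"
    then obtain e' where e': "e = f ` e'" "e' \<subseteq> V" "card e' = 2"
      using assms(2) by (auto simp: connected_graph_def simple_graph_def)
    then show "e \<subseteq> f ` V" "card e = 2"
      using card_image[OF inj_on_subset[OF assms(1)]] by auto
  qed (use assms(2) in \<open>simp add: connected_graph_def simple_graph_def\<close>)
  show "f ` V \<noteq> {}" using assms by (auto simp: connected_graph_def)
  fix u v assume "u \<in> f ` V" "v \<in> f ` V"
  then obtain a b where ab: "u = f a" "v = f b" "a \<in> V" "b \<in> V" by blast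
  then have "(a, b) \<in> {(a, b). {a, b} \<in> E}\<^sup>*" using assms by (auto simp: connected_graph_def)
  then have "(f a, f b) \<in> {(a, b). {a, b} \<in> (`) f ` E}\<^sup>*"
  proof (induction rule: rtrancl_induct)
    case (step y z)
    then have "{f y, f z} \<in> (`) f ` E" by (intro image_eqI[of _ _ "{y, z}"]) auto
    then show ?case using step.IH by (auto intro: rtrancl_into_rtrancl)
  qed simp
  then show "(u, v) \<in> {(a, b). {a, b} \<in> (`) f ` E}\<^sup>*" using ab by simp
qed

text \<open>The bijection is arbitrary because the lemma serves twice: with the identity for the
  graphs produced by the reduction, and with the numbering found in a certificate.\<close>

lemma gp4_graphI:
  assumes sym: "symp H" and con: "connected_graph {..<h} (edges h H)"
    and bij: "bij_betw \<sigma> {..<5 * h} V"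
  shows "gp4_graph V ((`) \<sigma> ` edges (5 * h) (gp4_adj H))"
proof -
  define a where "a k i = \<sigma> (5 * i + k)" for k i
  have inj: "inj_on \<sigma> {..<5 * h}" using bij by (simp add: bij_betw_def)
  have a_eq: "a k i = a l j \<longleftrightarrow> k = l \<and> i = j" if "i < h" "j < h" "k < 5" "l < 5" for i j k l
  proof
    assume "a k i = a l j"
    then have "5 * i + k = 5 * j + l" using inj_onD[OF inj] that by (simp add: a_def)
    then show "k = l \<and> i = j" using that by presburger
  qed simp
  \<comment> \<open>In the definition of GP4-graphs the maps to the new vertices act on vertices of
    \<open>H\<close>; \<open>ix\<close> recovers the index of such a vertex.\<close>
  define ix where "ix = inv_into {..<h} (a 0)"
  have inj0: "inj_on (a 0) {..<h}" using a_eq by (auto simp: inj_on_def)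
  have ix: "ix (a 0 i) = i" if "i < h" for i using inj0 that by (simp add: ix_def)
  let ?VH = "a 0 ` {..<h}" let ?f = "\<lambda>k v. a k (ix v)"
  have img: "?f k ` ?VH = a k ` {..<h}" for k using ix by force
  have inj_f: "inj_on (?f k) ?VH" if "k < 5" for k using ix a_eq that by (auto simp: inj_on_def)
  have dis: "disjnt (a k ` {..<h}) (a l ` {..<h})" if "k < 5" "l < 5" "k \<noteq> l" for k l
    using a_eq that by (auto simp: disjnt_def)
  have V: "V = ?VH \<union> a 1 ` {..<h} \<union> a 2 ` {..<h} \<union> a 3 ` {..<h} \<union> a 4 ` {..<h}"
  proof -
    have "{..<5 * h} = (\<lambda>i. 5 * i) ` {..<h} \<union> (\<lambda>i. 5 * i + 1) ` {..<h} \<union> (\<lambda>i. 5 * i + 2) ` {..<h}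
        \<union> (\<lambda>i. 5 * i + 3) ` {..<h} \<union> (\<lambda>i. 5 * i + 4) ` {..<h}" (is "_ = ?U")
    proof (intro set_eqI iffI)
      fix x assume "x \<in> {..<5 * h}"
      then show "x \<in> ?U" by (cases x rule: mod5_cases) auto
    qed auto
    then have "V = \<sigma> ` ?U" using bij by (simp add: bij_betw_def)
    then show ?thesis by (simp add: image_Un image_image a_def)
  qed
  have mem: "\<sigma> ` {i, j} \<in> (`) \<sigma> ` edges (5 * h) (gp4_adj H)" if "i < 5 * h" "j < 5 * h" "gp4_adj H i j" for i j
    using that by (intro imageI) (auto simp: edges_def)
  have E: "(`) \<sigma> ` edges (5 * h) (gp4_adj H) = (`) (a 0) ` edges h H \<union>
     (\<Union>v\<in>?VH. {{v, ?f 1 v}, {?f 1 v, ?f 2 v}, {?f 2 v, ?f 3 v}, {?f 3 v, ?f 4 v}})" (is "?L = ?R")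
  proof (rule subset_antisym; rule subsetI)
    fix e assume "e \<in> ?L"
    then obtain i j where ij: "e = \<sigma> ` {i, j}" "i < 5 * h" "j < 5 * h" "gp4_adj H i j"
      by (auto simp: edges_def)
    have ch: "e \<in> ?R" if "e = {a k q, a (Suc k) q}" "k < 4" "q < h" for k q
    proof -
      have "k = 0 \<or> k = 1 \<or> k = 2 \<or> k = 3" using that by linarith
      then show ?thesis using that ix by (intro UnI2 UN_I[of "a 0 q"]) (auto simp: numeral_eq_Suc)
    qed
    from ij(4) consider "i div 5 = j div 5" "j = Suc i" | "i div 5 = j div 5" "i = Suc j"
      | "5 dvd i" "5 dvd j" "H (i div 5) (j div 5)" unfolding gp4_adj_def chain_def by blast
    then show "e \<in> ?R"
    proof cases
      case 1
      then have "i mod 5 < 4" by presburger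
      moreover have "e = {a (i mod 5) (i div 5), a (Suc (i mod 5)) (i div 5)}"
        using ij(1) 1(2) by (simp add: a_def)
      ultimately show ?thesis using ij by (intro ch[of "i mod 5" "i div 5"]) auto
    next
      case 2
      then have "j mod 5 < 4" by presburger
      moreover have "e = {a (j mod 5) (j div 5), a (Suc (j mod 5)) (j div 5)}"
        using ij(1) 2(2) by (simp add: a_def insert_commute)
      ultimately show ?thesis using ij by (intro ch[of "j mod 5" "j div 5"]) auto
    next
      case 3
      then have "e = a 0 ` {i div 5, j div 5}" using ij by (simp add: a_def)
      moreover have "{i div 5, j div 5} \<in> edges h H" using 3 ij by (intro edgesI) auto
      ultimately show ?thesis by blast
    qed
  next
    fix e assume "e \<in> ?R"
    then consider i j where "e = a 0 ` {i, j}" "i < h" "j < h" "H i j"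
      | i where "i < h" "e \<in> {{a 0 i, a 1 i}, {a 1 i, a 2 i}, {a 2 i, a 3 i}, {a 3 i, a 4 i}}"
      using ix by (auto simp: edges_def)
    then show "e \<in> ?L"
    proof cases
      case (1 i j)
      then show ?thesis using mem[of "5 * i" "5 * j"] by (simp add: a_def gp4_adj_iff)
    next
      case (2 i)
      then show ?thesis
        using mem[of "5 * i" "5 * i + 1"] mem[of "5 * i + 1" "5 * i + 2"] mem[of "5 * i + 2" "5 * i + 3"]
          mem[of "5 * i + 3" "5 * i + 4"] unfolding gp4_adj_iff by (auto simp: a_def)
    qed
  qed
  show ?thesis
    unfolding gp4_graph_def
    by (rule exI[of _ ?VH], rule exI[of _ "(`) (a 0) ` edges h H"], rule exI[of _ "?f 1"],
        rule exI[of _ "?f 2"], rule exI[of _ "?f 3"], rule exI[of _ "?f 4"])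
      (use connected_graph_image[OF inj0 con] in
        \<open>simp only: img inj_f dis V[symmetric] E[symmetric]; simp add: inj_f dis\<close>)
qed

lemma gp4_graph_edges:
  assumes "symp H" "connected_graph {..<h} (edges h H)"
  shows "gp4_graph {..<5 * h} (edges (5 * h) (gp4_adj H))"
  using gp4_graphI[OF assms, of "\<lambda>i. i"] by (simp add: bij_betw_def)

text \<open>The matching edges at the \<open>y\<close> vertices are \<open>h\<close> distinct edges,
  each inside the part \<open>{x, y, z}\<close> of its own path, so at most \<open>s\<close>
  matching edges remain. \<open>\<phi>\<close> projects these to \<open>H\<close>: an edge between
  two \<open>v\<close> vertices becomes a pair, an edge through some \<open>w\<close> a single
  vertex. A \<open>v\<close> outside \<open>D\<close> that is dominated by its own \<open>w\<close>
  is then covered by that single vertex.\<close>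

lemma paired_dominating_set_pairs:
  assumes sym: "symp H" and irr: "irreflp H"
    and pds: "paired_dominating_set {..<5 * h} (edges (5 * h) (gp4_adj H)) D"
    and card: "card D \<le> 2 * h + 2 * s"
  obtains P where "finite P" "card P \<le> s" "\<And>e. e \<in> P \<Longrightarrow> \<exists>i j. e \<subseteq> {i, j} \<and> (i = j \<or> H i j)"
    "\<And>i. i < h \<Longrightarrow> \<exists>j\<in>\<Union>P. j = i \<or> H i j"
proof -
  let ?G = "gp4_adj H" let ?E = "edges (5 * h) ?G"
  have E: "{i, j} \<in> ?E \<longleftrightarrow> i < 5 * h \<and> j < 5 * h \<and> ?G i j" for i j
    by (rule edges_iff[OF symp_gp4_adj[OF sym]])
  from pds obtain M where D: "D \<subseteq> {..<5 * h}" and dom: "\<And>v. v < 5 * h \<Longrightarrow> v \<notin> D \<Longrightarrow> \<exists>u\<in>D. {u, v} \<in> ?E"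
    and M: "M \<subseteq> induced_edges ?E D" and uniq: "\<And>v. v \<in> D \<Longrightarrow> \<exists>!e. e \<in> M \<and> v \<in> e"
    unfolding paired_dominating_set_def perfect_matching_def by auto
  have MD: "e \<subseteq> D" "e \<in> ?E" if "e \<in> M" for e
    using M that by (auto simp: induced_edges_def)
  have M_edge: "\<exists>b. e = {v, b} \<and> ?G v b" if e: "e \<in> M" "v \<in> e" for e v
  proof -
    obtain i j where "e = {i, j}" "?G i j" using MD(2)[OF e(1)] by (auto simp: edges_def)
    moreover from this(2) have "?G j i" by (rule sympD[OF symp_gp4_adj[OF sym]])
    ultimately show ?thesis using e(2) by (auto simp: insert_commute)
  qed
  have dj: "pairwise disjnt M"
    unfolding pairwise_def disjnt_def using uniq MD(1) by blast
  have finD: "finite D" using D finite_subset by blast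
  then have finM: "finite M" using MD(1) by (meson finite_Pow_iff finite_subset PowI subsetI)
  have c2: "card e = 2" if "e \<in> M" for e
    using MD(2)[OF that] simple_graph_edges[OF irreflp_gp4_adj[OF irr], of "5 * h"]
    by (auto simp: simple_graph_def)
  have UM: "\<Union>M = D" using MD(1) uniq by blast
  have "card (\<Union>M) = (\<Sum>e\<in>M. card e)"
    by (rule card_Union_disjoint[OF dj]) (use MD(1) finD finite_subset in blast)
  then have cM: "card D = 2 * card M" using UM c2 by simp
  have y: "5 * i + 3 \<in> D" if i: "i < h" for i
  proof (cases "5 * i + 4 \<in> D")
    case True
    then obtain e where "e \<in> M" "5 * i + 4 \<in> e" using uniq by blast
    then obtain b where "e = {5 * i + 4, b}" "?G (5 * i + 4) b" using M_edge by blast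
    then show ?thesis using MD(1)[OF \<open>e \<in> M\<close>] by (auto simp: gp4_adj_iff)
  next
    case False
    then obtain u where "u \<in> D" "{5 * i + 4, u} \<in> ?E"
      using dom[of "5 * i + 4"] i by (auto simp: insert_commute)
    then show ?thesis unfolding E gp4_adj_iff by auto
  qed
  define m where "m i = (THE e. e \<in> M \<and> 5 * i + 3 \<in> e)" for i
  have m: "m i \<in> M" "5 * i + 3 \<in> m i" if "i < h" for i
    using theI'[OF uniq[OF y[OF that]]] unfolding m_def by auto
  have m_sub: "m i \<subseteq> {5 * i + 2, 5 * i + 3, 5 * i + 4}" if "i < h" for i
    using M_edge[OF m[OF that]] unfolding gp4_adj_iff by auto
  have inj: "inj_on m {..<h}"
  proof (rule inj_onI)
    fix i j assume "i \<in> {..<h}" "j \<in> {..<h}" "m i = m j"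
    then have "5 * i + 3 \<in> {5 * j + 2, 5 * j + 3, 5 * j + 4}" using m(2) m_sub by blast
    then show "i = j" by auto
  qed
  define M' where "M' = M - m ` {..<h}"
  define \<phi> where "\<phi> e = {i. 5 * i \<in> e \<or> 5 * i + 1 \<in> e}" for e :: "nat set"
  have "card M' = card M - h"
    unfolding M'_def using m(1) by (subst card_Diff_subset) (auto simp: card_image[OF inj])
  then have cM': "card M' \<le> s" using cM card by simp
  have in_M': "e \<in> M'" if "e \<in> M" "5 * i \<in> e \<or> 5 * i + 1 \<in> e" for e i
  proof -
    have "e \<noteq> m j" if "j < h" for j
    proof
      assume "e = m j"
      then have "5 * i \<in> {5 * j + 2, 5 * j + 3, 5 * j + 4} \<or> 5 * i + 1 \<in> {5 * j + 2, 5 * j + 3, 5 * j + 4}"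
        using m_sub[OF \<open>j < h\<close>] \<open>5 * i \<in> e \<or> 5 * i + 1 \<in> e\<close> by blast
      then show False by auto presburger+
    qed
    then show ?thesis using that(1) by (auto simp: M'_def)
  qed
  have cover: "i \<in> \<Union>(\<phi> ` M')" if i: "5 * i \<in> D \<or> 5 * i + 1 \<in> D" for i
  proof -
    obtain e where "e \<in> M" "5 * i \<in> e \<or> 5 * i + 1 \<in> e" using i uniq by blast
    then show ?thesis using in_M' by (auto simp: \<phi>_def)
  qed
  show thesis
  proof (rule that[of "\<phi> ` M'"])
    show "finite (\<phi> ` M')" using finM by (simp add: M'_def)
    show "card (\<phi> ` M') \<le> s" using card_image_le[of M' \<phi>] cM' finM by (simp add: M'_def)
  next
    fix f assume "f \<in> \<phi> ` M'"
    then obtain e where e: "f = \<phi> e" "e \<in> M" by (auto simp: M'_def)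
    then obtain x z where xz: "e = {x, z}" "?G x z" using MD(2)[OF e(2)] by (auto simp: edges_def)
    show "\<exists>i j. f \<subseteq> {i, j} \<and> (i = j \<or> H i j)"
    proof (cases "chain x z")
      case True
      have "f \<subseteq> {x div 5, x div 5}"
      proof
        fix i assume "i \<in> f"
        then have "5 * i = x \<or> 5 * i = z \<or> 5 * i + 1 = x \<or> 5 * i + 1 = z"
          using e xz by (auto simp: \<phi>_def)
        then show "i \<in> {x div 5, x div 5}" using True unfolding chain_def by auto
      qed
      then show ?thesis by blast
    next
      case False
      then have *: "5 dvd x" "5 dvd z" "H (x div 5) (z div 5)" using xz by (auto simp: gp4_adj_def)
      have "f \<subseteq> {x div 5, z div 5}"
      proof
        fix i assume "i \<in> f"
        then have "5 * i = x \<or> 5 * i = z \<or> 5 * i + 1 = x \<or> 5 * i + 1 = z"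
          using e xz by (auto simp: \<phi>_def)
        then show "i \<in> {x div 5, z div 5}" using * by auto
      qed
      then show ?thesis using * by blast
    qed
  next
    fix i assume i: "i < h"
    show "\<exists>j\<in>\<Union>(\<phi> ` M'). j = i \<or> H i j"
    proof (cases "5 * i \<in> D")
      case False
      then obtain u where u: "u \<in> D" "{5 * i, u} \<in> ?E"
        using dom[of "5 * i"] i by (auto simp: insert_commute)
      then consider "u = 5 * i + 1" | j where "u = 5 * j" "H i j" unfolding E gp4_adj_iff by auto
      then show ?thesis using u(1) cover by cases blast+
    qed (use cover in blast)
  qed
qed


section \<open>Satisfiability as paired domination\<close>

text \<open>
  Instances have \<open>N\<close> variables and \<open>N\<close> clauses; \<open>pos j u\<close> says that variable \<open>u\<close> occurs
  positively in clause \<open>j\<close>.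
\<close>

definition satisfiable :: "nat \<Rightarrow> (nat \<Rightarrow> nat \<Rightarrow> bool) \<Rightarrow> (nat \<Rightarrow> nat \<Rightarrow> bool) \<Rightarrow> bool" where
  "satisfiable N pos neg \<longleftrightarrow>
     (\<exists>\<alpha>. \<forall>j<N. \<exists>u<N. pos j u \<and> \<alpha> u \<or> neg j u \<and> \<not> \<alpha> u)"

text \<open>
  For each \<open>u < N\<close> the graph has five vertices: a center \<open>5 u\<close> with neighbours \<open>5 u + 1\<close> (a leaf,
  forcing one pair per variable), \<open>5 u + 2\<close> and \<open>5 u + 3\<close> (the positive and the negative
  literal), and the clause vertex \<open>5 u + 4\<close>. The cliques on the positive literals and on the
  clauses only serve to make the graph connected.
\<close>

definition sat_dir :: "(nat \<Rightarrow> nat \<Rightarrow> bool) \<Rightarrow> (nat \<Rightarrow> nat \<Rightarrow> bool) \<Rightarrow> nat \<Rightarrow> nat \<Rightarrow> bool" where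
  "sat_dir pos neg a b \<longleftrightarrow>
     a mod 5 = 0 \<and> (b mod 5 = 1 \<or> b mod 5 = 2 \<or> b mod 5 = 3) \<and> a div 5 = b div 5
   \<or> a mod 5 = b mod 5 \<and> (a mod 5 = 2 \<or> a mod 5 = 4) \<and> a \<noteq> b
   \<or> a mod 5 = 2 \<and> b mod 5 = 4 \<and> pos (b div 5) (a div 5)
   \<or> a mod 5 = 3 \<and> b mod 5 = 4 \<and> neg (b div 5) (a div 5)"

definition sat_adj :: "(nat \<Rightarrow> nat \<Rightarrow> bool) \<Rightarrow> (nat \<Rightarrow> nat \<Rightarrow> bool) \<Rightarrow> nat \<Rightarrow> nat \<Rightarrow> bool" where
  "sat_adj pos neg a b \<longleftrightarrow> sat_dir pos neg a b \<or> sat_dir pos neg b a"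

section \<open>Neighbourhoods and connectedness of the graph of a formula\<close>

lemma symp_sat_adj: "symp (sat_adj pos neg)"
  by (auto simp: symp_def sat_adj_def)

lemma irreflp_sat_adj: "irreflp (sat_adj pos neg)"
  by (auto simp: irreflp_def sat_adj_def sat_dir_def)

lemma sat_adj_center:
  "sat_adj pos neg (5 * u) b \<longleftrightarrow> b = 5 * u + 1 \<or> b = 5 * u + 2 \<or> b = 5 * u + 3"
  unfolding sat_adj_def sat_dir_def five_mod five_eq by auto

lemma sat_adj_leaf: "sat_adj pos neg (5 * u + 1) b \<longleftrightarrow> b = 5 * u"
  unfolding sat_adj_def sat_dir_def five_mod five_eq by auto

lemma sat_adj_clause:
  assumes "sat_adj pos neg (5 * j + 4) b" "b mod 5 \<noteq> 4"
  obtains u where "b = 5 * u + 2" "pos j u" | u where "b = 5 * u + 3" "neg j u"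
proof -
  have "b mod 5 = 2 \<and> pos j (b div 5) \<or> b mod 5 = 3 \<and> neg j (b div 5)"
    using assms unfolding sat_adj_def sat_dir_def five_mod by auto
  moreover have "b = 5 * (b div 5) + b mod 5" by simp
  ultimately show thesis using that by metis
qed

text \<open>The root is vertex 2, the positive literal of variable 0. The positive literals form a
  clique from which the centers, leaves and negative literals are reached; the clause clique is
  attached through the one literal occurrence that the assumption provides.\<close>

lemma connected_graph_sat:
  assumes "\<exists>j<N. \<exists>u<N. pos j u \<or> neg j u"
  shows "connected_graph {..<5 * N} (edges (5 * N) (sat_adj pos neg))"
proof -
  let ?A = "sat_adj pos neg"
  let ?R = "{(a, b). {a, b} \<in> edges (5 * N) ?A}"
  obtain j u where ju: "j < N" "u < N" "pos j u \<or> neg j u" using assms by blast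
  have R: "(a, b) \<in> ?R \<longleftrightarrow> a < 5 * N \<and> b < 5 * N \<and> ?A a b" for a b
    using edges_iff[OF symp_sat_adj] by simp
  have pos: "(5 * i + 2, 2) \<in> ?R\<^sup>*" if "i < N" for i
  proof (cases "i = 0")
    case False
    have "?A (5 * i + 2) 2" using False five_mod(3)[of 0] unfolding sat_adj_def sat_dir_def five_mod by simp
    then show ?thesis using that False R by (intro r_into_rtrancl) auto
  qed (simp add: numeral_eq_Suc)
  have cen: "(5 * i, 2) \<in> ?R\<^sup>*" if "i < N" for i
    using that R sat_adj_center by (intro converse_rtrancl_into_rtrancl[OF _ pos[of i]]) auto
  have lea: "(5 * i + 1, 2) \<in> ?R\<^sup>*" if "i < N" for i
    using that R sat_adj_leaf by (intro converse_rtrancl_into_rtrancl[OF _ cen[of i]]) auto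
  have neg: "(5 * i + 3, 2) \<in> ?R\<^sup>*" if "i < N" for i
    using that R sympD[OF symp_sat_adj, of pos neg "5 * i" "5 * i + 3"] sat_adj_center
    by (intro converse_rtrancl_into_rtrancl[OF _ cen[of i]]) auto
  have j: "(5 * j + 4, 2) \<in> ?R\<^sup>*"
  proof (cases "pos j u")
    case True
    then have "?A (5 * j + 4) (5 * u + 2)" unfolding sat_adj_def sat_dir_def five_mod by simp
    then show ?thesis using ju R by (intro converse_rtrancl_into_rtrancl[OF _ pos[of u]]) auto
  next
    case False
    then have "?A (5 * j + 4) (5 * u + 3)" using ju unfolding sat_adj_def sat_dir_def five_mod by simp
    then show ?thesis using ju R by (intro converse_rtrancl_into_rtrancl[OF _ neg[of u]]) auto
  qed
  have cla: "(5 * i + 4, 2) \<in> ?R\<^sup>*" if "i < N" for i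
  proof (cases "i = j")
    case False
    then have "?A (5 * i + 4) (5 * j + 4)" using False unfolding sat_adj_def sat_dir_def five_mod by simp
    then show ?thesis using that ju R by (intro converse_rtrancl_into_rtrancl[OF _ j]) auto
  qed (use j in simp)
  have root: "(a, 2) \<in> ?R\<^sup>*" if "a < 5 * N" for a
    using that by (cases a rule: mod5_cases) (use pos neg cen lea cla in auto)
  have "sym ?R" by (auto simp: sym_def insert_commute)
  then have root': "(2, a) \<in> ?R\<^sup>*" if "a < 5 * N" for a
    using root[OF that] sym_rtrancl by (blast dest: symD)
  show ?thesis
    unfolding connected_graph_def
  proof (intro conjI ballI)
    show "{..<5 * N} \<noteq> {}" using ju(1) by (simp add: lessThan_empty_iff)
    fix a b assume "a \<in> {..<5 * N}" "b \<in> {..<5 * N}"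
    then show "(a, b) \<in> ?R\<^sup>*" using rtrancl_trans[OF root[of a] root'[of b]] by simp
  qed (rule simple_graph_edges[OF irreflp_sat_adj])
qed

text \<open>Dominating the leaf of \<open>u\<close> takes a pair that meets the center or the leaf.
  These \<open>N\<close> pairs are distinct and so exhaust \<open>P\<close>. Consequently no pair
  contains a clause vertex or both literals of a variable, and each clause vertex is dominated by a
  selected literal.\<close>

lemma satisfiable_if_paired_dominating:
  assumes pds: "paired_dominating_set {..<5 * (5 * N)} (edges (5 * (5 * N)) (gp4_adj (sat_adj pos neg))) D"
    and card: "card D \<le> 12 * N"
  shows "satisfiable N pos neg"
proof -
  let ?A = "sat_adj pos neg"
  obtain P where P: "finite P" "card P \<le> N" and pair: "\<And>e. e \<in> P \<Longrightarrow> \<exists>i j. e \<subseteq> {i, j} \<and> (i = j \<or> ?A i j)"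
    and dom: "\<And>i. i < 5 * N \<Longrightarrow> \<exists>j\<in>\<Union>P. j = i \<or> ?A i j"
    using paired_dominating_set_pairs[OF symp_sat_adj irreflp_sat_adj pds, of N] card by auto
  have "\<exists>e\<in>P. 5 * u \<in> e \<or> 5 * u + 1 \<in> e" if "u < N" for u
    using dom[of "5 * u + 1"] that unfolding sat_adj_leaf by auto
  then obtain e where e: "\<And>u. u < N \<Longrightarrow> e u \<in> P" "\<And>u. u < N \<Longrightarrow> 5 * u \<in> e u \<or> 5 * u + 1 \<in> e u"
    by metis
  have e_sub: "e u \<subseteq> {5 * u, 5 * u + 1, 5 * u + 2} \<or> e u \<subseteq> {5 * u, 5 * u + 1, 5 * u + 3}" if u: "u < N" for u
  proof -
    obtain i j where ij: "e u \<subseteq> {i, j}" "i = j \<or> ?A i j" using pair[OF e(1)[OF u]] by blast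
    then have ij': "i = j \<or> ?A j i" using sympD[OF symp_sat_adj] by metis
    have "i = 5 * u \<or> i = 5 * u + 1 \<or> j = 5 * u \<or> j = 5 * u + 1" using e(2)[OF u] ij(1) by blast
    then show ?thesis
      using ij(2) ij' ij(1) by (elim disjE) (auto simp: sat_adj_center sat_adj_leaf[simplified])
  qed
  have e_div: "k div 5 = u" "k mod 5 \<noteq> 4" if "u < N" "k \<in> e u" for u k
  proof -
    have "k = 5 * u \<or> k = 5 * u + 1 \<or> k = 5 * u + 2 \<or> k = 5 * u + 3"
      using e_sub[OF that(1)] that(2) by blast
    then show "k div 5 = u" "k mod 5 \<noteq> 4" unfolding five_eq by auto
  qed
  have "inj_on e {..<N}"
  proof (rule inj_onI)
    fix u u' assume *: "u \<in> {..<N}" "u' \<in> {..<N}" "e u = e u'"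
    then obtain k where "k \<in> e u" using e(2) by auto
    then show "u = u'" using e_div(1) * by (metis lessThan_iff)
  qed
  then have "card (e ` {..<N}) = N" by (simp add: card_image)
  moreover have "e ` {..<N} \<subseteq> P" using e(1) by auto
  ultimately have Pe: "P = e ` {..<N}" using P by (metis card_subset_eq card_mono le_antisym)
  have mem: "\<exists>u<N. k \<in> e u" if "k \<in> \<Union>P" for k using that Pe by auto
  \<comment> \<open>A variable whose pair contains neither literal becomes false; such a pair
    dominates no clause vertex.\<close>
  define \<alpha> where "\<alpha> u \<longleftrightarrow> 5 * u + 2 \<in> \<Union>P" for u
  show ?thesis
    unfolding satisfiable_def
  proof (intro exI[of _ \<alpha>] allI impI)
    fix j assume j: "j < N"
    then obtain b where b: "b \<in> \<Union>P" "b = 5 * j + 4 \<or> ?A (5 * j + 4) b"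
      using dom[of "5 * j + 4"] by auto
    obtain u where u: "u < N" "b \<in> e u" using mem[OF b(1)] by blast
    have b4: "b mod 5 \<noteq> 4" using e_div(2)[OF u] .
    then have "?A (5 * j + 4) b" using b(2) five_mod(5) by metis
    from this b4 show "\<exists>u<N. pos j u \<and> \<alpha> u \<or> neg j u \<and> \<not> \<alpha> u"
    proof (cases rule: sat_adj_clause)
      case (1 u')
      then have "u' = u" using e_div(1)[OF u] by simp
      then have "\<alpha> u" using b(1) 1(1) by (simp only: \<alpha>_def)
      then show ?thesis using u(1) 1(2) \<open>u' = u\<close> by blast
    next
      case (2 u')
      then have u': "u' = u" using e_div(1)[OF u] by simp
      have "\<not> \<alpha> u"
      proof
        assume "\<alpha> u"
        then obtain u'' where u'': "u'' < N" "5 * u + 2 \<in> e u''" using mem by (auto simp: \<alpha>_def)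
        then have "5 * u + 2 \<in> e u" using e_div(1)[OF u''] five_mod(8)[of u] by metis
        then show False using e_sub[OF u(1)] u(2) 2(1) u' by auto
      qed
      then show ?thesis using 2 u u' by auto
    qed
  qed
qed

lemma paired_dominating_if_satisfiable:
  assumes "satisfiable N pos neg"
  shows "\<exists>D. paired_dominating_set {..<5 * (5 * N)} (edges (5 * (5 * N)) (gp4_adj (sat_adj pos neg))) D \<and>
    card D \<le> 12 * N"
proof -
  let ?A = "sat_adj pos neg" let ?G = "gp4_adj ?A" let ?E = "edges (5 * (5 * N)) ?G"
  obtain \<alpha> where \<alpha>: "\<And>j. j < N \<Longrightarrow> \<exists>u<N. pos j u \<and> \<alpha> u \<or> neg j u \<and> \<not> \<alpha> u"
    using assms unfolding satisfiable_def by blast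
  define l where "l u = (if \<alpha> u then 5 * u + 2 else 5 * u + 3)" for u
  have l: "l u div 5 = u" "l u mod 5 = 2 \<or> l u mod 5 = 3" "u < N \<Longrightarrow> l u < 5 * N" for u
    unfolding l_def by (cases "\<alpha> u"; simp only: if_True if_False five_mod; simp)+
  \<comment> \<open>On every path the pair of \<open>x\<close> and \<open>y\<close> takes care of
    \<open>w\<close> and \<open>z\<close>. The remaining pairs join the center of each variable, at
    \<open>5 * (5 * u)\<close>, to its true literal, and they dominate the vertices of
    \<open>H\<close>.\<close>
  define D where "D = (\<lambda>i. 5 * i + 2) ` {..<5 * N} \<union> (\<lambda>i. 5 * i + 3) ` {..<5 * N} \<union>
    (\<lambda>u. 5 * (5 * u)) ` {..<N} \<union> (\<lambda>u. 5 * l u) ` {..<N}"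
  define M where "M = (\<lambda>i. {5 * i + 2, 5 * i + 3}) ` {..<5 * N} \<union> (\<lambda>u. {5 * (5 * u), 5 * l u}) ` {..<N}"
  have E: "{i, j} \<in> ?E \<longleftrightarrow> i < 5 * (5 * N) \<and> j < 5 * (5 * N) \<and> ?G i j" for i j
    by (rule edges_iff[OF symp_gp4_adj[OF symp_sat_adj]])
  have l2: "l u mod 5 = (if \<alpha> u then 2 else 3)" for u
    unfolding l_def by (cases "\<alpha> u") (simp_all only: if_True if_False five_mod)
  have Al: "?A (5 * u) (l u)" for u unfolding sat_adj_center l_def by simp
  have "card D \<le> 5 * N + 5 * N + N + N"
    unfolding D_def by (intro order_trans[OF card_Un_le] add_mono order_trans[OF card_image_le]) auto
  then have card: "card D \<le> 12 * N" by simp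
  have D_sub: "D \<subseteq> {..<5 * (5 * N)}" using l(3) by (auto simp: D_def)
  have dom: "\<exists>b\<in>D. {b, a} \<in> ?E" if a: "a < 5 * (5 * N)" "a \<notin> D" for a
  proof (cases a rule: mod5_cases)
    case (1 i)
    then have i: "i < 5 * N" using a by simp
    have H: ?thesis if "?A i b" "5 * b \<in> D" for b
    proof -
      have "?G (5 * i) (5 * b)" using that(1) unfolding gp4_adj_iff by blast
      then have "{5 * b, a} \<in> ?E" using D_sub that(2) a 1 unfolding insert_commute[of _ a] E by auto
      then show ?thesis using that(2) by blast
    qed
    show ?thesis
    proof (cases i rule: mod5_cases)
      case (1 u)
      then show ?thesis using a \<open>a = 5 * i\<close> by (auto simp: D_def)
    next
      case (2 u)
      then show ?thesis using i by (intro H[of "5 * u"]) (auto simp: D_def sat_adj_leaf[simplified])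
    next
      case (3 u)
      then show ?thesis using i sympD[OF symp_sat_adj, of pos neg "5 * u" i]
        by (intro H[of "5 * u"]) (auto simp: D_def sat_adj_center)
    next
      case (4 u)
      then show ?thesis using i sympD[OF symp_sat_adj, of pos neg "5 * u" i]
        by (intro H[of "5 * u"]) (auto simp: D_def sat_adj_center)
    next
      case (5 j)
      then obtain u where u: "u < N" "pos j u \<and> \<alpha> u \<or> neg j u \<and> \<not> \<alpha> u"
        using \<alpha>[of j] i by auto
      have "?A i (l u)" using u(2) unfolding sat_adj_def sat_dir_def 5 five_mod l(1) l2 by auto
      then show ?thesis using u(1) by (intro H[of "l u"]) (auto simp: D_def)
    qed
  next
    case (2 i)
    then have "i < 5 * N" using a by simp
    then have "5 * i + 2 < 5 * (5 * N)" by linarith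
    then have "{5 * i + 2, a} \<in> ?E" unfolding E 2 gp4_adj_iff using a 2 by simp
    moreover have "5 * i + 2 \<in> D" using a 2 unfolding D_def by auto
    ultimately show ?thesis by blast
  next
    case (3 i)
    then show ?thesis using a by (auto simp: D_def)
  next
    case (4 i)
    then show ?thesis using a by (auto simp: D_def)
  next
    case (5 i)
    have "{5 * i + 3, a} \<in> ?E" unfolding E 5 gp4_adj_iff using a 5 by simp
    moreover have "5 * i + 3 \<in> D" using a 5 unfolding D_def by auto
    ultimately show ?thesis by blast
  qed
  have G2: "?G (5 * i + 2) (5 * i + 3)" for i unfolding gp4_adj_iff by simp
  have Gl: "?G (5 * (5 * u)) (5 * l u)" for u unfolding gp4_adj_iff using Al by blast
  have M_sub: "M \<subseteq> induced_edges ?E D"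
  proof
    fix e assume "e \<in> M"
    then consider i where "i < 5 * N" "e = {5 * i + 2, 5 * i + 3}" | u where "u < N" "e = {5 * (5 * u), 5 * l u}"
      by (auto simp: M_def)
    then show "e \<in> induced_edges ?E D"
    proof cases
      case (1 i)
      then show ?thesis
        unfolding induced_edges_def using E[of "5 * i + 2" "5 * i + 3"] G2[of i] by (auto simp: D_def)
    next
      case (2 u)
      then show ?thesis unfolding induced_edges_def using E[of "5 * (5 * u)" "5 * l u"] Gl[of u] l(3)[of u]
        by (auto simp: D_def)
    qed
  qed
  have uni: "e = {5 * i + 2, 5 * i + 3}" if "e \<in> M" "k \<in> e" "k = 5 * i + 2 \<or> k = 5 * i + 3" for e k i
  proof -
    consider j where "e = {5 * j + 2, 5 * j + 3}" | u where "e = {5 * (5 * u), 5 * l u}"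
      using \<open>e \<in> M\<close> by (auto simp: M_def)
    then show ?thesis
    proof cases
      case (1 j)
      then have "k = 5 * j + 2 \<or> k = 5 * j + 3" using that(2) by blast
      then have "i = j" using that(3) by presburger
      then show ?thesis using 1 by simp
    next
      case (2 u)
      then have "\<exists>x. k = 5 * x" using that(2) by blast
      then have False using that(3) by presburger
      then show ?thesis ..
    qed
  qed
  \<comment> \<open>The center and the literals of a variable have the same quotient by 5, so a
    chosen vertex of \<open>H\<close> determines its matching edge.\<close>
  have unil: "e = {5 * (5 * u), 5 * l u}" if "e \<in> M" "5 * k \<in> e" "k div 5 = u" for e k u
  proof -
    consider i where "e = {5 * i + 2, 5 * i + 3}" | u' where "e = {5 * (5 * u'), 5 * l u'}"
      using \<open>e \<in> M\<close> by (auto simp: M_def)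
    then show ?thesis
    proof cases
      case (1 i)
      then have "5 * k = 5 * i + 2 \<or> 5 * k = 5 * i + 3" using that(2) by blast
      then have False by presburger
      then show ?thesis ..
    next
      case (2 u')
      then have "k = 5 * u' \<or> k = l u'" using that(2) by auto
      then have "u' = u" using l(1)[of u'] that(3) by auto
      then show ?thesis using 2 by simp
    qed
  qed
  have "\<exists>!e. e \<in> M \<and> v \<in> e" if v: "v \<in> D" for v
  proof -
    consider i where "i < 5 * N" "v = 5 * i + 2 \<or> v = 5 * i + 3" | u where "u < N" "v = 5 * (5 * u) \<or> v = 5 * l u"
      using v unfolding D_def by blast
    then show ?thesis
    proof cases
      case (1 i)
      show ?thesis
      proof (rule ex1I[of _ "{5 * i + 2, 5 * i + 3}"])
        show "{5 * i + 2, 5 * i + 3} \<in> M \<and> v \<in> {5 * i + 2, 5 * i + 3}"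
          using 1 by (auto simp: M_def)
      qed (use uni 1 in blast)
    next
      case (2 u)
      show ?thesis
      proof (rule ex1I[of _ "{5 * (5 * u), 5 * l u}"])
        show "{5 * (5 * u), 5 * l u} \<in> M \<and> v \<in> {5 * (5 * u), 5 * l u}"
          using 2 by (auto simp: M_def)
        fix e assume e: "e \<in> M \<and> v \<in> e"
        then consider "5 * (5 * u) \<in> e" | "5 * l u \<in> e" using 2 by blast
        then show "e = {5 * (5 * u), 5 * l u}"
        proof cases
          case 1
          then show ?thesis using e by (intro unil[of e "5 * u"]) auto
        next
          case 2
          then show ?thesis using e l(1) by (intro unil[of e "l u"]) auto
        qed
      qed
    qed
  qed
  then have "paired_dominating_set {..<5 * (5 * N)} ?E D"
    unfolding paired_dominating_set_def perfect_matching_def using D_sub dom M_sub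
    by (intro conjI ballI exI[of _ M]) auto
  then show ?thesis using card by blast
qed

section \<open>The reduction from satisfiability\<close>

lemma concat_map_upt:
  "concat (map (\<lambda>i. map (f i) [0..<n]) [0..<m]) = map (\<lambda>k. f (k div n) (k mod n)) [0..<m * n]"
proof (induction m)
  case (Suc m)
  have "[0..<Suc m * n] = [0..<m * n] @ map (\<lambda>j. j + m * n) [0..<n]"
    using upt_add_eq_append[of 0 "m * n" n] by (simp add: map_add_upt add.commute)
  then show ?case using Suc by simp
qed simp

lemma adj_matrix_eq: "adj_matrix n E = map (\<lambda>k. {k div n, k mod n} \<in> E) [0..<n * n]"
  unfolding adj_matrix_def by (rule concat_map_upt)

lemma pdefinable_app2:
  assumes "pdefinable (\<lambda>s v. P s (v 0) (v (Suc 0)))" "definable F" "definable G"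
  shows "pdefinable (\<lambda>s v. P s (F s v) (G s v))"
proof -
  have "pdefinable (\<lambda>s v. P s (F s (\<lambda>i. v (Suc i))) (v 0))"
    by (rule pdefinable_let[OF definable_rename[OF assms(2)], of "\<lambda>s v n. P s n (v 0)"]) (rule assms(1))
  then show ?thesis by (rule pdefinable_let[OF assms(3)])
qed

text \<open>The encoding is injective on simple graphs; this makes injectivity applicable to the
  graph of any instance of the problem.\<close>

lemma gp4_graph_simple:
  assumes "gp4_graph V E"
  shows "simple_graph V E"
proof -
  from assms obtain VH EH w x y z where con: "connected_graph VH EH"
    and dis: "disjnt VH (w ` VH)" "disjnt (w ` VH) (x ` VH)" "disjnt (x ` VH) (y ` VH)" "disjnt (y ` VH) (z ` VH)"
    and V: "V = VH \<union> w ` VH \<union> x ` VH \<union> y ` VH \<union> z ` VH"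
    and E: "E = EH \<union> (\<Union>v\<in>VH. {{v, w v}, {w v, x v}, {x v, y v}, {y v, z v}})"
    unfolding gp4_graph_def by blast
  have H: "finite VH" "\<And>e. e \<in> EH \<Longrightarrow> e \<subseteq> VH \<and> card e = 2"
    using con by (auto simp: connected_graph_def simple_graph_def)
  have pair: "card {a, b} = 2" if "disjnt A B" "a \<in> A" "b \<in> B" for a b :: 'a and A B
    using that by (auto simp: disjnt_iff card_insert_if)
  show ?thesis
    unfolding simple_graph_def
  proof (intro conjI ballI)
    fix e assume "e \<in> E"
    then consider "e \<in> EH" | v where "v \<in> VH" "e \<in> {{v, w v}, {w v, x v}, {x v, y v}, {y v, z v}}"
      unfolding E by blast
    then show "e \<subseteq> V" "card e = 2"
    proof (atomize (full), cases)
      case 1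
      then show "e \<subseteq> V \<and> card e = 2" using H unfolding V by blast
    next
      case (2 v)
      then show "e \<subseteq> V \<and> card e = 2"
        using pair[OF dis(1), of v "w v"] pair[OF dis(2), of "w v" "x v"]
          pair[OF dis(3), of "x v" "y v"] pair[OF dis(4), of "y v" "z v"] unfolding V by auto
    qed
  qed (simp add: V H)
qed

text \<open>The encoding is rewritten as a formula for its \<open>i\<close>-th bit, the form that
  \<open>polytime_definable\<close> accepts. Position \<open>n\<close>, which terminates the unary
  number, is false because it satisfies neither \<open>i < n\<close> nor
  \<open>n < i\<close>.\<close>

lemma encode_instance_eq:
  assumes "symp R"
  shows "encode_instance n (edges n R) k =
    map (\<lambda>i. i < n \<or> n < i \<and> (if i < n + 1 + n * n then R ((i - n - 1) div n) ((i - n - 1) mod n)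
        else odd (k div 2 ^ (i - n - 1 - n * n)))) [0..<n + 1 + n * n + length (binary k)]"
  (is "?e = map ?b _")
proof (rule nth_equalityI)
  show "length ?e = length (map ?b [0..<n + 1 + n * n + length (binary k)])"
    by (simp add: encode_instance_def adj_matrix_eq)
  fix i assume "i < length ?e"
  then have i': "i < n + 1 + n * n + length (binary k)"
    by (simp add: encode_instance_def adj_matrix_eq)
  consider "i < n" | "i = n" | "n < i" "i < n + 1 + n * n" | "n + 1 + n * n \<le> i" by linarith
  then have "?e ! i \<longleftrightarrow> ?b i"
  proof cases
    case 3
    define l where "l = i - n - 1"
    have l: "i = Suc (n + l)" "l < n * n" using 3 by (auto simp: l_def)
    have "n > 0" using l by (cases n) auto
    then have "l div n < n" "l mod n < n" using l by (auto simp: less_mult_imp_div_less)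
    then show ?thesis using 3 l
      by (simp add: encode_instance_def adj_matrix_eq nth_append edges_iff[OF assms])
  next
    case 4
    define l where "l = i - n - 1 - n * n"
    have l: "i = Suc (n + (n * n + l))" "l < length (binary k)" using 4 i' by (auto simp: l_def)
    then show ?thesis using nth_binary[OF l(2)]
      by (simp add: encode_instance_def adj_matrix_eq nth_append)
  qed (auto simp: encode_instance_def nth_append)
  then show "?e ! i = map ?b [0..<n + 1 + n * n + length (binary k)] ! i"
    using i' by (simp del: upt_Suc)
qed

text \<open>The premise \<open>ne\<close> yields both the connectedness of \<open>H\<close> and a
  positive bound. Injectivity of the encoding shows that an instance equal to \<open>f x\<close> has
  the constructed graph and bound, so the converse direction applies.\<close>

theorem reduce_sat:
  assumes N: "definable (\<lambda>s v. N s)"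
    and pos: "pdefinable (\<lambda>s v. pos s (v 0) (v (Suc 0)))"
    and neg: "pdefinable (\<lambda>s v. neg s (v 0) (v (Suc 0)))"
    and ne: "\<And>s. \<exists>j<N s. \<exists>u<N s. pos s j u \<or> neg s j u"
    and K: "\<And>x. x \<in> K \<longleftrightarrow> satisfiable (N (syms x)) (pos (syms x)) (neg (syms x))"
  shows "polytime_reducible K gp4_paired_domination"
proof -
  define R where "R s = gp4_adj (sat_adj (pos s) (neg s))" for s
  let ?n = "\<lambda>s. 5 * (5 * N s)" let ?k = "\<lambda>s. 12 * N s"
  define B where "B s i \<longleftrightarrow> i < ?n s \<or> ?n s < i \<and> (if i < ?n s + 1 + ?n s * ?n s
     then R s ((i - ?n s - 1) div ?n s) ((i - ?n s - 1) mod ?n s)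
     else odd (?k s div 2 ^ (i - ?n s - 1 - ?n s * ?n s)))" for s i
  define f where "f x = encode_instance (?n (syms x)) (edges (?n (syms x)) (R (syms x))) (?k (syms x))" for x
  have sym: "symp (R s)" for s unfolding R_def by (intro symp_gp4_adj symp_sat_adj)
  have Rdef: "pdefinable (\<lambda>s v. R s (v 0) (v (Suc 0)))"
    unfolding R_def gp4_adj_def chain_def sat_adj_def sat_dir_def
    by (intro def_intros pdefinable_app2[OF pos] pdefinable_app2[OF neg])
  have f: "f = (\<lambda>x. map (\<lambda>i. B (syms x) (case_nat i (\<lambda>_. 0) 0))
      [0..<?n (syms x) + 1 + ?n (syms x) * ?n (syms x) + length (binary (?k (syms x)))])"
    unfolding f_def encode_instance_eq[OF sym] B_def nat.case ..
  have "polytime_computable f"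
    unfolding f
  proof (rule polytime_definable)
    show "definable (\<lambda>s v. ?n s + 1 + ?n s * ?n s + length (binary (?k s)))"
      by (intro definable_length_binary def_intros N)
    show "pdefinable (\<lambda>s v. B s (v 0))"
      unfolding B_def by (intro pdefinable_bit pdefinable_app2[OF Rdef] def_intros N)
  qed
  moreover have "x \<in> K \<longleftrightarrow> f x \<in> gp4_paired_domination" for x
  proof -
    let ?s = "syms x" let ?E = "edges (?n ?s) (R ?s)"
    have gp4: "gp4_graph {..<?n ?s} ?E"
      unfolding R_def by (intro gp4_graph_edges symp_sat_adj connected_graph_sat ne)
    have N0: "N ?s > 0" using ne[of ?s] by auto
    show ?thesis
    proof
      assume "x \<in> K"
      then obtain D where "paired_dominating_set {..<?n ?s} ?E D" "card D \<le> ?k ?s"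
        using paired_dominating_if_satisfiable K unfolding R_def by blast
      then have "gp4_graph {..<?n ?s} ?E \<and> ?k ?s > 0 \<and>
          (\<exists>D. paired_dominating_set {..<?n ?s} ?E D \<and> card D \<le> ?k ?s)"
        using gp4 N0 by auto
      then show "f x \<in> gp4_paired_domination"
        unfolding gp4_paired_domination_def f_def by blast
    next
      assume "f x \<in> gp4_paired_domination"
      then obtain n E k D where *: "f x = encode_instance n E k" "gp4_graph {..<n} E"
        "paired_dominating_set {..<n} E D" "card D \<le> k"
        unfolding gp4_paired_domination_def by blast
      then have "n = ?n ?s \<and> E = ?E \<and> k = ?k ?s"
        unfolding f_def using encode_instance_inj gp4 gp4_graph_simple by metis
      then have "satisfiable (N ?s) (pos ?s) (neg ?s)"
        using *(3,4) satisfiable_if_paired_dominating unfolding R_def by blast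
      then show "x \<in> K" using K by simp
    qed
  qed
  ultimately show ?thesis unfolding polytime_reducible_def by blast
qed

section \<open>Satisfiability encodes machine runs\<close>

datatype kind = QK nat | AK nat | SK nat nat

text \<open>A clause is a rule together with a time and a cell. \<open>Row\<close> recognises the
  row of the transition table that applies; \<open>State\<close>, \<open>Write\<close> and
  \<open>Move\<close> carry out its effect. \<open>InitQ\<close> to \<open>Suffix\<close> describe
  the initial configuration, where \<open>Choice\<close> leaves the certificate open and
  \<open>Suffix\<close> forces blanks to stay blank. \<open>Final\<close> excludes a nonaccepting
  state at the end.\<close>

datatype rule = Row nat | State nat | Write nat nat | Move nat nat nat
  | InitQ | Work nat | Blank | Symbol | Separator | Choice | Suffix | Final nat

instance kind :: countable by countable_datatype
instance rule :: countable by countable_datatype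

definition rel :: "config \<Rightarrow> nat \<Rightarrow> int \<Rightarrow> nat" where
  "rel c j d = snd (snd c ! j) (fst (snd c ! j) + d)"

text \<open>Cells are counted relative to the head, so they move against it: the content of
  \<open>c\<close> is found in \<open>c'\<close> after the step. The case distinction avoids
  integers, which expressions do not have.\<close>

definition shifted :: "move \<Rightarrow> nat \<Rightarrow> nat \<Rightarrow> bool" where
  "shifted a c c' \<longleftrightarrow> (case a of MLeft \<Rightarrow> c' = Suc c | MStay \<Rightarrow> c' = c | MRight \<Rightarrow> Suc c' = c)"

lemma shifted_iff: "shifted a c c' \<longleftrightarrow> int c = int c' + offset a"
  by (cases a) (auto simp: shifted_def)

lemma contents_verifier_input:
  "contents (verifier_input x u) d =
     (if d < 0 then 0 else if d < int (length x) then contents (syms x) d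
      else if d = int (length x) then 3
      else contents (syms u) (d - int (length x) - 1))"
proof -
  have "nat (d - int (length x) - 1) = nat d - Suc (length x)" by linarith
  then show ?thesis
    by (auto simp: contents_def verifier_input_def syms_def nth_append nth_Cons' nat_less_iff nat_diff_distrib)
qed

text \<open>
  A fact is a triple of a kind, a time and a cell: \<open>QK q\<close> at time \<open>t\<close> says that the machine is in
  state \<open>q\<close>, \<open>AK i\<close> that row \<open>i\<close> of the transition table applies, and \<open>SK j a\<close> at \<open>t\<close> and \<open>c\<close>
  that the symbol at distance \<open>c - T\<close> from the head of tape \<open>j\<close> is \<open>a\<close>. Recording the contents
  relative to the head makes the successor facts local. The clauses are Horn clauses, apart
  from those that leave the certificate open; therefore the facts of an actual run follow from
  the clauses, and nothing has to be said about uniqueness.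
\<close>

locale verifier =
  fixes M :: tm and p r :: "nat poly"
  assumes wf: "wf_tm M"
begin

abbreviation "k \<equiv> num_tapes M"

text \<open>Like \<open>step\<close>, halting states change nothing. Every row thus has a successor,
  and all runs can be inspected at the same time.\<close>

definition delta :: "nat \<Rightarrow> nat list \<Rightarrow> nat \<times> (nat \<times> move) list" where
  "delta q ss = (if q = accept M \<or> q = reject M then (q, map (\<lambda>a. (a, MStay)) ss) else trans M q ss)"

definition row_set :: "(nat \<times> nat list) set" where
  "row_set = {..<num_states M} \<times> {ss. set ss \<subseteq> {..<num_syms M} \<and> length ss = k}"

definition rows :: "(nat \<times> nat list) list" where
  "rows = (SOME xs. set xs = row_set)"

lemma set_rows: "set rows = row_set"
proof -
  have "finite row_set"
    unfolding row_set_def by (intro finite_cartesian_product finite_lists_length_eq) auto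
  then show ?thesis unfolding rows_def by (rule someI_ex[OF finite_list])
qed

definition out :: "nat \<Rightarrow> nat \<times> (nat \<times> move) list" where
  "out i = delta (fst (rows ! i)) (snd (rows ! i))"

text \<open>\<open>m\<close> bounds the certificate, and \<open>T\<close> is the time bound for the
  longest admissible input, with 1 for the separator. \<open>T\<close> also serves as the origin of
  the cells: the scanned cell is always number \<open>T\<close>.\<close>

definition m :: "nat list \<Rightarrow> nat" where "m s = poly p (length s)"
definition T :: "nat list \<Rightarrow> nat" where "T s = poly r (length s + 1 + m s)"

text \<open>The clause says that the facts in \<open>negl\<close> together imply one of the facts in
  \<open>posl\<close>. Facts about states and rows have no cell of their own and use cell 0.
  \<open>Write\<close> places the new symbol where the formerly scanned cell \<open>T s\<close> ends
  up after the move.\<close>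

fun posl :: "nat list \<Rightarrow> rule \<Rightarrow> nat \<Rightarrow> nat \<Rightarrow> kind \<Rightarrow> nat \<Rightarrow> nat \<Rightarrow> bool" where
  "posl s (Row i) t c \<kappa> t' c' \<longleftrightarrow> \<kappa> = AK i \<and> t' = t \<and> c' = 0"
| "posl s (State i) t c \<kappa> t' c' \<longleftrightarrow> \<kappa> = QK (fst (out i)) \<and> t' = Suc t \<and> c' = 0"
| "posl s (Write i j) t c \<kappa> t' c' \<longleftrightarrow> \<kappa> = SK j (fst (snd (out i) ! j)) \<and> t' = Suc t \<and>
     shifted (snd (snd (out i) ! j)) (T s) c'"
| "posl s (Move i j a) t c \<kappa> t' c' \<longleftrightarrow> \<kappa> = SK j a \<and> t' = Suc t \<and> shifted (snd (snd (out i) ! j)) c c'"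
| "posl s InitQ t c \<kappa> t' c' \<longleftrightarrow> \<kappa> = QK (start M) \<and> t' = 0 \<and> c' = 0"
| "posl s (Work j) t c \<kappa> t' c' \<longleftrightarrow> \<kappa> = SK j 0 \<and> t' = 0 \<and> c' = c"
| "posl s Blank t c \<kappa> t' c' \<longleftrightarrow> \<kappa> = SK 0 0 \<and> t' = 0 \<and> c' = c"
| "posl s Symbol t c \<kappa> t' c' \<longleftrightarrow> (\<kappa> = SK 0 1 \<and> contents s (int (c - T s)) = 1 \<or>
     \<kappa> = SK 0 2 \<and> contents s (int (c - T s)) = 2) \<and> t' = 0 \<and> c' = c"
| "posl s Separator t c \<kappa> t' c' \<longleftrightarrow> \<kappa> = SK 0 3 \<and> t' = 0 \<and> c' = c"
| "posl s Choice t c \<kappa> t' c' \<longleftrightarrow> \<kappa> \<in> {SK 0 0, SK 0 1, SK 0 2} \<and> t' = 0 \<and> c' = c"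
| "posl s Suffix t c \<kappa> t' c' \<longleftrightarrow> \<kappa> = SK 0 0 \<and> t' = 0 \<and> c' = Suc c"
| "posl s (Final q) t c \<kappa> t' c' \<longleftrightarrow> False"

fun negl :: "nat list \<Rightarrow> rule \<Rightarrow> nat \<Rightarrow> nat \<Rightarrow> kind \<Rightarrow> nat \<Rightarrow> nat \<Rightarrow> bool" where
  "negl s (Row i) t c \<kappa> t' c' \<longleftrightarrow> (\<kappa> = QK (fst (rows ! i)) \<and> c' = 0 \<or>
     (\<exists>j<k. \<kappa> = SK j (snd (rows ! i) ! j)) \<and> c' = T s) \<and> t' = t"
| "negl s (State i) t c \<kappa> t' c' \<longleftrightarrow> \<kappa> = AK i \<and> t' = t \<and> c' = 0"
| "negl s (Write i j) t c \<kappa> t' c' \<longleftrightarrow> \<kappa> = AK i \<and> t' = t \<and> c' = 0"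
| "negl s (Move i j a) t c \<kappa> t' c' \<longleftrightarrow> (\<kappa> = AK i \<and> c' = 0 \<or> \<kappa> = SK j a \<and> c' = c) \<and> t' = t"
| "negl s Suffix t c \<kappa> t' c' \<longleftrightarrow> \<kappa> = SK 0 0 \<and> t' = 0 \<and> c' = c"
| "negl s (Final q) t c \<kappa> t' c' \<longleftrightarrow> \<kappa> = QK q \<and> t' = T s \<and> c' = 0"
| "negl s _ t c \<kappa> t' c' \<longleftrightarrow> False"

text \<open>Tells which times and cells carry a clause. Initially the input starts in cell
  \<open>T s\<close>, the separator is in cell \<open>T s + length s\<close>, and the next
  \<open>m s\<close> cells are open. \<open>Move\<close> is confined to the cells strictly between 0
  and \<open>2 * T s\<close>: the others are too far away to be scanned within \<open>T s\<close>
  steps.\<close>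

fun guard :: "nat list \<Rightarrow> rule \<Rightarrow> nat \<Rightarrow> nat \<Rightarrow> bool" where
  "guard s (State i) t c \<longleftrightarrow> t < T s"
| "guard s (Write i j) t c \<longleftrightarrow> t < T s"
| "guard s (Move i j a) t c \<longleftrightarrow> t < T s \<and> c \<noteq> T s \<and> 0 < c \<and> c < 2 * T s"
| "guard s Blank t c \<longleftrightarrow> c < T s \<or> T s + length s + m s < c"
| "guard s Symbol t c \<longleftrightarrow> T s \<le> c \<and> c < T s + length s"
| "guard s Separator t c \<longleftrightarrow> c = T s + length s"
| "guard s Choice t c \<longleftrightarrow> T s + length s < c \<and> c \<le> T s + length s + m s"
| "guard s Suffix t c \<longleftrightarrow> T s + length s < c \<and> c < T s + length s + m s"
| "guard s _ t c \<longleftrightarrow> True"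

definition rules :: "rule set" where
  "rules = Row ` {..<length rows} \<union> State ` {..<length rows} \<union>
     (\<lambda>(i, j). Write i j) ` ({..<length rows} \<times> {..<k}) \<union>
     (\<lambda>(i, j, a). Move i j a) ` ({..<length rows} \<times> {..<k} \<times> {..<num_syms M}) \<union>
     Work ` {1..<k} \<union> {InitQ, Blank, Symbol, Separator, Choice, Suffix} \<union>
     Final ` {q. q < num_states M \<and> q \<noteq> accept M}"

definition kinds :: "kind set" where
  "kinds = QK ` {..<num_states M} \<union> AK ` {..<length rows} \<union>
     (\<lambda>(j, a). SK j a) ` ({..<k} \<times> {..<num_syms M})"

lemma finite_rules: "finite rules" and finite_kinds: "finite kinds"
  unfolding rules_def kinds_def by auto

definition C :: nat where
  "C = Suc (Max (insert 0 (to_nat ` rules \<union> to_nat ` kinds)))"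

lemma to_nat_less: "\<rho> \<in> rules \<Longrightarrow> to_nat \<rho> < C" "\<kappa> \<in> kinds \<Longrightarrow> to_nat \<kappa> < C"
  unfolding C_def using finite_rules finite_kinds by (auto simp: less_Suc_eq_le intro!: Max_ge)

text \<open>One base for everything that is coded: it exceeds all times and cells in use, including
  the successors that clauses refer to, and the codes of rules and kinds, which are below the
  constant \<open>C\<close>.\<close>

definition B :: "nat list \<Rightarrow> nat" where
  "B s = 2 * T s + length s + m s + C + 2"

definition clauses_hold :: "nat list \<Rightarrow> (kind \<Rightarrow> nat \<Rightarrow> nat \<Rightarrow> bool) \<Rightarrow> bool" where
  "clauses_hold s A \<longleftrightarrow> (\<forall>\<rho>\<in>rules. \<forall>t<B s. \<forall>c<B s. guard s \<rho> t c \<longrightarrow>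
     (\<exists>\<kappa>\<in>kinds. \<exists>t'<B s. \<exists>c'<B s. posl s \<rho> t c \<kappa> t' c' \<and> A \<kappa> t' c' \<or> negl s \<rho> t c \<kappa> t' c' \<and> \<not> A \<kappa> t' c'))"

text \<open>\<open>j\<close> and \<open>u\<close> are read as three digits in base
  \<open>B s\<close>: rule or kind, time, cell. A number \<open>j\<close> that codes no clause gets
  variable 0 with both signs and hence always holds.\<close>

definition literal :: "(nat list \<Rightarrow> rule \<Rightarrow> nat \<Rightarrow> nat \<Rightarrow> kind \<Rightarrow> nat \<Rightarrow> nat \<Rightarrow> bool) \<Rightarrow>
    nat list \<Rightarrow> nat \<Rightarrow> nat \<Rightarrow> bool" where
  "literal L s j u \<longleftrightarrow>
     (if \<exists>\<rho>\<in>rules. j mod B s = to_nat \<rho> \<and> guard s \<rho> (j div B s mod B s) (j div B s div B s)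
      then \<exists>\<rho>\<in>rules. j mod B s = to_nat \<rho> \<and> guard s \<rho> (j div B s mod B s) (j div B s div B s) \<and>
        (\<exists>\<kappa>\<in>kinds. u mod B s = to_nat \<kappa> \<and>
          L s \<rho> (j div B s mod B s) (j div B s div B s) \<kappa> (u div B s mod B s) (u div B s div B s))
      else u = 0)"

definition vars :: "nat list \<Rightarrow> nat" where
  "vars s = B s * (B s * B s)"

section \<open>Definability of the clauses\<close>

lemma definable_params:
  "definable (\<lambda>s v. m s)" "definable (\<lambda>s v. T s)" "definable (\<lambda>s v. B s)" "definable (\<lambda>s v. vars s)"
  unfolding vars_def B_def T_def m_def by (intro definable_poly def_intros)+

lemma pdefinable_shifted:
  assumes "definable F" "definable G"
  shows "pdefinable (\<lambda>s v. shifted a (F s v) (G s v))"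
  by (cases a) (simp_all add: shifted_def pdefinable_eq definable_Suc assms)

lemma pdefinable_literals:
  assumes "definable F1" "definable F2" "definable F3" "definable F4"
  shows "pdefinable (\<lambda>s v. posl s \<rho> (F1 s v) (F2 s v) \<kappa> (F3 s v) (F4 s v))"
    "pdefinable (\<lambda>s v. negl s \<rho> (F1 s v) (F2 s v) \<kappa> (F3 s v) (F4 s v))"
  by (cases \<rho>; simp only: posl.simps negl.simps;
      intro pdefinable_shifted def_intros assms definable_params)+

lemma pdefinable_guard:
  assumes "definable F" "definable G"
  shows "pdefinable (\<lambda>s v. guard s \<rho> (F s v) (G s v))"
  by (cases \<rho>; simp only: guard.simps; intro def_intros assms definable_params)

lemma pdefinable_literal:
  "pdefinable (\<lambda>s v. literal posl s (v 0) (v (Suc 0)))"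
  "pdefinable (\<lambda>s v. literal negl s (v 0) (v (Suc 0)))"
  unfolding literal_def
  by (intro pdefinable_if pdefinable_bex_const finite_rules finite_kinds pdefinable_conj pdefinable_eq
      pdefinable_literals pdefinable_guard definable_mod definable_div definable_var definable_const definable_params)+

section \<open>Coding of triples, and satisfiability in terms of facts\<close>

definition code :: "nat list \<Rightarrow> nat \<Rightarrow> nat \<Rightarrow> nat \<Rightarrow> nat" where
  "code s a t c = a + B s * (t + B s * c)"

lemma code:
  assumes "a < B s" "t < B s" "c < B s"
  shows "code s a t c < vars s" "code s a t c mod B s = a" "code s a t c div B s mod B s = t"
    "code s a t c div B s div B s = c"
proof -
  have B: "B s > 0" by (simp add: B_def)
  then show "code s a t c mod B s = a" "code s a t c div B s mod B s = t"
    "code s a t c div B s div B s = c"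
    using assms by (simp_all add: code_def)
  have "t + B s * c < B s * B s"
    using assms mult_le_mono2[of "Suc c" "B s" "B s"] by (simp add: algebra_simps)
  then have "B s * Suc (t + B s * c) \<le> B s * (B s * B s)" by (intro mult_le_mono2) simp
  then show "code s a t c < vars s" using assms by (simp add: code_def vars_def)
qed

lemma decode:
  assumes "j < vars s"
  shows "j mod B s < B s" "j div B s mod B s < B s" "j div B s div B s < B s"
    "code s (j mod B s) (j div B s mod B s) (j div B s div B s) = j"
proof -
  have B: "B s > 0" by (simp add: B_def)
  then show "j mod B s < B s" "j div B s mod B s < B s" by simp_all
  show "j div B s div B s < B s" using assms
    by (simp add: vars_def less_mult_imp_div_less mult.commute mult.left_commute div_mult2_eq[symmetric])
  show "code s (j mod B s) (j div B s mod B s) (j div B s div B s) = j" by (simp add: code_def)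
qed

lemma satisfiable_iff_clauses:
  "satisfiable (vars s) (literal posl s) (literal negl s) \<longleftrightarrow> (\<exists>A. clauses_hold s A)"
proof
  assume "satisfiable (vars s) (literal posl s) (literal negl s)"
  then obtain \<alpha> where \<alpha>: "\<And>j. j < vars s \<Longrightarrow>
      \<exists>u<vars s. literal posl s j u \<and> \<alpha> u \<or> literal negl s j u \<and> \<not> \<alpha> u"
    unfolding satisfiable_def by blast
  have "clauses_hold s (\<lambda>\<kappa> t c. \<alpha> (code s (to_nat \<kappa>) t c))"
    unfolding clauses_hold_def
  proof (intro ballI allI impI)
    fix \<rho> t c assume \<rho>: "\<rho> \<in> rules" "t < B s" "c < B s" "guard s \<rho> t c"
    have "to_nat \<rho> < B s" using to_nat_less(1)[OF \<rho>(1)] by (simp add: B_def)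
    note cd = code[OF this \<rho>(2,3)]
    obtain u where u: "u < vars s" "literal posl s (code s (to_nat \<rho>) t c) u \<and> \<alpha> u \<or>
       literal negl s (code s (to_nat \<rho>) t c) u \<and> \<not> \<alpha> u"
         using \<alpha>[OF cd(1)] by blast
    have ex: "\<exists>\<rho>'\<in>rules. to_nat \<rho> = to_nat \<rho>' \<and> guard s \<rho>' t c"
      using \<rho> by blast
    have lit: "\<exists>\<kappa>\<in>kinds. u mod B s = to_nat \<kappa> \<and> L s \<rho> t c \<kappa> (u div B s mod B s) (u div B s div B s)"
      if "literal L s (code s (to_nat \<rho>) t c) u" for L
      using that ex unfolding literal_def cd by auto
    note dc = decode[OF u(1)]
    from u(2) show "\<exists>\<kappa>\<in>kinds. \<exists>t'<B s. \<exists>c'<B s. posl s \<rho> t c \<kappa> t' c' \<and> \<alpha> (code s (to_nat \<kappa>) t' c') \<or>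
       negl s \<rho> t c \<kappa> t' c' \<and> \<not> \<alpha> (code s (to_nat \<kappa>) t' c')"
    proof (elim disjE conjE)
      assume "literal posl s (code s (to_nat \<rho>) t c) u" "\<alpha> u"
      then obtain \<kappa> where "\<kappa> \<in> kinds" "u mod B s = to_nat \<kappa>"
        "posl s \<rho> t c \<kappa> (u div B s mod B s) (u div B s div B s)" using lit by blast
      then show ?thesis using dc(2,3) dc(4) \<open>\<alpha> u\<close> by metis
    next
      assume "literal negl s (code s (to_nat \<rho>) t c) u" "\<not> \<alpha> u"
      then obtain \<kappa> where "\<kappa> \<in> kinds" "u mod B s = to_nat \<kappa>"
        "negl s \<rho> t c \<kappa> (u div B s mod B s) (u div B s div B s)" using lit by blast
      then show ?thesis using dc(2,3) dc(4) \<open>\<not> \<alpha> u\<close> by metis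
    qed
  qed
  then show "\<exists>A. clauses_hold s A" by blast
next
  assume "\<exists>A. clauses_hold s A"
  then obtain A where A: "clauses_hold s A" by blast
  define \<alpha> where "\<alpha> u \<longleftrightarrow> (\<exists>\<kappa>\<in>kinds. u mod B s = to_nat \<kappa> \<and> A \<kappa> (u div B s mod B s) (u div B s div B s))" for u
  have "\<exists>u<vars s. literal posl s j u \<and> \<alpha> u \<or> literal negl s j u \<and> \<not> \<alpha> u" if j: "j < vars s" for j
  proof (cases "\<exists>\<rho>\<in>rules. j mod B s = to_nat \<rho> \<and> guard s \<rho> (j div B s mod B s) (j div B s div B s)")
    case False
    then have "literal posl s j 0" "literal negl s j 0" unfolding literal_def by (simp_all only: if_False)
    moreover have "0 < vars s" by (simp add: vars_def B_def)
    ultimately show ?thesis by blast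
  next
    case True
    let ?t = "j div B s mod B s" let ?c = "j div B s div B s"
    obtain \<rho> where \<rho>: "\<rho> \<in> rules" "j mod B s = to_nat \<rho>" "guard s \<rho> ?t ?c"
      using True by blast
    obtain \<kappa> t' c' where *: "\<kappa> \<in> kinds" "t' < B s" "c' < B s"
      "posl s \<rho> ?t ?c \<kappa> t' c' \<and> A \<kappa> t' c' \<or> negl s \<rho> ?t ?c \<kappa> t' c' \<and> \<not> A \<kappa> t' c'"
      using A \<rho> decode(2,3)[OF j] unfolding clauses_hold_def by metis
    have "to_nat \<kappa> < B s" using to_nat_less(2)[OF *(1)] by (simp add: B_def)
    note cd = code[OF this *(2,3)]
    have \<alpha>: "\<alpha> (code s (to_nat \<kappa>) t' c') \<longleftrightarrow> A \<kappa> t' c'"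
      unfolding \<alpha>_def cd using *(1) by auto
    have "literal L s j (code s (to_nat \<kappa>) t' c')" if "L s \<rho> ?t ?c \<kappa> t' c'" for L
      unfolding literal_def cd using True \<rho> *(1) that by auto
    then show ?thesis using *(4) \<alpha> cd(1) by blast
  qed
  then show "satisfiable (vars s) (literal posl s) (literal negl s)"
    unfolding satisfiable_def by blast
qed

text \<open>The guard of \<open>Blank\<close> fails at cell \<open>T s\<close>, so this code is one
  of the tautologies and contains variable 0.\<close>

lemma literal_nonempty: "\<exists>j<vars s. \<exists>u<vars s. literal posl s j u \<or> literal negl s j u"
proof -
  have "to_nat Blank < C" by (rule to_nat_less(1)) (simp add: rules_def)
  then have "to_nat Blank < B s" "0 < B s" "T s < B s" by (simp_all add: B_def)
  note cd = code[OF this]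
  have "literal posl s (code s (to_nat Blank) 0 (T s)) 0"
    unfolding literal_def cd by auto
  moreover have "0 < vars s" by (simp add: vars_def B_def)
  ultimately show ?thesis using cd(1) by blast
qed

end

section \<open>Configurations seen from their heads, and their agreement with the clauses\<close>

context verifier begin

text \<open>Keeping the state and all symbols in range guarantees that some row of the finite table
  applies.\<close>

definition vconf :: "config \<Rightarrow> bool" where
  "vconf c \<longleftrightarrow> fst c < num_states M \<and> length (snd c) = k \<and> (\<forall>j<k. \<forall>d. rel c j d < num_syms M)"

definition heads :: "config \<Rightarrow> nat list" where
  "heads c = map (\<lambda>j. rel c j 0) [0..<k]"

lemma rel_init:
  "rel (init_config M s) 0 d = contents s d"
  "0 < j \<Longrightarrow> j < k \<Longrightarrow> rel (init_config M s) j d = 0"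
  by (auto simp: rel_def init_config_def nth_Cons' contents_def)

lemma contents_syms: "contents (syms x) d \<le> 2"
  by (auto simp: contents_def syms_def)

lemma contents_beyond: "int (length u) \<le> d \<Longrightarrow> contents (syms u) d = 0"
  by (simp add: contents_def syms_def)

lemma vconf_init: "vconf (init_config M (verifier_input x u))"
proof -
  have k: "k \<ge> 2" "num_syms M \<ge> 4" "start M < num_states M" using wf by (auto simp: wf_tm_def)
  have "contents (verifier_input x u) d < num_syms M" for d
    using contents_syms[of x d] contents_syms[of u "d - int (length x) - 1"] k(2)
    by (auto simp: contents_verifier_input)
  then have "rel (init_config M (verifier_input x u)) j d < num_syms M" if "j < k" for j d
    using that k rel_init by (cases j) auto
  then show ?thesis using k by (auto simp: vconf_def init_config_def)
qed

lemma vconf_row: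
  assumes "vconf c"
  obtains i where "i < length rows" "rows ! i = (fst c, heads c)"
proof -
  have "(fst c, heads c) \<in> set rows"
    using assms unfolding set_rows by (auto simp: row_set_def vconf_def heads_def)
  then show thesis using that by (auto simp: in_set_conv_nth)
qed

lemma delta_bounds:
  assumes "q < num_states M" "set ss \<subseteq> {..<num_syms M}" "length ss = k"
  shows "fst (delta q ss) < num_states M" "length (snd (delta q ss)) = k"
    "j < k \<Longrightarrow> fst (snd (delta q ss) ! j) < num_syms M"
proof -
  have *: "fst (trans M q ss) < num_states M \<and> length (snd (trans M q ss)) = k \<and>
      fst ` set (snd (trans M q ss)) \<subseteq> {..<num_syms M}"
    using wf assms unfolding wf_tm_def by (fastforce split: prod.splits)
  then show "fst (delta q ss) < num_states M" "length (snd (delta q ss)) = k"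
    using assms by (auto simp: delta_def)
  show "fst (snd (delta q ss) ! j) < num_syms M" if "j < k"
  proof (cases "q = accept M \<or> q = reject M")
    case True
    moreover have "ss ! j \<in> {..<num_syms M}" using assms(2,3) that nth_mem by (metis subsetD)
    ultimately show ?thesis using assms that by (auto simp: delta_def)
  next
    case False
    have "snd (trans M q ss) ! j \<in> set (snd (trans M q ss))" using * that by simp
    then have "fst (snd (trans M q ss) ! j) \<in> {..<num_syms M}" using * by blast
    then show ?thesis using False by (simp add: delta_def)
  qed
qed

text \<open>What lies at distance \<open>d\<close> after the move was at distance
  \<open>d + offset mv\<close> before it, and only the cell at former distance 0 has been
  overwritten.\<close>

lemma step_rel:
  assumes "vconf c"
  shows "fst (step M c) = fst (delta (fst c) (heads c))"
    "j < k \<Longrightarrow> rel (step M c) j d =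
      (let (a, mv) = snd (delta (fst c) (heads c)) ! j
       in if d + offset mv = 0 then a else rel c j (d + offset mv))"
    "vconf (step M c)"
proof -
  let ?q = "fst c" and ?ss = "heads c"
  have len: "length (snd c) = k" and q: "?q < num_states M" using assms by (auto simp: vconf_def)
  have ss: "set ?ss \<subseteq> {..<num_syms M}" "length ?ss = k"
    using assms by (auto simp: heads_def vconf_def)
  note db = delta_bounds[OF q ss]
  have heads: "map read_tape (snd c) = ?ss"
  proof (rule nth_equalityI)
    fix j assume "j < length (map read_tape (snd c))"
    then show "map read_tape (snd c) ! j = ?ss ! j"
      using len by (cases "snd c ! j") (auto simp: heads_def rel_def)
  qed (use ss len in simp)
  show fst: "fst (step M c) = fst (delta ?q ?ss)"
    by (auto simp: step_def delta_def halted_def heads split: prod.splits)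
  have rel: "rel (step M c) j d = (let (a, mv) = snd (delta ?q ?ss) ! j
       in if d + offset mv = 0 then a else rel c j (d + offset mv))" if j: "j < k" for j d
  proof (cases "halted M c")
    case True
    then show ?thesis using j by (auto simp: step_def delta_def halted_def heads_def)
  next
    case False
    then have "snd (step M c) = map2 act (snd (delta ?q ?ss)) (snd c)"
      by (auto simp: step_def delta_def halted_def heads split: prod.splits)
    then have "snd (step M c) ! j = act (snd (delta ?q ?ss) ! j) (snd c ! j)"
      using j len db(2) by simp
    then show ?thesis
      by (cases "snd (delta ?q ?ss) ! j"; cases "snd c ! j") (auto simp: rel_def algebra_simps)
  qed
  then show "j < k \<Longrightarrow> rel (step M c) j d =
      (let (a, mv) = snd (delta ?q ?ss) ! j
       in if d + offset mv = 0 then a else rel c j (d + offset mv))" .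
  have "length (snd (step M c)) = k"
    using len db(2) by (auto simp: step_def delta_def halted_def heads split: prod.splits)
  moreover have "rel (step M c) j d < num_syms M" if "j < k" for j d
    using rel[OF that, of d] db(3)[OF that] assms that
    by (auto simp: vconf_def split: prod.splits)
  ultimately show "vconf (step M c)" using db(1) fst by (auto simp: vconf_def)
qed

lemma vconf_run: "vconf (run M (verifier_input x u) t)"
  by (induction t) (simp_all add: run_def vconf_init step_rel(3))

lemma run_Suc: "run M s (Suc t) = step M (run M s t)"
  by (simp add: run_def)

lemma rows_bounds:
  assumes "i < length rows"
  shows "fst (rows ! i) < num_states M" "length (snd (rows ! i)) = k"
    "j < k \<Longrightarrow> snd (rows ! i) ! j < num_syms M"
    "fst (out i) < num_states M" "j < k \<Longrightarrow> fst (snd (out i) ! j) < num_syms M"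
proof -
  have "rows ! i \<in> row_set" using assms set_rows nth_mem by blast
  then have *: "fst (rows ! i) < num_states M" "set (snd (rows ! i)) \<subseteq> {..<num_syms M}" "length (snd (rows ! i)) = k"
    by (auto simp: row_set_def)
  then show "fst (rows ! i) < num_states M" "length (snd (rows ! i)) = k"
    "fst (out i) < num_states M" "j < k \<Longrightarrow> fst (snd (out i) ! j) < num_syms M"
    using delta_bounds[OF *] by (auto simp: out_def)
  show "j < k \<Longrightarrow> snd (rows ! i) ! j < num_syms M"
    using * by (metis lessThan_iff nth_mem subsetD)
qed

lemma B_bounds: "T s < B s" "0 < B s" "c \<le> 2 * T s \<Longrightarrow> c < B s" "c \<le> T s + length s + m s \<Longrightarrow> c < B s" "t < T s \<Longrightarrow> Suc t < B s"
  "c \<le> Suc (T s) \<Longrightarrow> c < B s"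
  by (simp_all add: B_def)

text \<open>Facts are read off from the actual run. \<open>Choice\<close> and \<open>Suffix\<close>
  hold because the certificate is a string of bits followed by blanks only.\<close>

lemma clauses_of_run:
  assumes u: "length u \<le> m (syms x)"
    and acc: "fst (run M (verifier_input x u) (T (syms x))) = accept M"
  shows "\<exists>A. clauses_hold (syms x) A"
proof -
  let ?s = "syms x"
  have n: "length ?s = length x" by (simp add: syms_def)
  define cf where "cf t = run M (verifier_input x u) t" for t
  have v: "vconf (cf t)" for t unfolding cf_def by (rule vconf_run)
  have cf_Suc: "cf (Suc t) = step M (cf t)" for t by (simp add: cf_def run_Suc)
  have cf0: "cf 0 = init_config M (verifier_input x u)" by (simp add: cf_def run_def)
  have k2: "k \<ge> 2" "num_syms M \<ge> 4" "start M < num_states M" using wf by (auto simp: wf_tm_def)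
  define A where "A \<kappa> t c = (case \<kappa> of QK q \<Rightarrow> fst (cf t) = q | AK i \<Rightarrow> rows ! i = (fst (cf t), heads (cf t))
     | SK j a \<Rightarrow> rel (cf t) j (int c - int (T ?s)) = a)" for \<kappa> t and c :: nat
  have "clauses_hold ?s A"
    unfolding clauses_hold_def
  proof (intro ballI allI impI)
    fix \<rho> t c assume \<rho>: "\<rho> \<in> rules" and t: "t < B ?s" and c: "c < B ?s" and g: "guard ?s \<rho> t c"
    let ?thesis = "\<exists>\<kappa>\<in>kinds. \<exists>t'<B ?s. \<exists>c'<B ?s. posl ?s \<rho> t c \<kappa> t' c' \<and> A \<kappa> t' c' \<or> negl ?s \<rho> t c \<kappa> t' c' \<and> \<not> A \<kappa> t' c'"
    have P: ?thesis if "\<kappa> \<in> kinds" "t' < B ?s" "c' < B ?s" "posl ?s \<rho> t c \<kappa> t' c'" "A \<kappa> t' c'" for \<kappa> t' c'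
      using that by blast
    have N: ?thesis if "\<kappa> \<in> kinds" "t' < B ?s" "c' < B ?s" "negl ?s \<rho> t c \<kappa> t' c'" "\<not> A \<kappa> t' c'" for \<kappa> t' c'
      using that by blast
    have QK: "q < num_states M \<Longrightarrow> QK q \<in> kinds" and AK: "i < length rows \<Longrightarrow> AK i \<in> kinds"
      and SK: "j < k \<Longrightarrow> a < num_syms M \<Longrightarrow> SK j a \<in> kinds" for q i j a
        by (auto simp: kinds_def)
    have nxt: "fst (cf (Suc t)) = fst (out i)"
      "j < k \<Longrightarrow> rel (cf (Suc t)) j d = (if d + offset (snd (snd (out i) ! j)) = 0 then fst (snd (out i) ! j)
         else rel (cf t) j (d + offset (snd (snd (out i) ! j))))"
      if "rows ! i = (fst (cf t), heads (cf t))" for i j d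
      using step_rel(1)[OF v[of t]] step_rel(2)[OF v[of t], of j d] that
        by (simp_all add: cf_Suc out_def case_prod_beta)
    have rel0: "rel (cf 0) 0 d = contents (verifier_input x u) d" for d by (simp add: cf0 rel_init)
    \<comment> \<open>A right move shifts the content to \<open>e - 1\<close>, which needs
      \<open>0 < e\<close>.\<close>
    have sh: "\<exists>c'. shifted mv e c' \<and> c' \<le> Suc e" if "0 < e" for mv e
      using that by (cases mv) (auto simp: shifted_def intro: exI[of _ "e - 1"])
    have SA: "A (SK j a) t' c' \<longleftrightarrow> rel (cf t') j (int c' - int (T ?s)) = a" for j a t' c' by (simp add: A_def)
    have AA: "A (AK i) t' c' \<longleftrightarrow> rows ! i = (fst (cf t'), heads (cf t'))" for i t' c'
      by (simp add: A_def)
    have QA: "A (QK q) t' c' \<longleftrightarrow> fst (cf t') = q" for q t' c' by (simp add: A_def)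
    show ?thesis
    proof (cases \<rho>)
      case (Row i)
      then have i: "i < length rows" using \<rho> by (auto simp: rules_def)
      consider "A (QK (fst (rows ! i))) t 0 = False" | j where "j < k" "A (SK j (snd (rows ! i) ! j)) t (T ?s) = False"
        | "fst (cf t) = fst (rows ! i)" "\<forall>j<k. rel (cf t) j 0 = snd (rows ! i) ! j"
        by (auto simp: A_def)
      then show ?thesis
      proof cases
        case 1
        then show ?thesis
          using i Row t by (intro N[of "QK (fst (rows ! i))" t 0] QK rows_bounds) (auto simp: B_bounds)
      next
        case (2 j)
        then show ?thesis using i Row t
          by (intro N[of "SK j (snd (rows ! i) ! j)" t "T ?s"] SK rows_bounds) (auto simp: B_bounds)
      next
        case 3
        then have "snd (rows ! i) = heads (cf t)"
          using rows_bounds(2)[OF i] by (intro nth_equalityI) (auto simp: heads_def)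
        then have "A (AK i) t 0" using 3 by (simp add: AA prod_eq_iff)
        then show ?thesis using i Row t by (intro P[of "AK i" t 0] AK) (auto simp: B_bounds)
      qed
    next
      case (State i)
      then have i: "i < length rows" using \<rho> by (auto simp: rules_def)
      show ?thesis
      proof (cases "A (AK i) t 0")
        case True
        then show ?thesis using i State g nxt(1)[of i]
          by (intro P[of "QK (fst (out i))" "Suc t" 0] QK rows_bounds) (auto simp: B_bounds QA AA)
      qed (use i State t N[of "AK i" t 0] AK in \<open>auto simp: B_bounds\<close>)
    next
      case (Write i j)
      then have i: "i < length rows" "j < k" using \<rho> by (auto simp: rules_def)
      show ?thesis
      proof (cases "A (AK i) t 0")
        case True
        obtain c' where c': "shifted (snd (snd (out i) ! j)) (T ?s) c'" "c' \<le> Suc (T ?s)"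
          using sh[of "T ?s"] g Write by auto
        have "A (SK j (fst (snd (out i) ! j))) (Suc t) c'"
          using nxt(2)[of i j] True i c'(1) unfolding SA AA shifted_iff by simp
        then show ?thesis using i Write g c'
          by (intro P[of "SK j (fst (snd (out i) ! j))" "Suc t" c'] SK rows_bounds) (auto simp: B_bounds)
      qed (use i Write t N[of "AK i" t 0] AK in \<open>auto simp: B_bounds\<close>)
    next
      case (Move i j a)
      then have i: "i < length rows" "j < k" "a < num_syms M" using \<rho> by (auto simp: rules_def)
      consider "\<not> A (AK i) t 0" | "\<not> A (SK j a) t c" | "A (AK i) t 0" "A (SK j a) t c" by blast
      then show ?thesis
      proof cases
        case 1
        then show ?thesis using i Move t by (intro N[of "AK i" t 0] AK) (auto simp: B_bounds)
      next
        case 2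
        then show ?thesis using i Move t c by (intro N[of "SK j a" t c] SK) auto
      next
        case 3
        have g': "t < T ?s" "c \<noteq> T ?s" "0 < c" "c < 2 * T ?s" using g Move by auto
        obtain c' where c': "shifted (snd (snd (out i) ! j)) c c'" "c' \<le> Suc c"
          using sh[OF g'(3)] by blast
        have d: "int c' - int (T ?s) + offset (snd (snd (out i) ! j)) = int c - int (T ?s)"
          using c'(1) unfolding shifted_iff by simp
        then have "A (SK j a) (Suc t) c'"
          using nxt(2)[of i j "int c' - int (T ?s)", unfolded d] 3 i g' unfolding SA AA by simp
        then show ?thesis using i Move g' c' B_bounds(3)[of c' ?s]
          by (intro P[of "SK j a" "Suc t" c'] SK) (auto simp: B_bounds)
      qed
    next
      case InitQ
      then show ?thesis using k2
        by (intro P[of "QK (start M)" 0 0] QK) (auto simp: B_bounds QA cf0 init_config_def)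
    next
      case (Work j)
      then have "0 < j" "j < k" using \<rho> by (auto simp: rules_def)
      then show ?thesis using k2 Work c
        by (intro P[of "SK j 0" 0 c] SK) (auto simp: B_bounds SA cf0 rel_init)
    next
      case Blank
      then have "contents (verifier_input x u) (int c - int (T ?s)) = 0"
        using g u n by (auto simp: contents_verifier_input contents_beyond)
      then show ?thesis using k2 Blank c
        by (intro P[of "SK 0 0" 0 c] SK) (auto simp: B_bounds SA rel0)
    next
      case Symbol
      then have c': "T ?s \<le> c" "c - T ?s < length x" using g n by auto
      then have "int c - int (T ?s) < int (length x)" by linarith
      then have e: "contents (verifier_input x u) (int c - int (T ?s)) = contents ?s (int (c - T ?s))"
        using c' by (simp add: contents_verifier_input of_nat_diff)
      have "contents ?s (int (c - T ?s)) = 1 \<or> contents ?s (int (c - T ?s)) = 2"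
        using c'(2) by (auto simp: contents_def syms_def)
      then show ?thesis
      proof
        assume "contents ?s (int (c - T ?s)) = 1"
        then show ?thesis using k2 Symbol c e
          by (intro P[of "SK 0 1" 0 c] SK) (auto simp: B_bounds SA rel0)
      next
        assume "contents ?s (int (c - T ?s)) = 2"
        then show ?thesis using k2 Symbol c e
          by (intro P[of "SK 0 2" 0 c] SK) (auto simp: B_bounds SA rel0)
      qed
    next
      case Separator
      then have "contents (verifier_input x u) (int c - int (T ?s)) = 3"
        using g n by (auto simp: contents_verifier_input)
      then show ?thesis using k2 Separator c
        by (intro P[of "SK 0 3" 0 c] SK) (auto simp: B_bounds SA rel0)
    next
      case Choice
      let ?a = "contents (verifier_input x u) (int c - int (T ?s))"
      have "?a = contents (syms u) (int c - int (T ?s) - int (length x) - 1)"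
        using Choice g n by (auto simp: contents_verifier_input)
      then have a: "?a = 0 \<or> ?a = 1 \<or> ?a = 2"
        using contents_syms by (metis One_nat_def le_SucE le_zero_eq numeral_2_eq_2)
      then have "SK 0 ?a \<in> {SK 0 0, SK 0 1, SK 0 2}" "?a < num_syms M" using k2 by auto
      then show ?thesis using k2 Choice c
        by (intro P[of "SK 0 ?a" 0 c] SK) (auto simp: B_bounds SA rel0)
    next
      case Suffix
      show ?thesis
      proof (cases "A (SK 0 0) 0 c")
        case True
        let ?d = "int c - int (T ?s) - int (length x) - 1"
        have c': "T ?s + length x < c" "c < T ?s + length x + m ?s" using g n Suffix by auto
        then have "contents (syms u) ?d = 0" using True by (auto simp: SA rel0 contents_verifier_input)
        moreover have "?d \<ge> 0" using c' by simp
        ultimately have "?d \<ge> int (length u)" by (auto simp: contents_def syms_def split: if_splits)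
        then have "A (SK 0 0) 0 (Suc c)"
          using c' unfolding SA rel0 by (auto simp: contents_verifier_input contents_beyond)
        then show ?thesis using k2 Suffix c' n by (intro P[of "SK 0 0" 0 "Suc c"] SK) (auto simp: B_bounds)
      next
        case False
        then show ?thesis using k2 Suffix c by (intro N[of "SK 0 0" 0 c] SK) (auto simp: B_bounds)
      qed
    next
      case (Final q)
      then have "q < num_states M" "q \<noteq> accept M" using \<rho> by (auto simp: rules_def)
      then show ?thesis using Final acc
        by (intro N[of "QK q" "T ?s" 0] QK) (auto simp: B_bounds QA cf_def)
    qed
  qed
  then show ?thesis by blast
qed

text \<open>The certificate is extracted from the open cells, and the facts of the run on it are
  derived forwards in time. Further facts may be true as well, but this is harmless: the state
  reached at time \<open>T\<close> is among the true facts, and \<open>Final\<close> leaves only the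
  accepting state.\<close>

lemma run_of_clauses:
  assumes A: "clauses_hold (syms x) A"
  shows "\<exists>u. length u \<le> m (syms x) \<and> fst (run M (verifier_input x u) (T (syms x))) = accept M"
proof -
  let ?s = "syms x" let ?T = "T ?s" let ?n = "length x" let ?m = "m ?s"
  have n: "length ?s = ?n" by (simp add: syms_def)
  have k2: "k \<ge> 2" "num_syms M \<ge> 4" "start M < num_states M" using wf by (auto simp: wf_tm_def)
  have D: "\<exists>\<kappa>\<in>kinds. \<exists>t'<B ?s. \<exists>c'<B ?s. posl ?s \<rho> t c \<kappa> t' c' \<and> A \<kappa> t' c'"
    if "\<rho> \<in> rules" "t < B ?s" "c < B ?s" "guard ?s \<rho> t c" "\<And>\<kappa> t' c'. negl ?s \<rho> t c \<kappa> t' c' \<Longrightarrow> A \<kappa> t' c'" for \<rho> t c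
    using A that unfolding clauses_hold_def by blast
  have simple_rules: "InitQ \<in> rules" "Blank \<in> rules" "Symbol \<in> rules" "Separator \<in> rules" "Choice \<in> rules" "Suffix \<in> rules"
    by (auto simp: rules_def)
  define cell where "cell i = ?T + ?n + 1 + i" for i
  \<comment> \<open>The first blank among the open cells ends the certificate; by
    \<open>Suffix\<close> all later open cells are blank too.\<close>
  define L where "L = (LEAST i. i = ?m \<or> A (SK 0 0) 0 (cell i))"
  have L: "L = ?m \<or> A (SK 0 0) 0 (cell L)" unfolding L_def by (rule LeastI[of _ ?m]) simp
  have Lm: "L \<le> ?m" unfolding L_def by (rule Least_le) simp
  have notL: "i \<noteq> ?m \<and> \<not> A (SK 0 0) 0 (cell i)" if "i < L" for i
    using not_less_Least[of i "\<lambda>i. i = ?m \<or> A (SK 0 0) 0 (cell i)"] that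
      unfolding L_def by blast
  \<comment> \<open>Where both symbols 1 and 2 are claimed, 2 is taken. Before \<open>L\<close> the
    blank is excluded, so a cell without 2 has 1.\<close>
  define u where "u = map (\<lambda>i. A (SK 0 2) 0 (cell i)) [0..<L]"
  have lu: "length u = L" by (simp add: u_def)
  have blank: "A (SK 0 0) 0 (cell i)" if "L \<le> i" "i < ?m" for i
    using that
  proof (induction rule: dec_induct)
    case base
    then show ?case using L by simp
  next
    case (step i)
    then have "A (SK 0 0) 0 (cell i)" by simp
    then show ?case using D[of Suffix 0 "cell i"] simple_rules step n B_bounds(4)[of "cell i" ?s]
      by (auto simp: cell_def B_bounds)
  qed
  have cert: "A (SK 0 (contents (syms u) (int i))) 0 (cell i)" if "i < ?m" for i
  proof (cases "i < L")
    case True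
    have "A (SK 0 0) 0 (cell i) \<or> A (SK 0 1) 0 (cell i) \<or> A (SK 0 2) 0 (cell i)"
      using D[of Choice 0 "cell i"] simple_rules that n B_bounds(4)[of "cell i" ?s]
        by (auto simp: cell_def B_bounds)
    then show ?thesis using notL[OF True] True lu by (auto simp: contents_def syms_def u_def)
  next
    case False
    then show ?thesis using blank[of i] that lu by (simp add: contents_def syms_def)
  qed
  define cf where "cf t = run M (verifier_input x u) t" for t
  have v: "vconf (cf t)" for t unfolding cf_def by (rule vconf_run)
  have cf_Suc: "cf (Suc t) = step M (cf t)" for t by (simp add: cf_def run_Suc)
  have cf0: "cf 0 = init_config M (verifier_input x u)" by (simp add: cf_def run_def)
  have init0: "A (SK 0 (contents (verifier_input x u) (int c - int ?T))) 0 c" if c: "c < 2 * ?T" for c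
  proof -
    have cB: "c < B ?s" using c by (simp add: B_bounds)
    consider "c < ?T" | "?T \<le> c" "c < ?T + ?n" | "c = ?T + ?n" | "?T + ?n < c" "c \<le> ?T + ?n + ?m"
      | "?T + ?n + ?m < c" by linarith
    then show ?thesis
    proof cases
      case 1
      then show ?thesis
        using D[of Blank 0 c] simple_rules cB by (auto simp: contents_verifier_input B_bounds)
    next
      case 2
      have "contents (verifier_input x u) (int c - int ?T) = contents ?s (int (c - ?T))"
        using 2 by (simp add: contents_verifier_input of_nat_diff)
      then show ?thesis using D[of Symbol 0 c] simple_rules cB 2 n by (auto simp: B_bounds)
    next
      case 3
      then show ?thesis
        using D[of Separator 0 c] simple_rules cB n by (auto simp: contents_verifier_input B_bounds)
    next
      case 4
      define i where "i = c - ?T - ?n - 1"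
      then have "c = cell i" "i < ?m" using 4 by (auto simp: cell_def)
      then show ?thesis using cert[of i] by (simp add: contents_verifier_input cell_def)
    next
      case 5
      then have "contents (syms u) (int c - int ?T - int ?n - 1) = 0"
        using Lm lu by (auto simp: contents_def syms_def)
      then show ?thesis
        using D[of Blank 0 c] simple_rules cB 5 n by (auto simp: contents_verifier_input B_bounds)
    qed
  qed
  \<comment> \<open>The window of known cells loses one cell on either side per step, as a move can
    shift unknown content in. It is centred at \<open>T\<close> and contains the scanned cell as
    long as \<open>t < T\<close>.\<close>
  have inv: "A (QK (fst (cf t))) t 0 \<and>
     (\<forall>j<k. \<forall>c. t < c \<and> c + t < 2 * ?T \<longrightarrow> A (SK j (rel (cf t) j (int c - int ?T))) t c)" if "t \<le> ?T" for t
    using that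
  proof (induction t)
    case 0
    have "A (QK (fst (cf 0))) 0 0"
      using D[of InitQ 0 0] simple_rules by (auto simp: cf0 init_config_def B_bounds)
    moreover have "A (SK j (rel (cf 0) j (int c - int ?T))) 0 c" if "j < k" "c < 2 * ?T" for j c
    proof (cases "j = 0")
      case True
      then show ?thesis using init0[OF that(2)] by (simp add: cf0 rel_init)
    next
      case False
      then have "Work j \<in> rules" using that by (auto simp: rules_def)
      then show ?thesis using D[of "Work j" 0 c] that False by (auto simp: cf0 rel_init B_bounds)
    qed
    ultimately show ?case by simp
  next
    case (Suc t)
    then have tT: "t < ?T" and IH: "A (QK (fst (cf t))) t 0"
      "\<And>j c. j < k \<Longrightarrow> t < c \<Longrightarrow> c + t < 2 * ?T \<Longrightarrow> A (SK j (rel (cf t) j (int c - int ?T))) t c" by auto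
    have tB: "t < B ?s" using tT by (simp add: B_def)
    obtain i where i: "i < length rows" "rows ! i = (fst (cf t), heads (cf t))"
      by (rule vconf_row[OF v[of t]])
    have nxt: "fst (cf (Suc t)) = fst (out i)"
      "j < k \<Longrightarrow> rel (cf (Suc t)) j d = (if d + offset (snd (snd (out i) ! j)) = 0 then fst (snd (out i) ! j)
         else rel (cf t) j (d + offset (snd (snd (out i) ! j))))" for j d
      using step_rel(1)[OF v[of t]] step_rel(2)[OF v[of t], of j d] i
        by (simp_all add: cf_Suc out_def case_prod_beta)
    have R: "Row i \<in> rules" "State i \<in> rules" "j < k \<Longrightarrow> Write i j \<in> rules"
      "j < k \<Longrightarrow> a < num_syms M \<Longrightarrow> Move i j a \<in> rules" for j a
      using i by (auto simp: rules_def image_iff)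
    have "A (AK i) t 0"
    proof -
      have hd: "A (SK j (heads (cf t) ! j)) t ?T" if "j < k" for j
        using IH(2)[OF that, of ?T] tT that by (simp add: heads_def)
      show ?thesis using D[OF R(1) tB, of 0] IH(1) hd i(2) by (auto simp: B_bounds)
    qed
    note row = this
    have "A (QK (fst (cf (Suc t)))) (Suc t) 0"
      using D[OF R(2) tB, of 0] row tT nxt(1) by (auto simp: B_bounds)
    moreover have "A (SK j (rel (cf (Suc t)) j (int c - int ?T))) (Suc t) c"
      if j: "j < k" and c: "Suc t < c" "c + Suc t < 2 * ?T" for j c
    proof -
      let ?mv = "snd (snd (out i) ! j)"
      \<comment> \<open>The cell that held, before the step, the position now numbered
        \<open>c\<close>.\<close>
      define c0 where "c0 = nat (int c + offset ?mv)"
      have off: "offset ?mv \<in> {-1, 0, 1}" by (cases ?mv) auto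
      have c0: "int c0 = int c + offset ?mv" using off c unfolding c0_def by auto
      then have c0': "t < c0" "c0 + t < 2 * ?T" using off c by auto
      have sh: "shifted ?mv c0 c' \<longleftrightarrow> c' = c" for c' using c0 by (auto simp: shifted_iff)
      have c0B: "c0 < B ?s" using c0' by (simp add: B_def)
      have d: "int c - int ?T + offset ?mv = int c0 - int ?T" using c0 by simp
      show ?thesis
      proof (cases "c0 = ?T")
        case True
        have "A (SK j (fst (snd (out i) ! j))) (Suc t) c"
          using D[OF R(3)[OF j] tB, of 0] row tT sh True by (auto simp: B_bounds)
        then show ?thesis using nxt(2)[OF j, of "int c - int ?T"] True d by simp
      next
        case False
        let ?a = "rel (cf t) j (int c0 - int ?T)"
        have "?a < num_syms M" using v[of t] j by (auto simp: vconf_def)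
        then have "A (SK j ?a) (Suc t) c"
          using D[OF R(4)[OF j] tB c0B, of ?a] row tT sh False c0' IH(2)[OF j c0'] by auto
        then show ?thesis using nxt(2)[OF j, of "int c - int ?T"] False d by simp
      qed
    qed
    ultimately show ?case by blast
  qed
  have "fst (cf ?T) = accept M"
  proof (rule ccontr)
    assume "fst (cf ?T) \<noteq> accept M"
    then have "Final (fst (cf ?T)) \<in> rules" using v[of ?T] by (auto simp: rules_def vconf_def)
    then show False using D[of "Final (fst (cf ?T))" 0 0] inv[of ?T] by (auto simp: B_bounds)
  qed
  then show ?thesis using Lm lu unfolding cf_def by blast
qed

end

theorem np_hard_gp4: "np_hard gp4_paired_domination"
  unfolding np_hard_def
proof
  fix K assume "K \<in> NP"
  then obtain M p r where wf: "wf_tm M"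
    and halt: "\<And>x u. halted M (run M (verifier_input x u) (poly r (length (verifier_input x u))))"
    and K: "\<And>x. x \<in> K \<longleftrightarrow> (\<exists>u. length u \<le> poly p (length x) \<and> (\<exists>t. fst (run M (verifier_input x u) t) = accept M))"
    unfolding NP_def by blast
  interpret verifier M p r by unfold_locales (rule wf)
  \<comment> \<open>Halting times depend on the length of the certificate, while the clauses inspect
    one time. Since \<open>r\<close> is monotone, all admissible runs have halted at
    \<open>T\<close>.\<close>
  have acc: "(\<exists>t. fst (run M (verifier_input x u) t) = accept M) \<longleftrightarrow>
      fst (run M (verifier_input x u) (T (syms x))) = accept M" if u: "length u \<le> poly p (length x)" for x u
  proof -
    have "length (verifier_input x u) \<le> length (syms x) + 1 + m (syms x)"
      using u by (simp add: verifier_input_def m_def syms_def)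
    then have "poly r (length (verifier_input x u)) \<le> T (syms x)"
      unfolding T_def by (rule poly_nat_mono)
    then have "halted M (run M (verifier_input x u) (T (syms x)))"
      using run_mono[OF halt] halt by metis
    then show ?thesis by (rule accepts_iff)
  qed
  have "x \<in> K \<longleftrightarrow> satisfiable (vars (syms x)) (literal posl (syms x)) (literal negl (syms x))" for x
  proof -
    have m: "m (syms x) = poly p (length x)" by (simp add: m_def syms_def)
    show ?thesis unfolding satisfiable_iff_clauses K
      using acc clauses_of_run[of _ x] run_of_clauses[of x] unfolding m by metis
  qed
  then show "polytime_reducible K gp4_paired_domination"
    by (intro reduce_sat[OF definable_params(4) pdefinable_literal literal_nonempty])
qed

section \<open>Certificates for GP4-graphs and paired dominating sets\<close>

lemma rtrancl_crossing:
  assumes "(a, b) \<in> R\<^sup>*" "a \<in> S" "b \<notin> S"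
  obtains c d where "(c, d) \<in> R" "c \<in> S" "d \<notin> S"
  using assms by (induction arbitrary: thesis rule: rtrancl_induct) blast+

text \<open>As long as a vertex is missing, a path to it from the first listed vertex leaves the
  listed set along some edge, whose far end is appended.\<close>

lemma connected_ordering:
  assumes con: "connected_graph V E"
  obtains e where "bij_betw e {..<card V} V" "\<And>i. i < card V \<Longrightarrow> 0 < i \<Longrightarrow> \<exists>j<i. {e i, e j} \<in> E"
proof -
  have fin: "finite V" and ne: "V \<noteq> {}" and simple: "\<And>e. e \<in> E \<Longrightarrow> e \<subseteq> V"
    and path: "\<And>u v. u \<in> V \<Longrightarrow> v \<in> V \<Longrightarrow> (u, v) \<in> {(a, b). {a, b} \<in> E}\<^sup>*"
    using con by (auto simp: connected_graph_def simple_graph_def)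
  define good where "good xs \<longleftrightarrow> distinct xs \<and> set xs \<subseteq> V \<and>
    (\<forall>i<length xs. 0 < i \<longrightarrow> (\<exists>j<i. {xs ! i, xs ! j} \<in> E))" for xs
  have "\<exists>xs. good xs \<and> length xs = n" if "1 \<le> n" "n \<le> card V" for n
    using that
  proof (induction n rule: dec_induct)
    case base
    obtain v where "v \<in> V" using ne by blast
    then show ?case by (intro exI[of _ "[v]"]) (simp add: good_def)
  next
    case (step n)
    then obtain xs where xs: "good xs" "length xs = n" by auto
    then have sub: "set xs \<subseteq> V" and "card (set xs) = n" by (auto simp: good_def distinct_card)
    then have "set xs \<noteq> V" using step by auto
    then obtain v where v: "v \<in> V" "v \<notin> set xs" using sub by blast
    have x0: "xs ! 0 \<in> set xs" using xs step by auto
    then have "(xs ! 0, v) \<in> {(a, b). {a, b} \<in> E}\<^sup>*" using path sub v by blast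
    then obtain c d where cd: "{c, d} \<in> E" "c \<in> set xs" "d \<notin> set xs"
      using rtrancl_crossing[OF _ x0 v(2)] by blast
    obtain j where j: "j < n" "xs ! j = c" using cd(2) xs(2) by (auto simp: in_set_conv_nth)
    have "good (xs @ [d])"
      unfolding good_def
    proof (intro conjI allI impI)
      show "distinct (xs @ [d])" "set (xs @ [d]) \<subseteq> V"
        using xs cd simple[OF cd(1)] by (auto simp: good_def)
      fix i assume i: "i < length (xs @ [d])" "0 < i"
      show "\<exists>j<i. {(xs @ [d]) ! i, (xs @ [d]) ! j} \<in> E"
      proof (cases "i = n")
        case True
        then show ?thesis using j cd(1) xs(2) by (intro exI[of _ j]) (simp add: nth_append insert_commute)
      next
        case False
        then have "i < length xs" using i xs(2) by simp
        then obtain j where "j < i" "{xs ! i, xs ! j} \<in> E" using xs(1) i(2) unfolding good_def by blast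
        then show ?thesis using \<open>i < length xs\<close> by (intro exI[of _ j]) (simp add: nth_append)
      qed
    qed
    then show ?case using xs(2) by (intro exI[of _ "xs @ [d]"]) simp
  qed
  moreover have "1 \<le> card V" using fin ne by (simp add: Suc_le_eq card_gt_0_iff)
  ultimately obtain xs where xs: "good xs" "length xs = card V" by blast
  have dist: "distinct xs" "set xs \<subseteq> V" using xs(1) unfolding good_def by blast+
  then have "set xs = V" using fin xs(2) by (intro card_subset_eq) (simp_all add: distinct_card)
  then have bij: "bij_betw (\<lambda>i. xs ! i) {..<card V} V"
    by (intro bij_betw_nth dist) (simp_all add: xs(2))
  have "\<forall>i<card V. 0 < i \<longrightarrow> (\<exists>j<i. {xs ! i, xs ! j} \<in> E)"
    using xs unfolding good_def by simp
  then show thesis using that[OF bij] by blast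
qed

text \<open>\<open>H\<close> need not be given: it consists of whatever edges run between multiples
  of five, where only the earlier neighbour is prescribed. All other pairs are adjacent exactly as
  in the paths.\<close>

definition numbering :: "nat \<Rightarrow> nat set set \<Rightarrow> (nat \<Rightarrow> nat) \<Rightarrow> bool" where
  "numbering n E \<sigma> \<longleftrightarrow> bij_betw \<sigma> {..<n} {..<n} \<and>
     (\<forall>i<n. \<forall>j<n. (chain i j \<longrightarrow> {\<sigma> i, \<sigma> j} \<in> E) \<and>
        ({\<sigma> i, \<sigma> j} \<in> E \<longrightarrow> chain i j \<or> 5 dvd i \<and> 5 dvd j)) \<and>
     (\<forall>i<n. 5 dvd i \<and> 0 < i \<longrightarrow> (\<exists>j<i. 5 dvd j \<and> {\<sigma> i, \<sigma> j} \<in> E))"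

lemma gp4_graph_if_numbering:
  assumes simple: "simple_graph {..<n} E" and n: "0 < n" "5 dvd n" and num: "numbering n E \<sigma>"
  shows "gp4_graph {..<n} E"
proof -
  define h where "h = n div 5"
  have nh: "n = 5 * h" "0 < h" using n by (auto simp: h_def)
  define H where "H a b \<longleftrightarrow> a < h \<and> b < h \<and> {\<sigma> (5 * a), \<sigma> (5 * b)} \<in> E" for a b
  have bij: "bij_betw \<sigma> {..<5 * h} {..<n}" using num nh by (simp add: numbering_def)
  have ch: "chain i j \<Longrightarrow> {\<sigma> i, \<sigma> j} \<in> E" "{\<sigma> i, \<sigma> j} \<in> E \<Longrightarrow> chain i j \<or> 5 dvd i \<and> 5 dvd j"
    if "i < n" "j < n" for i j using num that by (auto simp: numbering_def)
  have sym: "symp H" by (auto simp: symp_def H_def insert_commute)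
  have irr: "irreflp H" using simple by (auto simp: irreflp_def H_def simple_graph_def)
  let ?R = "{(a, b). {a, b} \<in> edges h H}"
  \<comment> \<open>Passing to earlier neighbours strictly decreases the index, so every vertex of
    \<open>H\<close> is linked to vertex 0.\<close>
  have root: "(a, 0) \<in> ?R\<^sup>*" if "a < h" for a
    using that
  proof (induction a rule: less_induct)
    case (less a)
    show ?case
    proof (cases "a = 0")
      case False
      then have "5 * a < n" "5 dvd 5 * a \<and> 0 < 5 * a" using less.prems nh by auto
      then obtain j where j: "j < 5 * a" "5 dvd j" "{\<sigma> (5 * a), \<sigma> j} \<in> E"
        using num unfolding numbering_def by blast
      then obtain b where "j = 5 * b" by (elim dvdE)
      then have b: "b < a" "H a b" using j less.prems by (auto simp: H_def)
      then have "(a, b) \<in> ?R" using edgesI[of a h b H] less.prems by simp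
      moreover have "(b, 0) \<in> ?R\<^sup>*" by (rule less.IH[OF b(1)]) (use b(1) less.prems in simp)
      ultimately show ?thesis by (rule converse_rtrancl_into_rtrancl)
    qed simp
  qed
  have "sym ?R" by (auto simp: sym_def insert_commute)
  then have "sym (?R\<^sup>*)" by (rule sym_rtrancl)
  then have root': "(0, a) \<in> ?R\<^sup>*" if "a < h" for a
    using root[OF that] by (rule symD)
  have con: "connected_graph {..<h} (edges h H)"
    unfolding connected_graph_def
  proof (intro conjI ballI)
    show "{..<h} \<noteq> {}" using nh by (simp add: lessThan_empty_iff)
    fix a b assume "a \<in> {..<h}" "b \<in> {..<h}"
    then show "(a, b) \<in> ?R\<^sup>*" using rtrancl_trans[OF root[of a] root'[of b]] by simp
  qed (rule simple_graph_edges[OF irr])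
  have "E = (`) \<sigma> ` edges (5 * h) (gp4_adj H)"
  proof (intro subset_antisym subsetI)
    fix e assume e: "e \<in> E"
    then have "e \<subseteq> {..<n}" "card e = 2" using simple by (auto simp: simple_graph_def)
    then obtain a b where ab: "e = {a, b}" "a < n" "b < n" by (auto simp: card_2_iff)
    have "\<sigma> ` {..<n} = {..<n}" using num by (auto simp: numbering_def bij_betw_def)
    then obtain i j where ij: "a = \<sigma> i" "b = \<sigma> j" "i < n" "j < n"
      using ab by (metis imageE lessThan_iff)
    have "gp4_adj H i j"
    proof (cases "chain i j")
      case False
      then have "5 dvd i" "5 dvd j" using ch(2)[OF ij(3,4)] e ab ij by auto
      then show ?thesis using e ab ij nh by (auto simp: gp4_adj_def H_def elim!: dvdE)
    qed (simp add: gp4_adj_def)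
    then have "{i, j} \<in> edges (5 * h) (gp4_adj H)" using ij nh by (intro edgesI) auto
    moreover have "e = \<sigma> ` {i, j}" using ab ij by simp
    ultimately show "e \<in> (`) \<sigma> ` edges (5 * h) (gp4_adj H)" by blast
  next
    fix e assume "e \<in> (`) \<sigma> ` edges (5 * h) (gp4_adj H)"
    then obtain i j where ij: "e = {\<sigma> i, \<sigma> j}" "i < n" "j < n" "gp4_adj H i j"
      using nh by (auto simp: edges_def)
    then show "e \<in> E" using ch(1)[OF ij(2,3)] by (auto simp: gp4_adj_def H_def)
  qed
  then show ?thesis using gp4_graphI[OF sym con bij] by simp
qed

text \<open>The vertices of \<open>H\<close> are taken in the order of
  \<open>connected_ordering\<close>, and each is followed by its pendant path.\<close>

lemma numbering_if_gp4_graph: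
  assumes "gp4_graph {..<n} E"
  obtains \<sigma> where "0 < n" "5 dvd n" "numbering n E \<sigma>"
proof -
  from assms obtain VH EH w x y z where con: "connected_graph VH EH"
    and inj: "inj_on w VH" "inj_on x VH" "inj_on y VH" "inj_on z VH"
    and dis: "disjnt VH (w ` VH)" "disjnt VH (x ` VH)" "disjnt VH (y ` VH)" "disjnt VH (z ` VH)"
      "disjnt (w ` VH) (x ` VH)" "disjnt (w ` VH) (y ` VH)" "disjnt (w ` VH) (z ` VH)"
      "disjnt (x ` VH) (y ` VH)" "disjnt (x ` VH) (z ` VH)" "disjnt (y ` VH) (z ` VH)"
    and V: "{..<n} = VH \<union> w ` VH \<union> x ` VH \<union> y ` VH \<union> z ` VH"
    and E: "E = EH \<union> (\<Union>v\<in>VH. {{v, w v}, {w v, x v}, {x v, y v}, {y v, z v}})"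
    unfolding gp4_graph_def by blast
  have EH: "e \<subseteq> VH" if "e \<in> EH" for e
    using con that by (auto simp: connected_graph_def simple_graph_def)
  define h where "h = card VH"
  obtain e where e: "bij_betw e {..<h} VH" "\<And>i. i < h \<Longrightarrow> 0 < i \<Longrightarrow> \<exists>j<i. {e i, e j} \<in> EH"
    unfolding h_def using connected_ordering[OF con] by blast
  have eV: "e i \<in> VH" if "i < h" for i using e(1) that by (auto simp: bij_betw_def)
  have einj: "e i = e j \<longleftrightarrow> i = j" if "i < h" "j < h" for i j
    using e(1) that by (auto simp: bij_betw_def inj_on_def)
  \<comment> \<open>Treating the four maps as one family condenses all injectivity and disjointness
    assumptions into \<open>a_eq\<close>.\<close>
  define a where "a t v = (if t = 0 then v else if t = 1 then w v else if t = 2 then x v else if t = 3 then y v else z v)" for t :: nat and v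
  have S: "a 0 ` VH = VH" "a 1 ` VH = w ` VH" "a 2 ` VH = x ` VH" "a 3 ` VH = y ` VH" "a 4 ` VH = z ` VH"
    by (simp_all add: a_def)
  have five: "t = 0 \<or> t = 1 \<or> t = 2 \<or> t = 3 \<or> t = 4" if "t < 5" for t :: nat
    using that by linarith
  have a_eq: "a t v = a t' v' \<longleftrightarrow> t = t' \<and> v = v'" if "t < 5" "t' < 5" "v \<in> VH" "v' \<in> VH" for t t' v v'
  proof
    assume eq: "a t v = a t' v'"
    have dj: "a t v \<noteq> a t' v'" if "t < t'" "t' < 5" "v \<in> VH" "v' \<in> VH" for t t' v v'
    proof -
      have "t = 0 \<and> t' \<in> {1, 2, 3, 4} \<or> t = 1 \<and> t' \<in> {2, 3, 4} \<or> t = 2 \<and> t' \<in> {3, 4} \<or> t = 3 \<and> t' = 4"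
        using that(1,2) by (auto simp: numeral_eq_Suc less_Suc_eq)
      then have "disjnt (a t ` VH) (a t' ` VH)"
        by (elim disjE conjE insertE emptyE; simp only: S dis)
      then show ?thesis using that(3,4) by (auto simp: disjnt_iff)
    qed
    have "t = t'" using dj[of t t' v v'] dj[of t' t v' v] that eq by (metis nat_neq_iff)
    moreover have "v = v'"
      using five[OF that(1)] eq that(3,4) inj unfolding \<open>t = t'\<close> a_def inj_on_def
      by (elim disjE) auto
    ultimately show "t = t' \<and> v = v'" by blast
  qed simp
  define \<sigma> where "\<sigma> i = a (i mod 5) (e (i div 5))" for i
  have img: "\<sigma> ` {..<5 * h} = {..<n}"
  proof (intro subset_antisym subsetI)
    fix b assume "b \<in> \<sigma> ` {..<5 * h}"
    then obtain i where i: "i < 5 * h" "b = a (i mod 5) (e (i div 5))" by (auto simp: \<sigma>_def)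
    then have "e (i div 5) \<in> VH" by (intro eV) auto
    then show "b \<in> {..<n}" unfolding V i(2) a_def by auto
  next
    fix b assume "b \<in> {..<n}"
    then obtain t v where tv: "t < 5" "v \<in> VH" "b = a t v"
    proof -
      have "b \<in> VH \<or> b \<in> w ` VH \<or> b \<in> x ` VH \<or> b \<in> y ` VH \<or> b \<in> z ` VH"
        using \<open>b \<in> {..<n}\<close> V by auto
      then show thesis
        using that[of 0] that[of 1] that[of 2] that[of 3] that[of 4] by (auto simp: a_def)
    qed
    obtain i where i: "i < h" "v = e i" using e(1) tv(2) by (auto simp: bij_betw_def)
    then have "b = \<sigma> (5 * i + t)" "5 * i + t < 5 * h" using tv by (auto simp: \<sigma>_def)
    then show "b \<in> \<sigma> ` {..<5 * h}" by blast
  qed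
  have \<sigma>_eq: "\<sigma> i = \<sigma> j \<longleftrightarrow> i = j" if "i < 5 * h" "j < 5 * h" for i j
  proof
    assume "\<sigma> i = \<sigma> j"
    then have "i mod 5 = j mod 5 \<and> e (i div 5) = e (j div 5)"
      using that unfolding \<sigma>_def by (subst (asm) a_eq) (auto intro!: eV)
    moreover from this have "i div 5 = j div 5" using that by (subst (asm) einj) auto
    ultimately show "i = j" by (metis mult_div_mod_eq)
  qed simp
  have inj\<sigma>: "inj_on \<sigma> {..<5 * h}" using \<sigma>_eq by (auto simp: inj_on_def)
  then have "card {..<n} = 5 * h" using card_image[OF inj\<sigma>] img by simp
  then have nh: "n = 5 * h" by simp
  have h0: "0 < h"
    using con unfolding h_def connected_graph_def simple_graph_def by (simp add: card_gt_0_iff)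
  have \<sigma>5: "\<sigma> (5 * i) = e i" "\<sigma> (5 * i + 1) = w (e i)" "\<sigma> (5 * i + 2) = x (e i)" "\<sigma> (5 * i + 3) = y (e i)"
    "\<sigma> (5 * i + 4) = z (e i)" for i unfolding \<sigma>_def five_mod by (simp_all add: a_def)
  have EE: "{\<sigma> (5 * q), \<sigma> (5 * q + 1)} \<in> E" "{\<sigma> (5 * q + 1), \<sigma> (5 * q + 2)} \<in> E"
    "{\<sigma> (5 * q + 2), \<sigma> (5 * q + 3)} \<in> E" "{\<sigma> (5 * q + 3), \<sigma> (5 * q + 4)} \<in> E" if "q < h" for q
    unfolding \<sigma>5 E using eV[OF that] by blast+
  have chainE: "{\<sigma> i, \<sigma> (Suc i)} \<in> E" if i: "i < n" "Suc i div 5 = i div 5" for i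
  proof (cases i rule: mod5_cases)
    case (1 q)
    then have "Suc i = 5 * q + 1" "q < h" using i(1) nh by simp_all
    then show ?thesis using EE(1)[of q] 1 by (simp only:)
  next
    case (2 q)
    then have "Suc i = 5 * q + 2" "q < h" using i(1) nh by simp_all
    then show ?thesis using EE(2)[of q] 2 by (simp only:)
  next
    case (3 q)
    then have "Suc i = 5 * q + 3" "q < h" using i(1) nh by simp_all
    then show ?thesis using EE(3)[of q] 3 by (simp only:)
  next
    case (4 q)
    then have "Suc i = 5 * q + 4" "q < h" using i(1) nh by simp_all
    then show ?thesis using EE(4)[of q] 4 by (simp only:)
  next
    case (5 q)
    then have "Suc i = 5 * Suc q" by simp
    then show ?thesis using i(2) 5 five_mod by (metis n_not_Suc_n)
  qed
  have "numbering n E \<sigma>"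
    unfolding numbering_def
  proof (intro conjI allI impI)
    show "bij_betw \<sigma> {..<n} {..<n}" using inj\<sigma> img nh by (simp add: bij_betw_def)
  next
    fix i j assume ij: "i < n" "j < n" "chain i j"
    then show "{\<sigma> i, \<sigma> j} \<in> E"
      using chainE[of i] chainE[of j] by (auto simp: chain_def insert_commute)
  next
    fix i j assume ij: "i < n" "j < n" "{\<sigma> i, \<sigma> j} \<in> E"
    then consider "{\<sigma> i, \<sigma> j} \<in> EH" | v where "v \<in> VH" "{\<sigma> i, \<sigma> j} \<in> {{v, w v}, {w v, x v}, {x v, y v}, {y v, z v}}"
      unfolding E by blast
    then show "chain i j \<or> 5 dvd i \<and> 5 dvd j"
    proof cases
      case 1
      have "5 dvd l" if "\<sigma> l \<in> VH" "l < n" for l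
      proof -
        obtain q where "q < h" "\<sigma> l = e q"
          using e(1) \<open>\<sigma> l \<in> VH\<close> by (auto simp: bij_betw_def)
        then have "\<sigma> l = \<sigma> (5 * q)" "5 * q < 5 * h" by (simp_all add: \<sigma>5)
        then have "l = 5 * q" using \<sigma>_eq that nh by blast
        then show ?thesis by simp
      qed
      then show ?thesis using EH[OF 1] ij by auto
    next
      case (2 v)
      obtain q where q: "q < h" "v = e q" using e(1) 2(1) by (auto simp: bij_betw_def)
      have *: "{\<sigma> i, \<sigma> j} \<in> {{\<sigma> (5 * q), \<sigma> (5 * q + 1)}, {\<sigma> (5 * q + 1), \<sigma> (5 * q + 2)},
          {\<sigma> (5 * q + 2), \<sigma> (5 * q + 3)}, {\<sigma> (5 * q + 3), \<sigma> (5 * q + 4)}}"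
        using 2(2) unfolding q(2) \<sigma>5 .
      have "chain i j" if cd: "{\<sigma> i, \<sigma> j} = {\<sigma> c, \<sigma> d}" "chain c d" "c < 5 * h" "d < 5 * h" for c d
      proof -
        have "i = c \<and> j = d \<or> i = d \<and> j = c"
          using \<sigma>_eq ij nh cd by (auto simp: doubleton_eq_iff)
        then show ?thesis using cd(2) by (auto simp: chain_def)
      qed
      note this[of "5 * q" "5 * q + 1"] this[of "5 * q + 1" "5 * q + 2"]
        this[of "5 * q + 2" "5 * q + 3"] this[of "5 * q + 3" "5 * q + 4"]
      then have "chain i j" using * q(1) unfolding chain_iff by simp linarith
      then show ?thesis ..
    qed
  next
    fix i assume i: "i < n" "5 dvd i \<and> 0 < i"
    then obtain q where q: "i = 5 * q" "q < h" "0 < q" using nh by (auto elim!: dvdE)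
    then obtain j where "j < q" "{e q, e j} \<in> EH" using e(2) by blast
    then show "\<exists>j<i. 5 dvd j \<and> {\<sigma> i, \<sigma> j} \<in> E"
      using q by (intro exI[of _ "5 * j"]) (simp add: \<sigma>5 E)
  qed
  then show thesis using that nh h0 by simp
qed

text \<open>\<open>Q\<close> is the partner relation of a perfect matching of \<open>D\<close>. The
  set \<open>D\<close> is not given separately; it consists of the vertices with a partner.\<close>

definition matching :: "nat \<Rightarrow> (nat \<Rightarrow> nat \<Rightarrow> bool) \<Rightarrow> (nat \<Rightarrow> nat \<Rightarrow> bool) \<Rightarrow> bool" where
  "matching n A Q \<longleftrightarrow>
     (\<forall>i<n. \<forall>j<n. Q i j \<longrightarrow> A i j \<and> Q j i) \<and>
     (\<forall>i<n. \<forall>j<n. \<forall>l<n. Q i j \<and> Q i l \<longrightarrow> j = l) \<and>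
     (\<forall>i<n. (\<exists>j<n. Q i j) \<or> (\<exists>c<n. A i c \<and> (\<exists>j<n. Q c j)))"

section \<open>Partner relations and paired dominating sets\<close>

lemma paired_dominating_if_matching:
  assumes simple: "simple_graph {..<n} E" and Q: "matching n (\<lambda>i j. {i, j} \<in> E) Q"
  shows "\<exists>D. paired_dominating_set {..<n} E D \<and> card D = (\<Sum>i<n. of_bool (\<exists>j<n. Q i j))"
proof -
  define D where "D = {i. i < n \<and> (\<exists>j<n. Q i j)}"
  define M where "M = {{i, j} | i j. i < n \<and> j < n \<and> Q i j}"
  have Q1: "{i, j} \<in> E" "Q j i" if "Q i j" "i < n" "j < n" for i j
    using Q that by (auto simp: matching_def)
  have Q2: "j = l" if "Q i j" "Q i l" "i < n" "j < n" "l < n" for i j l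
    using Q that unfolding matching_def by blast
  have "paired_dominating_set {..<n} E D"
    unfolding paired_dominating_set_def perfect_matching_def
  proof (intro conjI ballI exI[of _ M])
    show "D \<subseteq> {..<n}" by (auto simp: D_def)
    show "M \<subseteq> induced_edges E D" using Q1 by (auto simp: M_def D_def induced_edges_def)
  next
    fix v assume "v \<in> {..<n} - D"
    then obtain c where "c < n" "{v, c} \<in> E" "\<exists>j<n. Q c j"
      using Q unfolding matching_def D_def by blast
    then show "\<exists>u\<in>D. {u, v} \<in> E" by (intro bexI[of _ c]) (auto simp: D_def insert_commute)
  next
    fix v assume "v \<in> D"
    then obtain j where j: "v < n" "j < n" "Q v j" by (auto simp: D_def)
    show "\<exists>!e. e \<in> M \<and> v \<in> e"
    proof (rule ex1I[of _ "{v, j}"])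
      show "{v, j} \<in> M \<and> v \<in> {v, j}" using j by (auto simp: M_def)
      fix e assume "e \<in> M \<and> v \<in> e"
      then obtain l where "e = {v, l}" "l < n" "Q v l" using Q1(2) by (auto simp: M_def insert_commute)
      then show "e = {v, j}" using Q2 j by blast
    qed
  qed
  moreover have "card D = (\<Sum>i<n. of_bool (\<exists>j<n. Q i j))"
    by (simp add: D_def sum_of_bool_eq Int_def)
  ultimately show ?thesis by blast
qed

lemma matching_if_paired_dominating:
  assumes simple: "simple_graph {..<n} E" and D: "paired_dominating_set {..<n} E D"
  obtains Q where "matching n (\<lambda>i j. {i, j} \<in> E) Q" "(\<Sum>i<n. of_bool (\<exists>j<n. Q i j)) = card D"
proof -
  obtain M where DV: "D \<subseteq> {..<n}" and dom: "\<And>v. v < n \<Longrightarrow> v \<notin> D \<Longrightarrow> \<exists>u\<in>D. {u, v} \<in> E"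
    and M: "M \<subseteq> induced_edges E D" and uni: "\<And>v. v \<in> D \<Longrightarrow> \<exists>!e. e \<in> M \<and> v \<in> e"
    using D unfolding paired_dominating_set_def perfect_matching_def by auto
  define Q where "Q i j \<longleftrightarrow> {i, j} \<in> M" for i j
  have QD: "{i, j} \<in> E" "i \<in> D" "j \<in> D" if "Q i j" for i j
    using M that by (auto simp: Q_def induced_edges_def)
  have ex: "(\<exists>j<n. Q i j) \<longleftrightarrow> i \<in> D" for i
  proof
    assume i: "i \<in> D"
    then obtain e where e: "e \<in> M" "i \<in> e" using uni by blast
    then have "e \<in> E" "e \<subseteq> D" using M by (auto simp: induced_edges_def)
    then obtain a b where "e = {a, b}" using simple by (fastforce simp: simple_graph_def card_2_iff)
    then obtain j where j: "e = {i, j}" using e(2) by blast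
    then have "j < n" using \<open>e \<subseteq> D\<close> DV by auto
    then show "\<exists>j<n. Q i j" using e j by (auto simp: Q_def)
  qed (use QD in blast)
  have "matching n (\<lambda>i j. {i, j} \<in> E) Q"
    unfolding matching_def ex
  proof (intro conjI allI impI)
    fix i j assume "Q i j"
    then show "{i, j} \<in> E" "Q j i" using QD by (auto simp: Q_def insert_commute)
  next
    fix i j l assume "Q i j \<and> Q i l"
    then have "{i, j} = {i, l}" using uni[of i] QD unfolding Q_def by blast
    then show "j = l" by (auto simp: doubleton_eq_iff)
  next
    fix i assume "i < n"
    then show "i \<in> D \<or> (\<exists>c<n. {i, c} \<in> E \<and> c \<in> D)"
      using dom[of i] DV by (metis insert_commute lessThan_iff subsetD)
  qed
  moreover have "(\<Sum>i<n. of_bool (\<exists>j<n. Q i j)) = card D"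
  proof -
    have "{..<n} \<inter> {i. i \<in> D} = D" using DV by blast
    then show ?thesis unfolding ex by (simp add: sum_of_bool_eq)
  qed
  ultimately show thesis using that by blast
qed

section \<open>Membership in NP\<close>

text \<open>
  The certificate is the graph of a numbering, given by \<open>P\<close>, followed by the relation \<open>Q\<close> of a
  matching.
\<close>

definition numbering_rel :: "nat \<Rightarrow> (nat \<Rightarrow> nat \<Rightarrow> bool) \<Rightarrow> (nat \<Rightarrow> nat \<Rightarrow> bool) \<Rightarrow> bool" where
  "numbering_rel n A P \<longleftrightarrow>
     (\<forall>i<n. \<exists>a<n. P i a \<and> (\<forall>b<n. P i b \<longrightarrow> a = b)) \<and> (\<forall>a<n. \<exists>i<n. P i a) \<and>
     (\<forall>i<n. \<forall>j<n. \<forall>a<n. \<forall>b<n. P i a \<and> P j b \<longrightarrow>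
        (chain i j \<longrightarrow> A a b) \<and> (A a b \<longrightarrow> chain i j \<or> 5 dvd i \<and> 5 dvd j)) \<and>
     (\<forall>i<n. 5 dvd i \<and> 0 < i \<longrightarrow> (\<exists>j<i. 5 dvd j \<and> (\<exists>a<n. \<exists>b<n. P i a \<and> P j b \<and> A a b)))"

text \<open>
  The bound \<open>k\<close> may be exponential in the length of the instance, but it matters only up to \<open>n\<close>.
\<close>

definition check :: "nat \<Rightarrow> (nat \<Rightarrow> bool) \<Rightarrow> (nat \<Rightarrow> bool) \<Rightarrow> bool" where
  "check m X U \<longleftrightarrow> (\<exists>n<Suc m. \<exists>l<Suc m. 0 < n \<and> 5 dvd n \<and> 0 < l \<and> m = n + 1 + n * n + l \<and>
     (\<forall>i<n. X i) \<and> \<not> X n \<and> X (m - 1) \<and>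
     (\<forall>i<n. \<not> X (n + 1 + (i * n + i))) \<and>
     (\<forall>i<n. \<forall>j<n. X (n + 1 + (i * n + j)) \<longrightarrow> X (n + 1 + (j * n + i))) \<and>
     numbering_rel n (\<lambda>i j. X (n + 1 + (i * n + j))) (\<lambda>i j. U (i * n + j)) \<and>
     matching n (\<lambda>i j. X (n + 1 + (i * n + j))) (\<lambda>i j. U (n * n + (i * n + j))) \<and>
     (length (binary n) < l \<or>
      (\<exists>k<2 * n. length (binary k) = l \<and>
         (\<forall>i<l. (X (n + 1 + (n * n + i)) \<longrightarrow> bit k i) \<and> (bit k i \<longrightarrow> X (n + 1 + (n * n + i)))) \<and>
         (\<Sum>i<n. of_bool (\<exists>j<n. U (n * n + (i * n + j)))) \<le> k)))"

text \<open>Numerals are the bit strings that do not end in \<open>False\<close>; this is why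
  \<open>check\<close> tests the last bit of the instance.\<close>

lemma ex_binary: "bs = [] \<or> last bs \<Longrightarrow> \<exists>k. binary k = bs"
proof (induction bs)
  case Nil
  show ?case using binary_0 by blast
next
  case (Cons b bs)
  then have "bs = [] \<or> last bs" by (auto split: if_splits)
  then obtain k where k: "binary k = bs" using Cons.IH by blast
  have "of_bool b + 2 * k \<noteq> 0"
  proof (cases "bs = []")
    case True
    then show ?thesis using Cons.prems by simp
  next
    case False
    then have "k \<noteq> 0" using k by (intro notI) simp
    then show ?thesis by simp
  qed
  then have "binary (of_bool b + 2 * k) = b # bs" using k by (subst binary.simps) simp
  then show ?case by blast
qed

lemma last_binary: "k \<noteq> 0 \<Longrightarrow> last (binary k)"
proof (induction k rule: less_induct)
  case (less k)
  show ?case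
  proof (cases "k div 2 = 0")
    case True
    then have "k = 1" using less.prems by linarith
    then show ?thesis by (simp add: binary.simps)
  next
    case False
    then have "binary (k div 2) \<noteq> []" by (subst binary.simps) simp
    then show ?thesis using less.IH[of "k div 2"] less.prems False by (simp add: binary.simps[of k])
  qed
qed

lemma pair_index: "i < n \<Longrightarrow> j < n \<Longrightarrow> i * n + j < n * (n :: nat)"
  using mult_le_mono1[of "Suc i" n n] by simp

lemma adj_index:
  assumes "i < n" "j < n"
  shows "adj_matrix n E ! (i * n + j) \<longleftrightarrow> {i, j} \<in> E"
  using pair_index[OF assms] assms by (simp add: adj_matrix_eq)

section \<open>Numberings as functions and as relations\<close>

lemma numbering_if_rel:
  assumes "numbering_rel n A P" "\<And>i j. i < n \<Longrightarrow> j < n \<Longrightarrow> A i j \<longleftrightarrow> {i, j} \<in> E"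
  shows "\<exists>\<sigma>. numbering n E \<sigma>"
proof -
  have "\<exists>a<n. P i a \<and> (\<forall>b<n. P i b \<longrightarrow> a = b)" if "i < n" for i
    using assms(1) that unfolding numbering_rel_def by blast
  then obtain \<sigma> where \<sigma>: "\<And>i. i < n \<Longrightarrow> \<sigma> i < n" "\<And>i. i < n \<Longrightarrow> P i (\<sigma> i)"
    "\<And>i b. i < n \<Longrightarrow> b < n \<Longrightarrow> P i b \<Longrightarrow> \<sigma> i = b"
      by metis
  have "\<sigma> ` {..<n} = {..<n}"
  proof (intro subset_antisym subsetI)
    fix a assume a: "a \<in> {..<n}"
    have "\<forall>a<n. \<exists>i<n. P i a" using assms(1) unfolding numbering_rel_def by (elim conjE)
    then obtain i where "i < n" "P i a" "a < n" using a by auto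
    then show "a \<in> \<sigma> ` {..<n}" using \<sigma>(3) by (intro image_eqI[of _ _ i]) auto
  qed (use \<sigma>(1) in auto)
  then have "bij_betw \<sigma> {..<n} {..<n}" by (simp add: bij_betw_def eq_card_imp_inj_on)
  moreover have "(chain i j \<longrightarrow> {\<sigma> i, \<sigma> j} \<in> E) \<and> ({\<sigma> i, \<sigma> j} \<in> E \<longrightarrow> chain i j \<or> 5 dvd i \<and> 5 dvd j)"
    if "i < n" "j < n" for i j
  proof -
    have "\<forall>i<n. \<forall>j<n. \<forall>a<n. \<forall>b<n. P i a \<and> P j b \<longrightarrow>
        (chain i j \<longrightarrow> A a b) \<and> (A a b \<longrightarrow> chain i j \<or> 5 dvd i \<and> 5 dvd j)"
      using assms(1) unfolding numbering_rel_def by (elim conjE)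
    from this[rule_format, of i j "\<sigma> i" "\<sigma> j"]
    have "(chain i j \<longrightarrow> A (\<sigma> i) (\<sigma> j)) \<and> (A (\<sigma> i) (\<sigma> j) \<longrightarrow> chain i j \<or> 5 dvd i \<and> 5 dvd j)"
      using \<sigma>(1,2) that by blast
    then show ?thesis using assms(2) \<sigma>(1) that by simp
  qed
  moreover have "\<exists>j<i. 5 dvd j \<and> {\<sigma> i, \<sigma> j} \<in> E" if i: "i < n" "5 dvd i \<and> 0 < i" for i
  proof -
    have "\<forall>i<n. 5 dvd i \<and> 0 < i \<longrightarrow> (\<exists>j<i. 5 dvd j \<and> (\<exists>a<n. \<exists>b<n. P i a \<and> P j b \<and> A a b))"
      using assms(1) unfolding numbering_rel_def by (elim conjE)
    then obtain j a b where *: "j < i" "5 dvd j" "a < n" "b < n" "P i a" "P j b" "A a b"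
      using i by blast
    then have "\<sigma> i = a" "\<sigma> j = b" using \<sigma>(3) i by auto
    then show ?thesis using * assms(2) by blast
  qed
  ultimately show ?thesis unfolding numbering_def by blast
qed

lemma rel_if_numbering:
  assumes "numbering n E \<sigma>" "\<And>i j. i < n \<Longrightarrow> j < n \<Longrightarrow> A i j \<longleftrightarrow> {i, j} \<in> E"
    "\<And>i j. i < n \<Longrightarrow> j < n \<Longrightarrow> P i j \<longleftrightarrow> \<sigma> i = j"
  shows "numbering_rel n A P"
proof -
  have \<sigma>: "\<sigma> i < n" if "i < n" for i
    using assms(1) that by (auto simp: numbering_def bij_betw_def)
  have surj: "\<exists>i<n. \<sigma> i = a" if "a < n" for a
  proof -
    have "a \<in> \<sigma> ` {..<n}" using assms(1) that by (auto simp: numbering_def bij_betw_def)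
    then show ?thesis by auto
  qed
  show ?thesis
    unfolding numbering_rel_def
  proof (intro conjI allI impI)
    fix i assume "i < n"
    then show "\<exists>a<n. P i a \<and> (\<forall>b<n. P i b \<longrightarrow> a = b)"
      using \<sigma> assms(3) by (intro exI[of _ "\<sigma> i"]) auto
  next
    fix a assume "a < n"
    then show "\<exists>i<n. P i a" using surj assms(3) by blast
  next
    fix i j a b assume *: "i < n" "j < n" "a < n" "b < n" "P i a \<and> P j b"
    then have "a = \<sigma> i" "b = \<sigma> j" using assms(3) by auto
    moreover assume "chain i j"
    ultimately show "A a b" using assms(1,2) * unfolding numbering_def by auto
  next
    fix i j a b assume *: "i < n" "j < n" "a < n" "b < n" "P i a \<and> P j b"
    then have "a = \<sigma> i" "b = \<sigma> j" using assms(3) by auto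
    moreover assume "A a b"
    ultimately show "chain i j \<or> 5 dvd i \<and> 5 dvd j"
      using assms(1,2) * unfolding numbering_def by auto
  next
    fix i assume i: "i < n" "5 dvd i \<and> 0 < i"
    then obtain j where "j < i" "5 dvd j" "{\<sigma> i, \<sigma> j} \<in> E"
      using assms(1) unfolding numbering_def by blast
    then show "\<exists>j<i. 5 dvd j \<and> (\<exists>a<n. \<exists>b<n. P i a \<and> P j b \<and> A a b)"
      using i \<sigma> assms(2,3)
        by (intro exI[of _ j] conjI exI[of _ "\<sigma> i"] exI[of _ "\<sigma> j"]) auto
  qed
qed

lemma matching_cong:
  assumes "\<And>i j. i < n \<Longrightarrow> j < n \<Longrightarrow> A i j \<longleftrightarrow> A' i j" "\<And>i j. i < n \<Longrightarrow> j < n \<Longrightarrow> Q i j \<longleftrightarrow> Q' i j"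
  shows "matching n A Q \<longleftrightarrow> matching n A' Q'"
  unfolding matching_def using assms by (simp cong: conj_cong)

lemma check_sound:
  assumes X: "\<And>i. i < length x \<Longrightarrow> X i \<longleftrightarrow> x ! i" and check: "check (length x) X U"
  shows "x \<in> gp4_paired_domination"
proof -
  obtain n l where n: "0 < n" "5 dvd n" and l: "0 < l" and len: "length x = n + 1 + n * n + l"
    and un: "\<forall>i<n. X i" "\<not> X n" "X (length x - 1)"
    and irr: "\<forall>i<n. \<not> X (n + 1 + (i * n + i))"
    and sym: "\<forall>i<n. \<forall>j<n. X (n + 1 + (i * n + j)) \<longrightarrow> X (n + 1 + (j * n + i))"
    and num: "numbering_rel n (\<lambda>i j. X (n + 1 + (i * n + j))) (\<lambda>i j. U (i * n + j))"
    and mat: "matching n (\<lambda>i j. X (n + 1 + (i * n + j))) (\<lambda>i j. U (n * n + (i * n + j)))"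
    and bound: "length (binary n) < l \<or>
      (\<exists>k<2 * n. length (binary k) = l \<and>
         (\<forall>i<l. (X (n + 1 + (n * n + i)) \<longrightarrow> bit k i) \<and> (bit k i \<longrightarrow> X (n + 1 + (n * n + i)))) \<and>
         (\<Sum>i<n. of_bool (\<exists>j<n. U (n * n + (i * n + j)))) \<le> k)"
    using check unfolding check_def by (elim exE conjE) (rule that; assumption)
  \<comment> \<open>Restricting \<open>R\<close> to indices below \<open>n\<close> makes it
    symmetric on all numbers, although the instance only controls the matrix entries.\<close>
  define R where "R i j \<longleftrightarrow> i < n \<and> j < n \<and> X (n + 1 + (i * n + j))" for i j
  define E where "E = edges n R"
  have symR: "symp R" using sym by (auto simp: symp_def R_def)
  have simple: "simple_graph {..<n} E" unfolding E_def
    by (rule simple_graph_edges) (use irr in \<open>auto simp: irreflp_def R_def\<close>)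
  have A: "X (n + 1 + (i * n + j)) \<longleftrightarrow> {i, j} \<in> E" if "i < n" "j < n" for i j
    using that unfolding E_def edges_iff[OF symR] by (simp add: R_def)
  let ?b = "drop (n + 1 + n * n) x"
  have lb: "length ?b = l" using len by simp
  have "last ?b"
  proof -
    have "x \<noteq> []" using len by auto
    then have "last ?b = x ! (length x - 1)" using len l last_conv_nth[of x] by (subst last_drop) simp_all
    then show ?thesis using X[of "length x - 1"] un(3) len by simp
  qed
  then obtain k where k: "binary k = ?b" using ex_binary by blast
  then have lk: "length (binary k) = l" using lb by simp
  then have k0: "k > 0" using l by (cases "k = 0") auto
  have enc: "x = encode_instance n E k"
  proof (rule nth_equalityI)
    show lenc: "length x = length (encode_instance n E k)"
      unfolding E_def encode_instance_eq[OF symR] using len lk by simp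
    fix i assume i: "i < length x"
    let ?q = "(i - n - 1) div n" and ?r = "(i - n - 1) mod n"
    have e: "encode_instance n E k ! i \<longleftrightarrow> i < n \<or> n < i \<and> (if i < n + 1 + n * n then R ?q ?r
        else odd (k div 2 ^ (i - n - 1 - n * n)))"
      unfolding E_def encode_instance_eq[OF symR] using i len lk by (simp del: upt_Suc)
    consider "i < n" | "i = n" | "n < i" "i < n + 1 + n * n" | "n + 1 + n * n \<le> i" by linarith
    then show "x ! i = encode_instance n E k ! i"
    proof cases
      case 3
      then have "i - n - 1 < n * n" by simp
      then have "?q < n" "?r < n" using n by (auto simp: less_mult_imp_div_less)
      moreover have "n + 1 + (?q * n + ?r) = i" using 3 by simp
      ultimately have "R ?q ?r \<longleftrightarrow> X i" unfolding R_def by simp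
      then show ?thesis using e 3 X[OF i] by simp
    next
      case 4
      define t where "t = i - (n + 1 + n * n)"
      have t: "i = n + 1 + n * n + t" "t < l" using 4 i len by (auto simp: t_def)
      have "binary k ! t = x ! i" unfolding k t(1) using len by (subst nth_drop) auto
      moreover have "binary k ! t = odd (k div 2 ^ t)" using t lk by (intro nth_binary) simp
      moreover have "i - n - 1 - n * n = t" using t by simp
      ultimately show ?thesis using e 4 by simp
    qed (use e X[OF i] un in auto)
  qed
  obtain \<sigma> where "numbering n E \<sigma>" using numbering_if_rel[OF num A] by blast
  then have gp4: "gp4_graph {..<n} E" by (rule gp4_graph_if_numbering[OF simple n])
  let ?Q = "\<lambda>i j. U (n * n + (i * n + j))"
  have "matching n (\<lambda>i j. {i, j} \<in> E) ?Q" 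
    using matching_cong[of n "\<lambda>i j. X (n + 1 + (i * n + j))" "\<lambda>i j. {i, j} \<in> E" ?Q ?Q, OF A refl] mat
    by blast
  then obtain D where D: "paired_dominating_set {..<n} E D" "card D = (\<Sum>i<n. of_bool (\<exists>j<n. ?Q i j))"
    using paired_dominating_if_matching[OF simple] by blast
  have "card D \<le> k"
    using bound
  proof
    \<comment> \<open>A numeral longer than that of \<open>n\<close> denotes a number above
      \<open>n\<close>, and \<open>D\<close> has at most \<open>n\<close> elements.\<close>
    assume "length (binary n) < l"
    then have "(2 :: nat) ^ length (binary n) \<le> k" using lk power_le_iff_length_binary by simp
    moreover have "n < 2 ^ length (binary n)" using length_binary by blast
    moreover have "card D \<le> n"
      using D(1) card_mono[of "{..<n}" D] by (simp add: paired_dominating_set_def)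
    ultimately show ?thesis by linarith
  next
    assume "\<exists>k<2 * n. length (binary k) = l \<and>
         (\<forall>i<l. (X (n + 1 + (n * n + i)) \<longrightarrow> bit k i) \<and> (bit k i \<longrightarrow> X (n + 1 + (n * n + i)))) \<and>
         (\<Sum>i<n. of_bool (\<exists>j<n. ?Q i j)) \<le> k"
    then obtain k' where k': "length (binary k') = l" "\<And>i. i < l \<Longrightarrow> X (n + 1 + (n * n + i)) \<longleftrightarrow> bit k' i"
      "card D \<le> k'" using D(2) by auto
    have "binary k' = binary k"
    proof (rule nth_equalityI)
      fix i assume "i < length (binary k')"
      then have i: "i < l" using k'(1) by simp
      then have "binary k' ! i \<longleftrightarrow> X (n + 1 + (n * n + i))"
        using k' nth_binary by (simp add: bit_iff_odd)
      also have "\<dots> \<longleftrightarrow> x ! (n + 1 + (n * n + i))" using i len by (intro X) simp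
      also have "\<dots> \<longleftrightarrow> binary k ! i"
        unfolding k using len by (subst nth_drop) (auto simp: add.assoc)
      finally show "binary k' ! i = binary k ! i" .
    qed (use lk k' in simp)
    then show ?thesis using k'(3) binary_inj by blast
  qed
  then show ?thesis
    unfolding gp4_paired_domination_def using enc gp4 k0 D(1) by blast
qed

text \<open>\<open>X\<close> and \<open>U\<close> are prescribed within the two strings only: a
  verifier reading the tape beyond the certificate sees whatever is there, and \<open>check\<close>
  must not depend on it.\<close>

lemma check_complete:
  assumes "x \<in> gp4_paired_domination"
  shows "\<exists>u. length u \<le> 2 * (length x * length x) \<and>
    (\<forall>X U. (\<forall>i<length x. X i \<longleftrightarrow> x ! i) \<and> (\<forall>i<length u. U i \<longleftrightarrow> u ! i) \<longrightarrow> check (length x) X U)"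
proof -
  obtain n E k D where x: "x = encode_instance n E k" and gp4: "gp4_graph {..<n} E" and k: "k > 0"
    and D: "paired_dominating_set {..<n} E D" "card D \<le> k"
    using assms unfolding gp4_paired_domination_def by blast
  have simple: "simple_graph {..<n} E" by (rule gp4_graph_simple[OF gp4])
  obtain \<sigma> where n: "0 < n" "5 dvd n" and \<sigma>: "numbering n E \<sigma>"
    using numbering_if_gp4_graph[OF gp4] by blast
  obtain Q where Q: "matching n (\<lambda>i j. {i, j} \<in> E) Q" "(\<Sum>i<n. of_bool (\<exists>j<n. Q i j)) = card D"
    using matching_if_paired_dominating[OF simple D(1)] by blast
  define u where "u = map (\<lambda>i. \<sigma> (i div n) = i mod n) [0..<n * n] @ map (\<lambda>i. Q (i div n) (i mod n)) [0..<n * n]"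
  have lx: "length x = n + 1 + n * n + length (binary k)"
    by (simp add: x encode_instance_def adj_matrix_eq)
  have lu: "length u = 2 * (n * n)" by (simp add: u_def)
  have "n * n \<le> length x * length x" using lx by (intro mult_le_mono) auto
  then have "length u \<le> 2 * (length x * length x)" using lu by simp
  moreover have "check (length x) X U" if X: "\<forall>i<length x. X i \<longleftrightarrow> x ! i" and U: "\<forall>i<length u. U i \<longleftrightarrow> u ! i" for X U
  proof -
    let ?l = "length (binary k)"
    have A: "X (n + 1 + (i * n + j)) \<longleftrightarrow> {i, j} \<in> E" if "i < n" "j < n" for i j
    proof -
      have "n + 1 + (i * n + j) < length x" using pair_index[OF that] lx by simp
      then have "X (n + 1 + (i * n + j)) \<longleftrightarrow> x ! (n + 1 + (i * n + j))" using X by blast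
      also have "\<dots> \<longleftrightarrow> adj_matrix n E ! (i * n + j)"
        using pair_index[OF that] by (simp add: x encode_instance_def nth_append adj_matrix_length)
      finally show ?thesis using adj_index[OF that] by simp
    qed
    have UP: "U (i * n + j) \<longleftrightarrow> \<sigma> i = j" and UQ: "U (n * n + (i * n + j)) \<longleftrightarrow> Q i j" if "i < n" "j < n" for i j
      using U pair_index[OF that] that lu by (auto simp: u_def nth_append)
    have Xb: "X (n + 1 + (n * n + i)) \<longleftrightarrow> bit k i" if "i < ?l" for i
    proof -
      have "X (n + 1 + (n * n + i)) \<longleftrightarrow> x ! (n + 1 + (n * n + i))" using X lx that by simp
      also have "\<dots> \<longleftrightarrow> binary k ! i"
        by (simp add: x encode_instance_def nth_append adj_matrix_length)
      finally show ?thesis using nth_binary[OF that] by (simp add: bit_iff_odd)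
    qed
    have l: "0 < ?l" using k power_le_iff_length_binary[of 0 k] by simp
    have X1: "\<forall>i<n. X i" "\<not> X n" using X lx by (auto simp: x encode_instance_def nth_append)
    have X2: "X (length x - 1)"
    proof -
      have "x ! (length x - 1) = last x" using lx by (subst last_conv_nth) auto
      also have "\<dots> = last (binary k)" using l by (simp add: x encode_instance_def)
      finally show ?thesis using X lx last_binary k by simp
    qed
    have X3: "\<forall>i<n. \<not> X (n + 1 + (i * n + i))" using A simple by (auto simp: simple_graph_def)
    have X4: "\<forall>i<n. \<forall>j<n. X (n + 1 + (i * n + j)) \<longrightarrow> X (n + 1 + (j * n + i))" using A by (auto simp: insert_commute)
    have X5: "numbering_rel n (\<lambda>i j. X (n + 1 + (i * n + j))) (\<lambda>i j. U (i * n + j))"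
      by (rule rel_if_numbering[OF \<sigma> A UP])
    have X6: "matching n (\<lambda>i j. X (n + 1 + (i * n + j))) (\<lambda>i j. U (n * n + (i * n + j)))"
      using Q(1) A UQ matching_cong[of n "\<lambda>i j. X (n + 1 + (i * n + j))" "\<lambda>i j. {i, j} \<in> E"
          "\<lambda>i j. U (n * n + (i * n + j))" Q] by blast
    have "(\<exists>j<n. U (n * n + (i * n + j))) \<longleftrightarrow> (\<exists>j<n. Q i j)" if "i < n" for i using UQ[OF that] by blast
    then have sz: "(\<Sum>i<n. of_bool (\<exists>j<n. U (n * n + (i * n + j)))) = card D"
      unfolding Q(2)[symmetric] by (intro sum.cong refl) simp
    have X7: "length (binary n) < ?l \<or>
      (\<exists>k<2 * n. length (binary k) = ?l \<and>
         (\<forall>i<?l. (X (n + 1 + (n * n + i)) \<longrightarrow> bit k i) \<and> (bit k i \<longrightarrow> X (n + 1 + (n * n + i)))) \<and>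
         (\<Sum>i<n. of_bool (\<exists>j<n. U (n * n + (i * n + j)))) \<le> k)"
    proof (cases "length (binary n) < ?l")
      case False
      \<comment> \<open>A numeral no longer than that of \<open>n\<close> denotes a number below
        \<open>2 * n\<close>; this is the range of the search for the bound in
        \<open>check\<close>.\<close>
      have "k < 2 ^ ?l" using length_binary by blast
      also have "(2 :: nat) ^ ?l \<le> 2 ^ length (binary n)" using False by (intro power_increasing) auto
      also have "(2 :: nat) ^ length (binary n) \<le> 2 * n"
      proof -
        have "2 ^ (length (binary n) - 1) \<le> n" "length (binary n) > 0"
          using n length_binary[of n] power_le_iff_length_binary[of 0 n] by auto
        then show ?thesis by (cases "length (binary n)") auto
      qed
      finally show ?thesis using Xb sz D(2) by (intro disjI2 exI[of _ k]) auto
    qed simp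
    have "n < Suc (length x)" "?l < Suc (length x)" using lx by auto
    then show ?thesis
      unfolding check_def using n l lx X1 X2 X3 X4 X5 X6 X7 by blast
  qed
  ultimately show ?thesis by blast
qed

text \<open>The separator occurs once, so this sum has at most one nonzero term and gives its
  position; as a bounded sum it is definable.\<close>

definition separator :: "nat list \<Rightarrow> nat" where
  "separator s = (\<Sum>i<length s. of_bool (contents s (int i) = 3) * i)"

lemma separator_verifier_input: "separator (verifier_input x u) = length x"
proof -
  let ?s = "verifier_input x u"
  have "contents ?s (int i) = 3 \<longleftrightarrow> i = length x" for i
    unfolding contents_verifier_input by (auto simp: contents_def syms_def)
  then have "separator ?s = (\<Sum>i<length ?s. if i = length x then length x else 0)"
    unfolding separator_def by (intro sum.cong) auto
  also have "\<dots> = length x" by (simp add: verifier_input_def syms_def)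
  finally show ?thesis .
qed

definition bit_at :: "nat list \<Rightarrow> nat \<Rightarrow> bool" where
  "bit_at s i \<longleftrightarrow> contents s (int i) = 2"

text \<open>\<open>check\<close> and the notions in it use only bounded quantifiers, connectives and
  arithmetic, with equivalences split into implications, so applying the closure rules
  suffices.\<close>

lemma pdefinable_check:
  "pdefinable (\<lambda>s v. check (separator s) (bit_at s) (\<lambda>i. bit_at s (separator s + 1 + i)))"
proof -
  have sep: "definable (\<lambda>s v. separator s)"
    unfolding separator_def by (intro def_intros)
  have at: "definable F \<Longrightarrow> pdefinable (\<lambda>s v. bit_at s (F s v))" for F
    unfolding bit_at_def by (rule pdefinable_symbol_eq)
  show ?thesis
    unfolding check_def numbering_rel_def matching_def chain_def
    by (intro at pdefinable_bit[folded bit_iff_odd] definable_length_binary sep def_intros)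
qed

theorem gp4_in_NP: "gp4_paired_domination \<in> NP"
proof -
  let ?P = "\<lambda>s. check (separator s) (bit_at s) (\<lambda>i. bit_at s (separator s + 1 + i))"
  obtain M r where M: "wf_tm M" "\<And>s. 0 \<notin> set s \<Longrightarrow> halted M (run M s (poly r (length s)))"
    "\<And>s. 0 \<notin> set s \<Longrightarrow> fst (run M s (poly r (length s))) = accept M \<longleftrightarrow> ?P s"
    using decide_definable[OF pdefinable_check] by blast
  have nz: "0 \<notin> set (verifier_input x u)" for x u by (auto simp: verifier_input_def syms_def)
  have acc: "(\<exists>t. fst (run M (verifier_input x u) t) = accept M) \<longleftrightarrow> ?P (verifier_input x u)" for x u
    using accepts_iff[OF M(2)[OF nz]] M(3)[OF nz] by simp
  have X: "bit_at (verifier_input x u) i \<longleftrightarrow> x ! i" if "i < length x" for x u i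
    using that unfolding bit_at_def contents_verifier_input by (auto simp: contents_def syms_def)
  have U: "bit_at (verifier_input x u) (length x + 1 + i) \<longleftrightarrow> u ! i" if "i < length u" for x u i
    using that unfolding bit_at_def contents_verifier_input by (auto simp: contents_def syms_def)
  \<comment> \<open>The certificate consists of two \<open>n * n\<close> matrices, one for the
    numbering and one for the matching.\<close>
  define p :: "nat poly" where "p = [:0, 0, 2:]"
  have p: "poly p l = 2 * (l * l)" for l by (simp add: p_def)
  have "x \<in> gp4_paired_domination \<longleftrightarrow> (\<exists>u. length u \<le> poly p (length x) \<and>
        (\<exists>t. fst (run M (verifier_input x u) t) = accept M))" for x
  proof
    assume "x \<in> gp4_paired_domination"
    then obtain u where u: "length u \<le> 2 * (length x * length x)"
      "\<And>X U. (\<forall>i<length x. X i \<longleftrightarrow> x ! i) \<and> (\<forall>i<length u. U i \<longleftrightarrow> u ! i) \<Longrightarrow> check (length x) X U"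
      using check_complete by blast
    have "?P (verifier_input x u)"
      unfolding separator_verifier_input by (rule u(2)) (use X U in blast)
    then show "\<exists>u. length u \<le> poly p (length x) \<and> (\<exists>t. fst (run M (verifier_input x u) t) = accept M)"
      using u(1) acc unfolding p by blast
  next
    assume "\<exists>u. length u \<le> poly p (length x) \<and> (\<exists>t. fst (run M (verifier_input x u) t) = accept M)"
    then obtain u where "?P (verifier_input x u)" using acc by blast
    then show "x \<in> gp4_paired_domination"
      unfolding separator_verifier_input using X by (rule check_sound[rotated])
  qed
  then show ?thesis unfolding NP_def using M(1) M(2)[OF nz] by blast
qed

theorem theorem2: "np_complete gp4_paired_domination"
  unfolding np_complete_def using gp4_in_NP np_hard_gp4 ..

end
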